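(* The functor $$\mathsf{Crl}:((\mathsf{SSub}^{\mathsf{int}})^{\mathsf{op}},\times)\to(\mathsf{Vect},\oplus),$$ which sends a surjective submersion $a$ to the vector space $\mathsf{Crl}(a)$ and an interconnection morphism $\psi:a\to b$ to the linear map $\psi^*:\mathsf{Crl}(b)\to\mathsf{Crl}(a)$, is a lax monoidal functor.
   Context: Manifolds and maps are smooth. A surjective submersion is written $a=(a_{\mathsf{tot}}\xrightarrow{p_a}a_{\mathsf{st}})$. $\mathsf{SSub}$ is the category of surjective submersions; a morphism $f:a\to b$ is a pair of smooth maps $f_{\mathsf{tot}}:a_{\mathsf{tot}}\to b_{\mathsf{tot}}$, $f_{\mathsf{st}}:a_{\mathsf{st}}\to b_{\mathsf{st}}$ with $p_b\circ f_{\mathsf{tot}}=f_{\mathsf{st}}\circ p_a$. It has finite products, formed by multiplying total spaces, state spaces and submersions. An interconnection morphism is a morphism $\varphi:a\to b$ of $\mathsf{SSub}$ with $\varphi_{\mathsf{st}}$ a diffeomorphism. $\mathsf{SSub}^{\mathsf{int}}$ is the subcategory of $\mathsf{SSub}$ with all objects and with interconnection morphisms as morphisms; it is symmetric monoidal under the product $\times$ inherited from $\mathsf{SSub}$, hence so is its opposite. $\mathsf{Crl}(a)$ is the real vector space of open systems on $a$: smooth maps $F:a_{\mathsf{tot}}\to Ta_{\mathsf{st}}$ with $F(q)\in T_{p_a(q)}a_{\mathsf{st}}$ for all $q$. For an interconnection morphism $\psi:a\to b$, $\psi^*F:=T(\psi_{\mathsf{st}})^{-1}\circ F\circ\psi_{\mathsf{tot}}$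 for $F\in\mathsf{Crl}(b)$. $\mathsf{Vect}$ is the category of real vector spaces and linear maps, with monoidal product the direct sum $\oplus$. *)

theory Defs
  imports "HOL-Analysis.Analysis" "HOL-Algebra.Module"
begin

section \<open>Smooth maps between open subsets of Euclidean spaces\<close>

text \<open>The dimension has to be a term, so the space of dimension \<open>n\<close> is the library's
  \<^const>\<open>Euclidean_space\<close> \<open>n\<close>: the sequences vanishing from index \<open>n\<close> on. On the type
  \<^typ>\<open>nat \<Rightarrow> real\<close> the type class topology used by \<^const>\<open>continuous_on\<close> is the product topology,
  which induces the topology of \<^const>\<open>Euclidean_space\<close>.\<close>

definition partial :: "nat \<Rightarrow> ((nat \<Rightarrow> real) \<Rightarrow> real) \<Rightarrow> (nat \<Rightarrow> real) \<Rightarrow> real" where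
  "partial i f x = deriv (\<lambda>t. f (x(i := t))) (x i)"

text \<open>\<open>C_k_on n k U f\<close>: all partial derivatives of \<open>f\<close> up to order \<open>k\<close> in the variables
  \<open>0, \<dots>, n - 1\<close> exist and are continuous on \<open>U\<close>, an open subset of \<open>Euclidean_space n\<close>.\<close>

primrec C_k_on :: "nat \<Rightarrow> nat \<Rightarrow> (nat \<Rightarrow> real) set \<Rightarrow> ((nat \<Rightarrow> real) \<Rightarrow> real) \<Rightarrow> bool" where
  "C_k_on n 0 U f \<longleftrightarrow> continuous_on U f"
| "C_k_on n (Suc k) U f \<longleftrightarrow> continuous_on U f \<and>
     (\<forall>i<n. (\<forall>x\<in>U. (\<lambda>t. f (x(i := t))) field_differentiable (at (x i))) \<and>
            C_k_on n k U (partial i f))"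

definition C_inf_on :: "nat \<Rightarrow> (nat \<Rightarrow> real) set \<Rightarrow> ((nat \<Rightarrow> real) \<Rightarrow> (nat \<Rightarrow> real)) \<Rightarrow> bool" where
  "C_inf_on n U f \<longleftrightarrow> (\<forall>j k. C_k_on n k U (\<lambda>x. f x j))"

definition jacobian ::
    "nat \<Rightarrow> ((nat \<Rightarrow> real) \<Rightarrow> (nat \<Rightarrow> real)) \<Rightarrow> (nat \<Rightarrow> real) \<Rightarrow> (nat \<Rightarrow> real) \<Rightarrow> (nat \<Rightarrow> real)" where
  "jacobian n f x v = (\<lambda>j. \<Sum>i<n. partial i (\<lambda>y. f y j) x * v i)"

text \<open>The identification of pairs of vectors of dimensions \<open>m\<close> and \<open>n\<close> with vectors of
  dimension \<open>m + n\<close>.\<close>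

definition vec_append :: "nat \<Rightarrow> (nat \<Rightarrow> real) \<Rightarrow> (nat \<Rightarrow> real) \<Rightarrow> (nat \<Rightarrow> real)" where
  "vec_append m u v = (\<lambda>i. if i < m then u i else v (i - m))"


section \<open>Smooth manifolds\<close>

type_synonym 'p chart = "'p set \<times> ('p \<Rightarrow> nat \<Rightarrow> real)"

abbreviation chart_dom :: "'p chart \<Rightarrow> 'p set" where "chart_dom \<equiv> fst"
abbreviation chart_map :: "'p chart \<Rightarrow> 'p \<Rightarrow> nat \<Rightarrow> real" where "chart_map \<equiv> snd"

definition chart_inv :: "'p chart \<Rightarrow> (nat \<Rightarrow> real) \<Rightarrow> 'p" where
  "chart_inv c = inv_into (chart_dom c) (chart_map c)"

definition is_chart :: "'p topology \<Rightarrow> nat \<Rightarrow> 'p chart \<Rightarrow> bool" where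
  "is_chart X n c \<longleftrightarrow>
     openin X (chart_dom c) \<and>
     openin (Euclidean_space n) (chart_map c ` chart_dom c) \<and>
     homeomorphic_map (subtopology X (chart_dom c))
       (subtopology (Euclidean_space n) (chart_map c ` chart_dom c)) (chart_map c)"

definition compatible :: "nat \<Rightarrow> 'p chart \<Rightarrow> 'p chart \<Rightarrow> bool" where
  "compatible n c d \<longleftrightarrow>
     C_inf_on n (chart_map c ` (chart_dom c \<inter> chart_dom d)) (chart_map d \<circ> chart_inv c) \<and>
     C_inf_on n (chart_map d ` (chart_dom c \<inter> chart_dom d)) (chart_map c \<circ> chart_inv d)"

record 'p manifold =
  space_top :: "'p topology"
  mdim :: nat
  charts :: "'p chart set"

abbreviation points :: "'p manifold \<Rightarrow> 'p set" where
  "points M \<equiv> topspace (space_top M)"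

text \<open>Manifolds are Hausdorff, second countable, without boundary, of a fixed dimension, and
  the atlas is maximal.\<close>

definition smooth_manifold :: "'p manifold \<Rightarrow> bool" where
  "smooth_manifold M \<longleftrightarrow>
     Hausdorff_space (space_top M) \<and> second_countable (space_top M) \<and>
     (\<forall>c\<in>charts M. is_chart (space_top M) (mdim M) c) \<and>
     (\<Union>c\<in>charts M. chart_dom c) = points M \<and>
     (\<forall>c\<in>charts M. \<forall>d\<in>charts M. compatible (mdim M) c d) \<and>
     (\<forall>c. is_chart (space_top M) (mdim M) c \<and> (\<forall>d\<in>charts M. compatible (mdim M) c d) \<longrightarrow>
          c \<in> charts M)"

text \<open>The maximal atlas determined by an atlas \<open>A\<close>.\<close>

definition manifold_of_atlas :: "'p topology \<Rightarrow> nat \<Rightarrow> 'p chart set \<Rightarrow> 'p manifold" where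
  "manifold_of_atlas X n A =
     \<lparr>space_top = X, mdim = n,
      charts = {c. is_chart X n c \<and> (\<forall>d\<in>A. compatible n c d)}\<rparr>"

definition charts_at :: "'p manifold \<Rightarrow> 'p \<Rightarrow> 'p chart set" where
  "charts_at M p = {c \<in> charts M. p \<in> chart_dom c}"

definition smooth_map :: "'p manifold \<Rightarrow> 'q manifold \<Rightarrow> ('p \<Rightarrow> 'q) \<Rightarrow> bool" where
  "smooth_map M N f \<longleftrightarrow> f ` points M \<subseteq> points N \<and>
     (\<forall>p\<in>points M. \<exists>c\<in>charts_at M p. \<exists>d\<in>charts_at N (f p).
        f ` chart_dom c \<subseteq> chart_dom d \<and>
        C_inf_on (mdim M) (chart_map c ` chart_dom c) (chart_map d \<circ> f \<circ> chart_inv c))"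

definition diffeomorphism :: "'p manifold \<Rightarrow> 'q manifold \<Rightarrow> ('p \<Rightarrow> 'q) \<Rightarrow> bool" where
  "diffeomorphism M N f \<longleftrightarrow>
     smooth_map M N f \<and> bij_betw f (points M) (points N) \<and>
     smooth_map N M (inv_into (points M) f)"


section \<open>Tangent bundle\<close>

text \<open>A tangent vector at \<open>p\<close> is given by its coordinate vectors in all charts around \<open>p\<close>,
  which are related by the Jacobians of the transition maps; the value \<open>0\<close> at all other
  charts makes the representation unique and the operations pointwise.\<close>

type_synonym 'p tvec = "'p chart \<Rightarrow> nat \<Rightarrow> real"

definition tangent_space :: "'p manifold \<Rightarrow> 'p \<Rightarrow> 'p tvec set" where
  "tangent_space M p =
     {v. (\<forall>c. c \<notin> charts_at M p \<longrightarrow> v c = (\<lambda>_. 0)) \<and>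
         (\<forall>c\<in>charts_at M p. v c \<in> topspace (Euclidean_space (mdim M))) \<and>
         (\<forall>c\<in>charts_at M p. \<forall>d\<in>charts_at M p.
            v d = jacobian (mdim M) (chart_map d \<circ> chart_inv c) (chart_map c p) (v c))}"

definition tangent_points :: "'p manifold \<Rightarrow> ('p \<times> 'p tvec) set" where
  "tangent_points M = Sigma (points M) (tangent_space M)"

definition tangent_chart :: "'p manifold \<Rightarrow> 'p chart \<Rightarrow> ('p \<times> 'p tvec) chart" where
  "tangent_chart M c =
     (Sigma (chart_dom c) (tangent_space M),
      \<lambda>(p, v). vec_append (mdim M) (chart_map c p) (v c))"

definition tangent_topology :: "'p manifold \<Rightarrow> ('p \<times> 'p tvec) topology" where
  "tangent_topology M = topology (\<lambda>W. W \<subseteq> tangent_points M \<and>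
     (\<forall>c\<in>charts M. openin (Euclidean_space (2 * mdim M))
        (chart_map (tangent_chart M c) ` (W \<inter> chart_dom (tangent_chart M c)))))"

definition tangent_bundle :: "'p manifold \<Rightarrow> ('p \<times> 'p tvec) manifold" where
  "tangent_bundle M =
     manifold_of_atlas (tangent_topology M) (2 * mdim M) (tangent_chart M ` charts M)"

text \<open>The tangent map \<open>Tf\<close>, computed in an arbitrary chart of \<open>M\<close> at the base point.\<close>

definition tangent_map ::
    "'p manifold \<Rightarrow> 'q manifold \<Rightarrow> ('p \<Rightarrow> 'q) \<Rightarrow> 'p \<times> 'p tvec \<Rightarrow> 'q \<times> 'q tvec" where
  "tangent_map M N f = (\<lambda>(p, v).
     (f p, \<lambda>d. if d \<in> charts_at N (f p)
               then let c = (SOME c. c \<in> charts_at M p)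
                    in jacobian (mdim M) (chart_map d \<circ> f \<circ> chart_inv c) (chart_map c p) (v c)
               else (\<lambda>_. 0)))"

definition surjective_submersion :: "'p manifold \<Rightarrow> 'q manifold \<Rightarrow> ('p \<Rightarrow> 'q) \<Rightarrow> bool" where
  "surjective_submersion M N f \<longleftrightarrow>
     smooth_map M N f \<and> f ` points M = points N \<and>
     (\<forall>p\<in>points M. tangent_map M N f ` ({p} \<times> tangent_space M p)
                     = {f p} \<times> tangent_space N (f p))"


section \<open>Products of manifolds\<close>

text \<open>The objects of a category live in one type, which therefore has to be closed under
  pairing: we use finite binary trees over an arbitrary type \<open>'a\<close>. Up to isomorphism every
  family of manifolds on subsets of \<open>'a\<close> occurs, via \<open>Atom\<close>, and \<open>{Pt}\<close> is the one-point
  manifold. The same device is used for vector spaces and direct sums.\<close>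

datatype 'a tup = Pt | Atom 'a | Tup (tfst: "'a tup") (tsnd: "'a tup")

definition tup_times :: "'a tup set \<Rightarrow> 'a tup set \<Rightarrow> 'a tup set" where
  "tup_times A B = {Tup x y | x y. x \<in> A \<and> y \<in> B}"

definition tup_map :: "('a tup \<Rightarrow> 'b tup) \<Rightarrow> ('a tup \<Rightarrow> 'b tup) \<Rightarrow> 'a tup \<Rightarrow> 'b tup" where
  "tup_map f g z = Tup (f (tfst z)) (g (tsnd z))"

definition tup_assoc :: "'a tup \<Rightarrow> 'a tup" where
  "tup_assoc z = Tup (tfst (tfst z)) (Tup (tsnd (tfst z)) (tsnd z))"

definition tup_prod_topology :: "'a tup topology \<Rightarrow> 'a tup topology \<Rightarrow> 'a tup topology" where
  "tup_prod_topology X Y =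
     pullback_topology (tup_times (topspace X) (topspace Y)) (\<lambda>z. (tfst z, tsnd z))
       (prod_topology X Y)"

definition prod_chart :: "nat \<Rightarrow> 'a tup chart \<Rightarrow> 'a tup chart \<Rightarrow> 'a tup chart" where
  "prod_chart m c d =
     (tup_times (chart_dom c) (chart_dom d),
      \<lambda>z. vec_append m (chart_map c (tfst z)) (chart_map d (tsnd z)))"

definition prod_manifold :: "'a tup manifold \<Rightarrow> 'a tup manifold \<Rightarrow> 'a tup manifold" where
  "prod_manifold M N =
     manifold_of_atlas (tup_prod_topology (space_top M) (space_top N)) (mdim M + mdim N)
       {prod_chart (mdim M) c d | c d. c \<in> charts M \<and> d \<in> charts N}"

definition point_manifold :: "'a tup manifold" where
  "point_manifold = manifold_of_atlas (discrete_topology {Pt}) 0 {({Pt}, \<lambda>_ _. 0)}"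


section \<open>Monoidal categories and lax monoidal functors\<close>

record ('o, 'm) category =
  Obj :: "'o set"
  Arr :: "'m set"
  Dom :: "'m \<Rightarrow> 'o"
  Cod :: "'m \<Rightarrow> 'o"
  Ide :: "'o \<Rightarrow> 'm"
  Comp :: "'m \<Rightarrow> 'm \<Rightarrow> 'm"  (infixr "\<cdot>\<index>" 55)

definition hom_set :: "('o, 'm, 'x) category_scheme \<Rightarrow> 'o \<Rightarrow> 'o \<Rightarrow> 'm set" where
  "hom_set C a b = {f \<in> Arr C. Dom C f = a \<and> Cod C f = b}"

locale category =
  fixes C :: "('o, 'm, 'x) category_scheme" (structure)
  assumes dom_cod: "f \<in> Arr C \<Longrightarrow> Dom C f \<in> Obj C \<and> Cod C f \<in> Obj C"
    and ide_in_hom: "a \<in> Obj C \<Longrightarrow> Ide C a \<in> hom_set C a a"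
    and comp_in_hom: "\<lbrakk>f \<in> hom_set C a b; g \<in> hom_set C b c\<rbrakk> \<Longrightarrow> g \<cdot> f \<in> hom_set C a c"
    and comp_ide: "f \<in> hom_set C a b \<Longrightarrow> f \<cdot> Ide C a = f"
    and ide_comp: "f \<in> hom_set C a b \<Longrightarrow> Ide C b \<cdot> f = f"
    and comp_assoc: "\<lbrakk>f \<in> hom_set C a b; g \<in> hom_set C b c; h \<in> hom_set C c d\<rbrakk>
      \<Longrightarrow> (h \<cdot> g) \<cdot> f = h \<cdot> (g \<cdot> f)"

definition inverse_arrows :: "('o, 'm, 'x) category_scheme \<Rightarrow> 'm \<Rightarrow> 'm \<Rightarrow> bool" where
  "inverse_arrows C f g \<longleftrightarrow>
     f \<in> Arr C \<and> g \<in> hom_set C (Cod C f) (Dom C f) \<and>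
     g \<cdot>\<^bsub>C\<^esub> f = Ide C (Dom C f) \<and> f \<cdot>\<^bsub>C\<^esub> g = Ide C (Cod C f)"

definition iso_arrow :: "('o, 'm, 'x) category_scheme \<Rightarrow> 'm \<Rightarrow> bool" where
  "iso_arrow C f \<longleftrightarrow> (\<exists>g. inverse_arrows C f g)"

definition inverse_arrow :: "('o, 'm, 'x) category_scheme \<Rightarrow> 'm \<Rightarrow> 'm" where
  "inverse_arrow C f = (THE g. inverse_arrows C f g)"

record ('o, 'm) monoidal = "('o, 'm) category" +
  tensor :: "'o \<Rightarrow> 'o \<Rightarrow> 'o"  (infixr "\<boxtimes>\<index>" 65)
  tensor_arr :: "'m \<Rightarrow> 'm \<Rightarrow> 'm"  (infixr "\<boxdot>\<index>" 65)
  unit :: 'o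
  associator :: "'o \<Rightarrow> 'o \<Rightarrow> 'o \<Rightarrow> 'm"
  left_unitor :: "'o \<Rightarrow> 'm"
  right_unitor :: "'o \<Rightarrow> 'm"

locale monoidal_category = category C
  for C :: "('o, 'm, 'x) monoidal_scheme" (structure) +
  assumes tensor_obj: "\<lbrakk>a \<in> Obj C; b \<in> Obj C\<rbrakk> \<Longrightarrow> a \<boxtimes> b \<in> Obj C"
    and tensor_in_hom: "\<lbrakk>f \<in> hom_set C a a'; g \<in> hom_set C b b'\<rbrakk>
      \<Longrightarrow> f \<boxdot> g \<in> hom_set C (a \<boxtimes> b) (a' \<boxtimes> b')"
    and tensor_ide: "\<lbrakk>a \<in> Obj C; b \<in> Obj C\<rbrakk> \<Longrightarrow> Ide C a \<boxdot> Ide C b = Ide C (a \<boxtimes> b)"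
    and tensor_comp: "\<lbrakk>f \<in> hom_set C a a'; f' \<in> hom_set C a' a'';
        g \<in> hom_set C b b'; g' \<in> hom_set C b' b''\<rbrakk>
      \<Longrightarrow> (f' \<cdot> f) \<boxdot> (g' \<cdot> g) = (f' \<boxdot> g') \<cdot> (f \<boxdot> g)"
    and unit_obj: "unit C \<in> Obj C"
    and associator_in_hom: "\<lbrakk>a \<in> Obj C; b \<in> Obj C; c \<in> Obj C\<rbrakk>
      \<Longrightarrow> associator C a b c \<in> hom_set C ((a \<boxtimes> b) \<boxtimes> c) (a \<boxtimes> (b \<boxtimes> c))"
    and associator_iso: "\<lbrakk>a \<in> Obj C; b \<in> Obj C; c \<in> Obj C\<rbrakk> \<Longrightarrow> iso_arrow C (associator C a b c)"
    and associator_natural: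
      "\<lbrakk>f \<in> hom_set C a a'; g \<in> hom_set C b b'; h \<in> hom_set C c c'\<rbrakk>
      \<Longrightarrow> associator C a' b' c' \<cdot> ((f \<boxdot> g) \<boxdot> h) = (f \<boxdot> (g \<boxdot> h)) \<cdot> associator C a b c"
    and left_unitor_in_hom: "a \<in> Obj C \<Longrightarrow> left_unitor C a \<in> hom_set C (unit C \<boxtimes> a) a"
    and left_unitor_iso: "a \<in> Obj C \<Longrightarrow> iso_arrow C (left_unitor C a)"
    and left_unitor_natural: "f \<in> hom_set C a a'
      \<Longrightarrow> left_unitor C a' \<cdot> (Ide C (unit C) \<boxdot> f) = f \<cdot> left_unitor C a"
    and right_unitor_in_hom: "a \<in> Obj C \<Longrightarrow> right_unitor C a \<in> hom_set C (a \<boxtimes> unit C) a"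
    and right_unitor_iso: "a \<in> Obj C \<Longrightarrow> iso_arrow C (right_unitor C a)"
    and right_unitor_natural: "f \<in> hom_set C a a'
      \<Longrightarrow> right_unitor C a' \<cdot> (f \<boxdot> Ide C (unit C)) = f \<cdot> right_unitor C a"
    and pentagon: "\<lbrakk>a \<in> Obj C; b \<in> Obj C; c \<in> Obj C; d \<in> Obj C\<rbrakk>
      \<Longrightarrow> associator C a b (c \<boxtimes> d) \<cdot> associator C (a \<boxtimes> b) c d
        = (Ide C a \<boxdot> associator C b c d) \<cdot> associator C a (b \<boxtimes> c) d
            \<cdot> (associator C a b c \<boxdot> Ide C d)"
    and triangle: "\<lbrakk>a \<in> Obj C; b \<in> Obj C\<rbrakk>
      \<Longrightarrow> (Ide C a \<boxdot> left_unitor C b) \<cdot> associator C a (unit C) b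
        = right_unitor C a \<boxdot> Ide C b"

definition opposite :: "('o, 'm) monoidal \<Rightarrow> ('o, 'm) monoidal" where
  "opposite C =
     \<lparr>Obj = Obj C, Arr = Arr C, Dom = Cod C, Cod = Dom C, Ide = Ide C,
      Comp = (\<lambda>g f. f \<cdot>\<^bsub>C\<^esub> g),
      tensor = tensor C, tensor_arr = tensor_arr C, unit = unit C,
      associator = (\<lambda>a b c. inverse_arrow C (associator C a b c)),
      left_unitor = (\<lambda>a. inverse_arrow C (left_unitor C a)),
      right_unitor = (\<lambda>a. inverse_arrow C (right_unitor C a))\<rparr>"

locale category_functor = C: category C + D: category D
  for C :: "('o, 'm, 'x) category_scheme" and D :: "('p, 'n, 'y) category_scheme" +
  fixes FO :: "'o \<Rightarrow> 'p" and FA :: "'m \<Rightarrow> 'n"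
  assumes obj: "a \<in> Obj C \<Longrightarrow> FO a \<in> Obj D"
    and arr: "f \<in> hom_set C a b \<Longrightarrow> FA f \<in> hom_set D (FO a) (FO b)"
    and ide: "a \<in> Obj C \<Longrightarrow> FA (Ide C a) = Ide D (FO a)"
    and comp: "\<lbrakk>f \<in> hom_set C a b; g \<in> hom_set C b c\<rbrakk> \<Longrightarrow> FA (g \<cdot>\<^bsub>C\<^esub> f) = FA g \<cdot>\<^bsub>D\<^esub> FA f"

locale lax_monoidal_functor =
  C: monoidal_category C + D: monoidal_category D + category_functor C D FO FA
  for C :: "('o, 'm, 'x) monoidal_scheme" and D :: "('p, 'n, 'y) monoidal_scheme"
    and FO :: "'o \<Rightarrow> 'p" and FA :: "'m \<Rightarrow> 'n" +
  fixes \<epsilon> :: 'n and \<mu> :: "'o \<Rightarrow> 'o \<Rightarrow> 'n"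
  assumes unit_in_hom: "\<epsilon> \<in> hom_set D (unit D) (FO (unit C))"
    and mult_in_hom: "\<lbrakk>a \<in> Obj C; b \<in> Obj C\<rbrakk>
      \<Longrightarrow> \<mu> a b \<in> hom_set D (FO a \<boxtimes>\<^bsub>D\<^esub> FO b) (FO (a \<boxtimes>\<^bsub>C\<^esub> b))"
    and mult_natural: "\<lbrakk>f \<in> hom_set C a a'; g \<in> hom_set C b b'\<rbrakk>
      \<Longrightarrow> \<mu> a' b' \<cdot>\<^bsub>D\<^esub> (FA f \<boxdot>\<^bsub>D\<^esub> FA g) = FA (f \<boxdot>\<^bsub>C\<^esub> g) \<cdot>\<^bsub>D\<^esub> \<mu> a b"
    and mult_assoc: "\<lbrakk>a \<in> Obj C; b \<in> Obj C; c \<in> Obj C\<rbrakk>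
      \<Longrightarrow> FA (associator C a b c) \<cdot>\<^bsub>D\<^esub> \<mu> (a \<boxtimes>\<^bsub>C\<^esub> b) c \<cdot>\<^bsub>D\<^esub> (\<mu> a b \<boxdot>\<^bsub>D\<^esub> Ide D (FO c))
        = \<mu> a (b \<boxtimes>\<^bsub>C\<^esub> c) \<cdot>\<^bsub>D\<^esub> (Ide D (FO a) \<boxdot>\<^bsub>D\<^esub> \<mu> b c)
            \<cdot>\<^bsub>D\<^esub> associator D (FO a) (FO b) (FO c)"
    and mult_unit_left: "a \<in> Obj C
      \<Longrightarrow> FA (left_unitor C a) \<cdot>\<^bsub>D\<^esub> \<mu> (unit C) a \<cdot>\<^bsub>D\<^esub> (\<epsilon> \<boxdot>\<^bsub>D\<^esub> Ide D (FO a))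
        = left_unitor D (FO a)"
    and mult_unit_right: "a \<in> Obj C
      \<Longrightarrow> FA (right_unitor C a) \<cdot>\<^bsub>D\<^esub> \<mu> a (unit C) \<cdot>\<^bsub>D\<^esub> (Ide D (FO a) \<boxdot>\<^bsub>D\<^esub> \<epsilon>)
        = right_unitor D (FO a)"

text \<open>Arrows of concrete categories remember source and target; the underlying functions are
  made extensional, so that equality of arrows is equality of maps on the carriers.\<close>

record ('o, 'f) arrow =
  source :: 'o
  target :: 'o
  action :: 'f


section \<open>The category of surjective submersions\<close>

record 'p ssub =
  total :: "'p tup manifold"
  state :: "'p tup manifold"
  subm :: "'p tup \<Rightarrow> 'p tup"

definition is_ssub :: "'p ssub \<Rightarrow> bool" where
  "is_ssub a \<longleftrightarrow>
     smooth_manifold (total a) \<and> smooth_manifold (state a) \<and>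
     subm a \<in> extensional (points (total a)) \<and>
     surjective_submersion (total a) (state a) (subm a)"

type_synonym 'p ssub_arrow =
  "('p ssub, ('p tup \<Rightarrow> 'p tup) \<times> ('p tup \<Rightarrow> 'p tup)) arrow"

abbreviation tot_map :: "'p ssub_arrow \<Rightarrow> 'p tup \<Rightarrow> 'p tup" where
  "tot_map f \<equiv> fst (action f)"

abbreviation st_map :: "'p ssub_arrow \<Rightarrow> 'p tup \<Rightarrow> 'p tup" where
  "st_map f \<equiv> snd (action f)"

definition is_ssub_arrow :: "'p ssub_arrow \<Rightarrow> bool" where
  "is_ssub_arrow f \<longleftrightarrow>
     (let a = source f; b = target f in
        is_ssub a \<and> is_ssub b \<and>
        tot_map f \<in> extensional (points (total a)) \<and>
        st_map f \<in> extensional (points (state a)) \<and>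
        smooth_map (total a) (total b) (tot_map f) \<and>
        smooth_map (state a) (state b) (st_map f) \<and>
        (\<forall>q\<in>points (total a). subm b (tot_map f q) = st_map f (subm a q)))"

definition mk_ssub_arrow ::
    "'p ssub \<Rightarrow> 'p ssub \<Rightarrow> ('p tup \<Rightarrow> 'p tup) \<Rightarrow> ('p tup \<Rightarrow> 'p tup) \<Rightarrow> 'p ssub_arrow" where
  "mk_ssub_arrow a b f g =
     \<lparr>source = a, target = b,
      action = (restrict f (points (total a)), restrict g (points (state a)))\<rparr>"

definition ssub_prod :: "'p ssub \<Rightarrow> 'p ssub \<Rightarrow> 'p ssub" where
  "ssub_prod a b =
     \<lparr>total = prod_manifold (total a) (total b),
      state = prod_manifold (state a) (state b),
      subm = restrict (tup_map (subm a) (subm b))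
               (points (prod_manifold (total a) (total b)))\<rparr>"

definition ssub_unit :: "'p ssub" where
  "ssub_unit =
     \<lparr>total = point_manifold, state = point_manifold,
      subm = restrict id (points point_manifold)\<rparr>"

definition SSub :: "('p ssub, 'p ssub_arrow) monoidal" where
  "SSub =
     \<lparr>Obj = {a. is_ssub a},
      Arr = {f. is_ssub_arrow f},
      Dom = source,
      Cod = target,
      Ide = (\<lambda>a. mk_ssub_arrow a a id id),
      Comp = (\<lambda>g f. mk_ssub_arrow (source f) (target g)
                      (tot_map g \<circ> tot_map f) (st_map g \<circ> st_map f)),
      tensor = ssub_prod,
      tensor_arr = (\<lambda>f g. mk_ssub_arrow
                      (ssub_prod (source f) (source g)) (ssub_prod (target f) (target g))
                      (tup_map (tot_map f) (tot_map g)) (tup_map (st_map f) (st_map g))),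
      unit = ssub_unit,
      associator = (\<lambda>a b c. mk_ssub_arrow
                      (ssub_prod (ssub_prod a b) c) (ssub_prod a (ssub_prod b c))
                      tup_assoc tup_assoc),
      left_unitor = (\<lambda>a. mk_ssub_arrow (ssub_prod ssub_unit a) a tsnd tsnd),
      right_unitor = (\<lambda>a. mk_ssub_arrow (ssub_prod a ssub_unit) a tfst tfst)\<rparr>"

definition interconnection :: "'p ssub_arrow \<Rightarrow> bool" where
  "interconnection f \<longleftrightarrow>
     is_ssub_arrow f \<and> diffeomorphism (state (source f)) (state (target f)) (st_map f)"

definition SSub_int :: "('p ssub, 'p ssub_arrow) monoidal" where
  "SSub_int = SSub\<lparr>Arr := {f. interconnection f}\<rparr>"


section \<open>Real vector spaces\<close>

definition real_field :: "real ring" where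
  "real_field = \<lparr>carrier = UNIV, monoid.mult = (*), one = 1, zero = 0, add = (+)\<rparr>"

text \<open>A real vector space is a module over the field of reals. The fields \<open>mult\<close> and \<open>one\<close>
  that the record of modules inherits from rings play no role.\<close>

type_synonym 'v vect = "(real, 'v tup) module"
type_synonym 'v vect_arrow = "('v vect, 'v tup \<Rightarrow> 'v tup) arrow"

definition linear_map :: "'v vect \<Rightarrow> 'v vect \<Rightarrow> ('v tup \<Rightarrow> 'v tup) \<Rightarrow> bool" where
  "linear_map V W f \<longleftrightarrow>
     f \<in> carrier V \<rightarrow> carrier W \<and>
     (\<forall>x\<in>carrier V. \<forall>y\<in>carrier V. f (x \<oplus>\<^bsub>V\<^esub> y) = f x \<oplus>\<^bsub>W\<^esub> f y) \<and>
     (\<forall>r. \<forall>x\<in>carrier V. f (r \<odot>\<^bsub>V\<^esub> x) = r \<odot>\<^bsub>W\<^esub> f x)"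

definition is_vect_arrow :: "'v vect_arrow \<Rightarrow> bool" where
  "is_vect_arrow f \<longleftrightarrow>
     module real_field (source f) \<and> module real_field (target f) \<and>
     action f \<in> extensional (carrier (source f)) \<and>
     linear_map (source f) (target f) (action f)"

definition mk_vect_arrow :: "'v vect \<Rightarrow> 'v vect \<Rightarrow> ('v tup \<Rightarrow> 'v tup) \<Rightarrow> 'v vect_arrow" where
  "mk_vect_arrow V W f = \<lparr>source = V, target = W, action = restrict f (carrier V)\<rparr>"

definition direct_sum :: "'v vect \<Rightarrow> 'v vect \<Rightarrow> 'v vect" where
  "direct_sum V W =
     \<lparr>carrier = tup_times (carrier V) (carrier W),
      monoid.mult = undefined, one = undefined,
      zero = Tup \<zero>\<^bsub>V\<^esub> \<zero>\<^bsub>W\<^esub>,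
      add = (\<lambda>x y. Tup (tfst x \<oplus>\<^bsub>V\<^esub> tfst y) (tsnd x \<oplus>\<^bsub>W\<^esub> tsnd y)),
      smult = (\<lambda>r x. Tup (r \<odot>\<^bsub>V\<^esub> tfst x) (r \<odot>\<^bsub>W\<^esub> tsnd x))\<rparr>"

definition zero_vect :: "'v vect" where
  "zero_vect =
     \<lparr>carrier = {Pt}, monoid.mult = undefined, one = undefined,
      zero = Pt, add = (\<lambda>_ _. Pt), smult = (\<lambda>_ _. Pt)\<rparr>"

definition Vect :: "('v vect, 'v vect_arrow) monoidal" where
  "Vect =
     \<lparr>Obj = {V. module real_field V},
      Arr = {f. is_vect_arrow f},
      Dom = source,
      Cod = target,
      Ide = (\<lambda>V. mk_vect_arrow V V id),
      Comp = (\<lambda>g f. mk_vect_arrow (source f) (target g) (action g \<circ> action f)),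
      tensor = direct_sum,
      tensor_arr = (\<lambda>f g. mk_vect_arrow
                      (direct_sum (source f) (source g)) (direct_sum (target f) (target g))
                      (tup_map (action f) (action g))),
      unit = zero_vect,
      associator = (\<lambda>U V W. mk_vect_arrow
                      (direct_sum (direct_sum U V) W) (direct_sum U (direct_sum V W)) tup_assoc),
      left_unitor = (\<lambda>V. mk_vect_arrow (direct_sum zero_vect V) V tsnd),
      right_unitor = (\<lambda>V. mk_vect_arrow (direct_sum V zero_vect) V tfst)\<rparr>"


section \<open>Open systems\<close>

type_synonym 'p osys = "'p tup \<Rightarrow> 'p tup \<times> 'p tup tvec"

definition open_systems :: "'p ssub \<Rightarrow> 'p osys set" where
  "open_systems a =
     {F \<in> extensional (points (total a)).
        smooth_map (total a) (tangent_bundle (state a)) F \<and>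
        (\<forall>q\<in>points (total a). F q \<in> {subm a q} \<times> tangent_space (state a) (subm a q))}"

definition osys_zero :: "'p ssub \<Rightarrow> 'p osys" where
  "osys_zero a = (\<lambda>q\<in>points (total a). (subm a q, \<lambda>_ _. 0))"

definition osys_add :: "'p ssub \<Rightarrow> 'p osys \<Rightarrow> 'p osys \<Rightarrow> 'p osys" where
  "osys_add a F G =
     (\<lambda>q\<in>points (total a). (subm a q, \<lambda>c i. snd (F q) c i + snd (G q) c i))"

definition osys_scale :: "'p ssub \<Rightarrow> real \<Rightarrow> 'p osys \<Rightarrow> 'p osys" where
  "osys_scale a r F = (\<lambda>q\<in>points (total a). (subm a q, \<lambda>c i. r * snd (F q) c i))"

text \<open>Vectors of an object of \<^const>\<open>Vect\<close> are trees, so the open system \<open>F\<close> appears as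
  \<open>Atom F\<close>; \<open>the_atom\<close> undoes this.\<close>

primrec the_atom :: "'a tup \<Rightarrow> 'a" where
  "the_atom (Atom x) = x"

definition Crl :: "'p ssub \<Rightarrow> 'p osys vect" where
  "Crl a =
     \<lparr>carrier = Atom ` open_systems a,
      monoid.mult = undefined, one = undefined,
      zero = Atom (osys_zero a),
      add = (\<lambda>x y. Atom (osys_add a (the_atom x) (the_atom y))),
      smult = (\<lambda>r x. Atom (osys_scale a r (the_atom x)))\<rparr>"

text \<open>\<open>\<psi>\<^sup>* F = T(\<psi>\<^sub>s\<^sub>t)\<^sup>-\<^sup>1 \<circ> F \<circ> \<psi>\<^sub>t\<^sub>o\<^sub>t\<close> on the total space of the source of \<open>\<psi>\<close>.\<close>

definition osys_pullback :: "'p ssub_arrow \<Rightarrow> 'p osys \<Rightarrow> 'p osys" where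
  "osys_pullback \<psi> F =
     restrict
       (inv_into (tangent_points (state (source \<psi>)))
          (tangent_map (state (source \<psi>)) (state (target \<psi>)) (st_map \<psi>))
        \<circ> F \<circ> tot_map \<psi>)
       (points (total (source \<psi>)))"

definition Crl_arr :: "'p ssub_arrow \<Rightarrow> 'p osys vect_arrow" where
  "Crl_arr \<psi> =
     mk_vect_arrow (Crl (target \<psi>)) (Crl (source \<psi>))
       (\<lambda>x. Atom (osys_pullback \<psi> (the_atom x)))"

end

theory Submission
  imports Defs
begin

text \<open>The structure map \<open>Crl a \<oplus> Crl b \<rightarrow> Crl (a \<times> b)\<close> sends \<open>(F, G)\<close> to the open system
  \<open>(x, y) \<mapsto> (F x, G y)\<close>, read in \<open>T(M \<times> N) = TM \<times> TN\<close>. As \<open>T\<psi>\<^sub>s\<^sub>t\<close> is injective, \<open>\<psi>\<^sup>*F\<close> is the only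
  \<open>H\<close> with \<open>T\<psi>\<^sub>s\<^sub>t \<circ> H = F \<circ> \<psi>\<^sub>t\<^sub>o\<^sub>t\<close>, and a tangent vector of a product is determined by its images under
  the tangent maps of the two projections. Hence naturality, associativity and the unit laws all
  reduce to the functoriality of \<open>T\<close>, that is, to the chain rule. Smoothness of a map into a manifold
  or a tangent bundle is tested on the coordinates of its values, which are real functions; sums,
  products and composites of those are controlled by the calculus of iterated partial derivatives.\<close>

section \<open>Calculus in Euclidean spaces\<close>

text \<open>Coordinate vectors have type \<open>nat => real\<close> with the product topology, which
  comes from no norm, so differentiability is expressed by partial derivatives alone and the chain
  rule is built from the one-variable mean value theorem. Two definitions by choice have to be
  removed before anything can be computed. \<open>tangent_map\<close> picks a chart at the base
  point; the coordinate change of tangent vectors makes the result independent of it.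
  \<open>osys_pullback\<close> inverts the tangent map of \<open>st_map\<close> by
  \<open>inv_into\<close>; a smooth inverse \<open>g\<close> of \<open>st_map\<close> shows that
  this inverse is the tangent map of \<open>g\<close>, for which smoothness and linearity on fibres
  are visible. In the opposite category the associator and the unitors are inverse arrows, so the
  coherence laws for \<open>Crl\<close> concern pullback along \<open>tup_unassoc\<close> and along
  the maps that insert the point \<open>Pt\<close> on the left or on the right.\<close>

abbreviation Eucl :: "nat \<Rightarrow> (nat \<Rightarrow> real) set" where
  "Eucl n \<equiv> topspace (Euclidean_space n)"

section \<open>Open subsets of Euclidean space\<close>

lemma Eucl_iff: "x \<in> Eucl n \<longleftrightarrow> (\<forall>i\<ge>n. x i = 0)"
  by (simp add: topspace_Euclidean_space)

lemma openin_Euclidean_space: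
  "openin (Euclidean_space n) U \<longleftrightarrow> (\<exists>T. open T \<and> U = T \<inter> Eucl n)"
  unfolding topspace_Euclidean_space
  by (simp add: Euclidean_space_def openin_subtopology euclidean_product_topology)

text \<open>Two points of \<open>Eucl n\<close> agree from index \<open>n\<close> on, so only
  \<open>n\<close> of the coordinate neighbourhoods of the product topology matter and their radii
  have a positive minimum. In this form an open set can be explored by moving single
  coordinates.\<close>

lemma openin_Euclidean_space_box:
  "openin (Euclidean_space n) U \<longleftrightarrow>
     U \<subseteq> Eucl n \<and> (\<forall>x\<in>U. \<exists>e>0. \<forall>y\<in>Eucl n. (\<forall>i<n. \<bar>y i - x i\<bar> < e) \<longrightarrow> y \<in> U)"
    (is "_ \<longleftrightarrow> ?R")
proof
  assume L: "openin (Euclidean_space n) U"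
  then obtain T where T: "open T" "U = T \<inter> Eucl n"
    by (auto simp: openin_Euclidean_space)
  have "\<exists>e>0. \<forall>y\<in>Eucl n. (\<forall>i<n. \<bar>y i - x i\<bar> < e) \<longrightarrow> y \<in> U" if x: "x \<in> U" for x
  proof -
    obtain X where X: "x \<in> (\<Pi>\<^sub>E i\<in>UNIV. X i)" "\<And>i. open (X i)" "(\<Pi>\<^sub>E i\<in>UNIV. X i) \<subseteq> T"
      using product_topology_open_contains_basis[of "\<lambda>_. euclidean" UNIV T x] T x
      by (auto simp: open_fun_def)
    have "\<exists>e>0. \<forall>t. \<bar>t - x i\<bar> < e \<longrightarrow> t \<in> X i" for i
      using X(1) X(2)[of i] by (auto simp: dist_real_def PiE_iff open_dist)
    then obtain e where e: "\<And>i. e i > 0" "\<And>i t. \<bar>t - x i\<bar> < e i \<Longrightarrow> t \<in> X i"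
      by metis
    \<comment> \<open>The element 1 keeps the set nonempty when \<open>n = 0\<close>.\<close>
    define d where "d = Min (insert 1 (e ` {..<n}))"
    have d: "d > 0" "\<And>i. i < n \<Longrightarrow> d \<le> e i"
      using e(1) by (auto simp: d_def intro: Min_le)
    have "y \<in> U" if y: "y \<in> Eucl n" "\<forall>i<n. \<bar>y i - x i\<bar> < d" for y
    proof -
      have "y i \<in> X i" for i
      proof (cases "i < n")
        case True
        then show ?thesis using y d(2)[of i] by (intro e) force
      next
        case False
        then have "y i = x i" using y x T by (auto simp: Eucl_iff)
        then show ?thesis using X(1) by (auto simp: PiE_iff)
      qed
      then show ?thesis using X(3) T y by (auto simp: PiE_iff)
    qed
    then show ?thesis using d by blast
  qed
  then show ?R using L openin_subset by blast
next
  assume R: ?R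
  show "openin (Euclidean_space n) U"
  proof (subst openin_subopen, clarify)
    fix x assume "x \<in> U"
    then obtain e where e: "e > 0" "\<And>y. y \<in> Eucl n \<Longrightarrow> (\<forall>i<n. \<bar>y i - x i\<bar> < e) \<Longrightarrow> y \<in> U"
      using R by blast
    \<comment> \<open>The \<open>id\<close> brings the set into the form required by
      \<open>product_topology_basis'\<close>.\<close>
    let ?T = "{y :: nat \<Rightarrow> real. \<forall>i\<in>{..<n}. y (id i) \<in> {x i - e<..<x i + e}}"
    have "open ?T" by (rule product_topology_basis') auto
    moreover have "?T \<inter> Eucl n \<subseteq> U"
    proof (clarify, rule e(2), assumption, intro allI impI)
      fix y i assume "\<forall>i\<in>{..<n}. y (id i) \<in> {x i - e<..<x i + e}" "i < n"
      then have "y i \<in> {x i - e<..<x i + e}" by auto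
      then show "\<bar>y i - x i\<bar> < e" by auto
    qed
    ultimately show "\<exists>T. openin (Euclidean_space n) T \<and> x \<in> T \<and> T \<subseteq> U"
      using \<open>x \<in> U\<close> R e(1) by (intro exI[of _ "?T \<inter> Eucl n"]) (auto simp: openin_Euclidean_space)
  qed
qed

text \<open>A bridge between two notions: \<open>continuous_on\<close> refers to the type class
  topology of all sequences, whereas the open sets of charts are those of
  \<open>Euclidean_space\<close>.\<close>

lemma continuous_on_open_vimage_Eucl:
  fixes f :: "(nat \<Rightarrow> real) \<Rightarrow> nat \<Rightarrow> real"
  assumes "openin (Euclidean_space n) U" "continuous_on U f" "f ` U \<subseteq> Eucl m"
    "openin (Euclidean_space m) V"
  shows "openin (Euclidean_space n) {x \<in> U. f x \<in> V}"
proof -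
  obtain T where T: "open T" "V = T \<inter> Eucl m" using assms by (auto simp: openin_Euclidean_space)
  obtain S where S: "open S" "U = S \<inter> Eucl n" using assms by (auto simp: openin_Euclidean_space)
  obtain A where A: "open A" "A \<inter> U = f -` T \<inter> U"
    using assms(2) T(1) by (auto simp: continuous_on_open_invariant)
  have "{x \<in> U. f x \<in> V} = (A \<inter> S) \<inter> Eucl n"
    using A(2) S T assms(3) by auto
  then show ?thesis using A S by (auto simp: openin_Euclidean_space)
qed

lemma Eucl_upd: "x \<in> Eucl n \<Longrightarrow> i < n \<Longrightarrow> x(i := t) \<in> Eucl n"
  by (auto simp: Eucl_iff)

text \<open>A partial derivative sees only the line through \<open>x\<close> in direction
  \<open>i\<close>. Since nearby points of that line stay in an open \<open>U\<close>, functions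
  that agree on \<open>U\<close> have the same partial derivatives on \<open>U\<close>, whatever
  they do outside.\<close>

lemma eventually_upd:
  assumes U: "openin (Euclidean_space n) U" "x \<in> U" and i: "i < n"
  shows "\<forall>\<^sub>F t in nhds (x i). x(i := t) \<in> U"
proof -
  obtain e where e: "e > 0" "\<And>y. y \<in> Eucl n \<Longrightarrow> (\<forall>i<n. \<bar>y i - x i\<bar> < e) \<Longrightarrow> y \<in> U"
    using U by (auto simp: openin_Euclidean_space_box)
  have "x(i := t) \<in> U" if "dist t (x i) < e" for t
    using e that U i openin_subset[OF U(1)] by (intro e(2) Eucl_upd) (auto simp: dist_real_def)
  then show ?thesis using e(1) by (auto simp: eventually_nhds_metric)
qed

section \<open>Functions with continuous partial derivatives\<close>

lemma C_k_on_imp_continuous: "C_k_on n k U f \<Longrightarrow> continuous_on U f"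
  by (cases k) auto

lemma partial_cong:
  assumes "openin (Euclidean_space n) U" "x \<in> U" "i < n" "\<And>y. y \<in> U \<Longrightarrow> f y = g y"
  shows "partial i f x = partial i g x"
  unfolding partial_def
  by (rule deriv_cong_ev) (use eventually_upd[OF assms(1-3)] assms(4) in \<open>auto elim!: eventually_mono\<close>)

lemma C_k_on_cong_imp:
  assumes "openin (Euclidean_space n) U"
  shows "(\<And>y. y \<in> U \<Longrightarrow> f y = g y) \<Longrightarrow> C_k_on n k U f \<Longrightarrow> C_k_on n k U g"
proof (induction k arbitrary: f g)
  case 0
  then show ?case by (simp cong: continuous_on_cong)
next
  case (Suc k)
  have "(\<lambda>t. g (x(i := t))) field_differentiable at (x i)" if "i < n" "x \<in> U" for i x
  proof -
    have "\<forall>\<^sub>F t in nhds (x i). f (x(i := t)) = g (x(i := t))"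
      using eventually_upd[OF assms that(2,1)] Suc.prems(1) by (auto elim!: eventually_mono)
    then have "((\<lambda>t. f (x(i := t))) has_real_derivative D) (at (x i)) \<longleftrightarrow>
        ((\<lambda>t. g (x(i := t))) has_real_derivative D) (at (x i))" for D
      by (intro DERIV_cong_ev) auto
    moreover have "(\<lambda>t. f (x(i := t))) field_differentiable at (x i)"
      using Suc.prems(2) that by simp
    ultimately show ?thesis unfolding field_differentiable_def by simp
  qed
  moreover have "C_k_on n k U (partial i g)" if "i < n" for i
  proof (rule Suc.IH)
    show "partial i f y = partial i g y" if "y \<in> U" for y
      using partial_cong[OF assms that \<open>i < n\<close>] Suc.prems(1) .
    show "C_k_on n k U (partial i f)" using Suc.prems(2) that by simp
  qed
  moreover have "continuous_on U g"
    using Suc.prems by (simp cong: continuous_on_cong)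
  ultimately show ?case by simp
qed

lemma C_k_on_cong:
  assumes "openin (Euclidean_space n) U" "\<And>y. y \<in> U \<Longrightarrow> f y = g y"
  shows "C_k_on n k U f \<longleftrightarrow> C_k_on n k U g"
  using C_k_on_cong_imp[OF assms(1), of f g] C_k_on_cong_imp[OF assms(1), of g f] assms(2) by metis

lemma C_k_on_SucD:
  assumes "C_k_on n (Suc k) U f" "i < n"
  shows "C_k_on n k U (partial i f)"
    and "x \<in> U \<Longrightarrow> ((\<lambda>t. f (x(i := t))) has_real_derivative partial i f x) (at (x i))"
  using assms by (auto simp: partial_def DERIV_deriv_iff_field_differentiable)

text \<open>The functions \<open>g i\<close> may be any formulas for the derivatives on
  \<open>U\<close>; \<open>partial i f\<close> agrees with them there, though perhaps not elsewhere.
  This is how sums, products and composites enter the recursion.\<close>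

lemma C_k_on_SucI:
  assumes U: "openin (Euclidean_space n) U" and "continuous_on U f"
    and "\<And>i. i < n \<Longrightarrow> C_k_on n k U (g i)"
    and D: "\<And>i x. i < n \<Longrightarrow> x \<in> U \<Longrightarrow> ((\<lambda>t. f (x(i := t))) has_real_derivative g i x) (at (x i))"
  shows "C_k_on n (Suc k) U f"
proof -
  have "partial i f x = g i x" if "i < n" "x \<in> U" for i x
    using D[OF that] by (simp add: partial_def DERIV_imp_deriv)
  then have "C_k_on n k U (partial i f)" if "i < n" for i
    using C_k_on_cong_imp[OF U, of "g i" "partial i f"] assms(3) that by auto
  moreover have "(\<lambda>t. f (x(i := t))) field_differentiable at (x i)" if "i < n" "x \<in> U" for i x
    using D[OF that] field_differentiable_def by blast
  ultimately show ?thesis using assms(2) by simp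
qed

lemma C_k_on_Suc_imp: "C_k_on n (Suc k) U f \<Longrightarrow> C_k_on n k U f"
  by (induction k arbitrary: f) auto

lemma C_k_on_le:
  assumes "C_k_on n k U f" "j \<le> k" shows "C_k_on n j U f"
  using assms(2,1) by (induction rule: dec_induct) (blast intro: C_k_on_Suc_imp)+

lemma C_k_on_subset: "C_k_on n k U f \<Longrightarrow> V \<subseteq> U \<Longrightarrow> C_k_on n k V f"
  by (induction k arbitrary: f) (auto intro: continuous_on_subset)

text \<open>Lets a transition map be examined near one point at a time, where it factors through a
  suitable third chart.\<close>

lemma C_k_on_local:
  assumes "\<And>x. x \<in> U \<Longrightarrow> \<exists>V. openin (Euclidean_space n) V \<and> x \<in> V \<and> C_k_on n k V f"
    and U: "U \<subseteq> Eucl n"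
  shows "C_k_on n k U f"
  using assms(1)
proof (induction k arbitrary: f)
  have cont: "continuous_on U f"
    if loc: "\<And>x. x \<in> U \<Longrightarrow> \<exists>V. openin (Euclidean_space n) V \<and> x \<in> V \<and> continuous_on V f"
    for f :: "(nat \<Rightarrow> real) \<Rightarrow> real"
    unfolding continuous_on_eq_continuous_within
  proof
    fix x assume x: "x \<in> U"
    then obtain V where V: "openin (Euclidean_space n) V" "x \<in> V" "continuous_on V f"
      using loc[OF x] by auto
    then obtain T where T: "open T" "V = T \<inter> Eucl n" by (auto simp: openin_Euclidean_space)
    have "continuous (at x within V \<inter> U) f"
      using V x by (meson IntI continuous_on_eq_continuous_within continuous_within_subset inf_le1)
    \<comment> \<open>\<open>V\<close> is cut out of \<open>Eucl n\<close> by the open set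
      \<open>T\<close>, and \<open>U\<close> lies in \<open>Eucl n\<close>, so the two sets coincide
      near \<open>x\<close>.\<close>
    moreover have "at x within V \<inter> U = at x within U"
      using V T U by (intro at_within_nhd[of x T]) auto
    ultimately show "continuous (at x within U) f" by simp
  qed
  case 0
  then show ?case using cont by auto
next
  case (Suc k)
  have "continuous_on U f" "\<And>i. i < n \<Longrightarrow> C_k_on n k U (partial i f)"
    using Suc by (metis C_k_on_imp_continuous C_k_on_Suc_imp, metis C_k_on_SucD(1))
  moreover have "(\<lambda>t. f (x(i := t))) field_differentiable at (x i)" if i: "i < n" and x: "x \<in> U" for i x
  proof -
    obtain V where "x \<in> V" "C_k_on n (Suc k) V f" using Suc.prems[OF x] by blast
    then show ?thesis using i by simp
  qed
  ultimately show ?case by simp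
qed

lemma C_k_on_const [intro]:
  assumes "openin (Euclidean_space n) U" shows "C_k_on n k U (\<lambda>_. c)"
proof (induction k arbitrary: c)
  case (Suc k)
  show ?case by (rule C_k_on_SucI[OF assms, where g = "\<lambda>_ _. 0"]) (use Suc in auto)
qed auto

lemma C_k_on_coord [intro]:
  assumes "openin (Euclidean_space n) U" shows "C_k_on n k U (\<lambda>x. x j)"
proof (cases k)
  case 0
  then show ?thesis by (auto intro: continuous_on_product_coordinates continuous_on_subset)
next
  case (Suc k)
  have "((\<lambda>t. (x(i := t)) j) has_real_derivative (if i = j then 1 else 0)) (at (x i))"
    for i and x :: "nat \<Rightarrow> real" by (cases "i = j") auto
  then show ?thesis unfolding Suc
    by (intro C_k_on_SucI[OF assms, where g = "\<lambda>i _. if i = j then 1 else 0"])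
       (use assms in \<open>auto intro: continuous_on_product_coordinates continuous_on_subset\<close>)
qed

lemma C_k_on_add [intro]:
  assumes U: "openin (Euclidean_space n) U"
  shows "C_k_on n k U f \<Longrightarrow> C_k_on n k U g \<Longrightarrow> C_k_on n k U (\<lambda>x. f x + g x)"
proof (induction k arbitrary: f g)
  case 0
  then show ?case by (auto intro: continuous_intros)
next
  case (Suc k)
  show ?case
  proof (rule C_k_on_SucI[OF U, where g = "\<lambda>i x. partial i f x + partial i g x"])
    show "continuous_on U (\<lambda>x. f x + g x)"
      using Suc.prems by (auto intro: continuous_intros)
    show "C_k_on n k U (\<lambda>x. partial i f x + partial i g x)" if "i < n" for i
      using Suc.prems[THEN C_k_on_SucD(1), OF that] by (rule Suc.IH)
    show "((\<lambda>t. f (x(i := t)) + g (x(i := t))) has_real_derivative partial i f x + partial i g x)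
        (at (x i))" if "i < n" "x \<in> U" for i x
      using Suc.prems that by (intro DERIV_add C_k_on_SucD(2)) auto
  qed
qed

lemma C_k_on_mult [intro]:
  assumes U: "openin (Euclidean_space n) U"
  shows "C_k_on n k U f \<Longrightarrow> C_k_on n k U g \<Longrightarrow> C_k_on n k U (\<lambda>x. f x * g x)"
proof (induction k arbitrary: f g)
  case 0
  then show ?case by (auto intro: continuous_intros)
next
  case (Suc k)
  show ?case
  proof (rule C_k_on_SucI[OF U, where g = "\<lambda>i x. partial i f x * g x + partial i g x * f x"])
    show "continuous_on U (\<lambda>x. f x * g x)"
      using Suc.prems by (auto intro: continuous_intros)
    \<comment> \<open>The product rule contains \<open>f\<close> and \<open>g\<close>
      undifferentiated; their order \<open>k\<close> comes from
      \<open>C_k_on_Suc_imp\<close>.\<close>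
    show "C_k_on n k U (\<lambda>x. partial i f x * g x + partial i g x * f x)" if "i < n" for i
      using Suc.prems[THEN C_k_on_Suc_imp] Suc.prems[THEN C_k_on_SucD(1), OF that]
      by (intro C_k_on_add[OF U] Suc.IH)
    show "((\<lambda>t. f (x(i := t)) * g (x(i := t))) has_real_derivative
        partial i f x * g x + partial i g x * f x) (at (x i))" if "i < n" "x \<in> U" for i x
      using DERIV_mult[OF C_k_on_SucD(2)[OF Suc.prems(1) that] C_k_on_SucD(2)[OF Suc.prems(2) that]]
      unfolding fun_upd_triv .
  qed
qed

lemma C_k_on_sum [intro]:
  assumes U: "openin (Euclidean_space n) U"
    and "\<And>i. i \<in> I \<Longrightarrow> C_k_on n k U (f i)"
  shows "C_k_on n k U (\<lambda>x. \<Sum>i\<in>I. f i x)"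
  using assms(2)
proof (induction I rule: infinite_finite_induct)
  case (insert i I)
  then have "C_k_on n k U (\<lambda>x. f i x + (\<Sum>i\<in>I. f i x))"
    by (intro C_k_on_add[OF U]) auto
  then show ?case using insert.hyps by simp
qed (simp_all add: C_k_on_const[OF U])

text \<open>Along a curve a coordinate may increase, decrease or stand still, so the two ends come
  in no fixed order. The intermediate point is located only by its distance from \<open>a\<close>,
  which is what the squeeze in \<open>has_derivative_along_curve\<close> uses.\<close>

lemma mean_value_unordered:
  fixes g :: "real \<Rightarrow> real"
  assumes "\<And>s. \<bar>s - a\<bar> \<le> \<bar>b - a\<bar> \<Longrightarrow> (g has_real_derivative g' s) (at s)"
  shows "\<exists>s. \<bar>s - a\<bar> \<le> \<bar>b - a\<bar> \<and> g b - g a = g' s * (b - a)"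
proof -
  consider "a < b" | "a = b" | "b < a" by linarith
  then show ?thesis
  proof cases
    case 1
    then obtain z where "a < z" "z < b" "g b - g a = (b - a) * g' z"
      using MVT2[of a b g g'] assms by force
    then show ?thesis by (intro exI[of _ z]) auto
  next
    case 3
    then obtain z where "b < z" "z < a" "g a - g b = (a - b) * g' z"
      using MVT2[of b a g g'] assms by force
    then show ?thesis by (intro exI[of _ z]) (auto simp: algebra_simps)
  qed auto
qed

lemma tendsto_fun_coordinatewise:
  fixes f :: "'a \<Rightarrow> 'i \<Rightarrow> 'b::topological_space"
  assumes "\<And>i. ((\<lambda>x. f x i) \<longlongrightarrow> l i) F"
  shows "(f \<longlongrightarrow> l) F"
proof -
  have "limitin (product_topology (\<lambda>_. euclidean) UNIV) f l F"
    using assms by (simp add: limitin_componentwise)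
  then show ?thesis by (simp add: euclidean_product_topology)
qed

text \<open>The curve is moved one coordinate at a time; the mean value theorem controls each step.\<close>

lemma has_derivative_along_curve:
  fixes f :: "(nat \<Rightarrow> real) \<Rightarrow> real" and \<gamma> :: "real \<Rightarrow> nat \<Rightarrow> real"
  assumes V: "openin (Euclidean_space m) V" and f: "C_k_on m (Suc 0) V f"
    and \<gamma>V: "\<forall>\<^sub>F t in nhds t0. \<gamma> t \<in> V"
    and \<gamma>: "\<And>j. j < m \<Longrightarrow> ((\<lambda>t. \<gamma> t j) has_real_derivative \<gamma>' j) (at t0)"
  shows "((\<lambda>t. f (\<gamma> t)) has_real_derivative (\<Sum>j<m. partial j f (\<gamma> t0) * \<gamma>' j)) (at t0)"
proof -
  define x0 where "x0 = \<gamma> t0"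
  have x0: "x0 \<in> V" using eventually_nhds_x_imp_x[OF \<gamma>V] by (simp add: x0_def)
  then have x0E: "x0 \<in> Eucl m" using V openin_subset by blast
  obtain e where e: "e > 0" "\<And>y. y \<in> Eucl m \<Longrightarrow> (\<forall>i<m. \<bar>y i - x0 i\<bar> < e) \<Longrightarrow> y \<in> V"
    using V x0 by (auto simp: openin_Euclidean_space_box)
  \<comment> \<open>\<open>hyb k t\<close> has its first \<open>k\<close> coordinates from the curve
    and the others from \<open>x0\<close>. It leads from \<open>x0\<close> at \<open>k = 0\<close>
    to the curve at \<open>k = m\<close>, so the increment of \<open>f\<close> along the curve
    telescopes into one-coordinate steps.\<close>
  define hyb where "hyb k t = (\<lambda>j. if j < k then \<gamma> t j else x0 j)" for k t
  have lim: "((\<lambda>t. \<gamma> t j) \<longlongrightarrow> x0 j) (at t0)" if "j < m" for j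
    using DERIV_isCont[OF \<gamma>[OF that]] by (simp add: isCont_def x0_def)
  have near: "\<forall>\<^sub>F t in at t0. \<forall>j<m. \<bar>\<gamma> t j - x0 j\<bar> < e"
  proof -
    have "\<forall>\<^sub>F t in at t0. \<forall>j\<in>{..<m}. dist (\<gamma> t j) (x0 j) < e"
      using lim e(1) by (intro eventually_ball_finite) (auto dest: tendstoD)
    then show ?thesis by (simp add: dist_real_def Ball_def)
  qed
  have step: "((\<lambda>t. f (hyb (Suc k) t) - f (hyb k t)) has_real_derivative partial k f x0 * \<gamma>' k) (at t0)"
    if k: "k < m" for k
  proof -
    \<comment> \<open>\<open>P t s\<close> says that \<open>s\<close> is an intermediate point for
      step \<open>k\<close> at parameter \<open>t\<close>: the increment of \<open>f\<close> in that
      step is a partial derivative, taken at the hybrid with \<open>s\<close> in place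
      \<open>k\<close>, times the increment of coordinate \<open>k\<close>.\<close>
    define P where "P t s \<longleftrightarrow> \<bar>s - x0 k\<bar> \<le> \<bar>\<gamma> t k - x0 k\<bar> \<and> (hyb k t)(k := s) \<in> V \<and>
      f (hyb (Suc k) t) - f (hyb k t) = partial k f ((hyb k t)(k := s)) * (\<gamma> t k - x0 k)" for t s
    \<comment> \<open>The choice is arbitrary for each \<open>t\<close>; the bound in
      \<open>P\<close> alone forces \<xi> to tend to \<open>x0 k\<close>.\<close>
    define \<xi> where "\<xi> t = (SOME s. P t s)" for t
    have "\<exists>s. P t s" if t: "\<forall>j<m. \<bar>\<gamma> t j - x0 j\<bar> < e" for t
    proof -
      have V': "(hyb k t)(k := s) \<in> V" if "\<bar>s - x0 k\<bar> \<le> \<bar>\<gamma> t k - x0 k\<bar>" for s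
      proof (rule e(2))
        show "(hyb k t)(k := s) \<in> Eucl m" using x0E k by (auto simp: Eucl_iff hyb_def)
        show "\<forall>i<m. \<bar>((hyb k t)(k := s)) i - x0 i\<bar> < e"
          using t that k e(1) by (auto simp: hyb_def intro: le_less_trans)
      qed
      have "((\<lambda>s. f ((hyb k t)(k := s))) has_real_derivative partial k f ((hyb k t)(k := s))) (at s)"
        if "\<bar>s - x0 k\<bar> \<le> \<bar>\<gamma> t k - x0 k\<bar>" for s
        using C_k_on_SucD(2)[OF f k V'[OF that]] by simp
      from mean_value_unordered[OF this, of "x0 k" "\<gamma> t k"] obtain s
        where s: "\<bar>s - x0 k\<bar> \<le> \<bar>\<gamma> t k - x0 k\<bar>"
          "f ((hyb k t)(k := \<gamma> t k)) - f ((hyb k t)(k := x0 k)) =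
            partial k f ((hyb k t)(k := s)) * (\<gamma> t k - x0 k)" by blast
      moreover have "(hyb k t)(k := \<gamma> t k) = hyb (Suc k) t" "(hyb k t)(k := x0 k) = hyb k t"
        by (auto simp: hyb_def less_Suc_eq)
      ultimately show ?thesis using V' by (auto simp: P_def)
    qed
    then have ev: "\<forall>\<^sub>F t in at t0. P t (\<xi> t)"
      using near unfolding \<xi>_def by (auto elim!: eventually_mono intro: someI_ex)
    let ?\<eta> = "\<lambda>t. (hyb k t)(k := \<xi> t)"
    have "((\<lambda>t. \<xi> t - x0 k) \<longlongrightarrow> 0) (at t0)"
    proof (rule Lim_null_comparison)
      show "\<forall>\<^sub>F t in at t0. norm (\<xi> t - x0 k) \<le> \<bar>\<gamma> t k - x0 k\<bar>"
        using ev by (auto simp: P_def elim!: eventually_mono)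
      show "((\<lambda>t. \<bar>\<gamma> t k - x0 k\<bar>) \<longlongrightarrow> 0) (at t0)"
        using lim[OF k] by (simp add: tendsto_rabs_zero_iff LIM_zero_iff)
    qed
    then have \<xi>: "(\<xi> \<longlongrightarrow> x0 k) (at t0)" by (simp add: LIM_zero_iff)
    have \<eta>: "(?\<eta> \<longlongrightarrow> x0) (at t0)"
    proof (rule tendsto_fun_coordinatewise)
      fix j
      consider "j = k" | "j < k" | "j > k" by linarith
      then show "((\<lambda>t. ?\<eta> t j) \<longlongrightarrow> x0 j) (at t0)"
        using lim[of j] k \<xi> by cases (auto simp: hyb_def)
    qed
    have cont: "continuous_on V (partial k f)"
      using C_k_on_SucD(1)[OF f k] by simp
    have "\<forall>\<^sub>F t in at t0. ?\<eta> t \<in> V"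
      using ev by (rule eventually_mono) (simp add: P_def)
    then have "((\<lambda>t. partial k f (?\<eta> t)) \<longlongrightarrow> partial k f x0) (at t0)"
      by (rule continuous_on_tendsto_compose[OF cont \<eta> x0])
    moreover have "((\<lambda>t. (\<gamma> t k - x0 k) / (t - t0)) \<longlongrightarrow> \<gamma>' k) (at t0)"
      using \<gamma>[OF k] by (simp add: has_field_derivative_iff x0_def)
    ultimately have "((\<lambda>t. partial k f (?\<eta> t) * ((\<gamma> t k - x0 k) / (t - t0))) \<longlongrightarrow>
        partial k f x0 * \<gamma>' k) (at t0)" by (rule tendsto_mult)
    then show ?thesis unfolding has_field_derivative_iff
    proof (rule Lim_transform_eventually)
      \<comment> \<open>At \<open>t0\<close> both hybrids are \<open>x0\<close>, so the value
        subtracted in the difference quotient is 0.\<close>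
      have "hyb (Suc k) t0 = hyb k t0" by (auto simp: hyb_def x0_def)
      then show "\<forall>\<^sub>F t in at t0. partial k f (?\<eta> t) * ((\<gamma> t k - x0 k) / (t - t0)) =
        (f (hyb (Suc k) t) - f (hyb k t) - (f (hyb (Suc k) t0) - f (hyb k t0))) / (t - t0)"
        using ev by (auto simp: P_def elim!: eventually_mono)
    qed
  qed
  have "((\<lambda>t. f (hyb k t)) has_real_derivative (\<Sum>j<k. partial j f x0 * \<gamma>' j)) (at t0)"
    if "k \<le> m" for k using that
  proof (induction k)
    case 0
    then show ?case by (simp add: hyb_def)
  next
    case (Suc k)
    then show ?case using DERIV_add[OF Suc.IH step[of k]] by simp
  qed
  from this[of m] have "((\<lambda>t. f (hyb m t)) has_real_derivative (\<Sum>j<m. partial j f x0 * \<gamma>' j)) (at t0)"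
    by simp
  moreover have "\<forall>\<^sub>F t in nhds t0. f (hyb m t) = f (\<gamma> t)"
  proof -
    \<comment> \<open>From index \<open>m\<close> on both sides vanish, the left one because
      \<open>x0\<close> does.\<close>
    have "hyb m t = \<gamma> t" if "\<gamma> t \<in> V" for t
      using that x0E openin_subset[OF V] by (auto simp: hyb_def Eucl_iff subset_iff fun_eq_iff)
    then show ?thesis using \<gamma>V by (auto elim!: eventually_mono)
  qed
  ultimately show ?thesis
    using DERIV_cong_ev[OF refl _ refl, of "\<lambda>t. f (hyb m t)" "\<lambda>t. f (\<gamma> t)" t0]
    unfolding x0_def by simp
qed

lemma C_inf_on_imp_C_k: "C_inf_on n U f \<Longrightarrow> C_k_on n k U (\<lambda>x. f x j)"
  by (simp add: C_inf_on_def)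

text \<open>The case of \<open>has_derivative_along_curve\<close> in which the curve is the image
  under \<open>g\<close> of a coordinate line.\<close>

lemma has_derivative_compose_coord:
  assumes U: "openin (Euclidean_space n) U" and V: "openin (Euclidean_space m) V"
    and f: "C_k_on m (Suc 0) V f" and g: "C_inf_on n U g" "g ` U \<subseteq> V"
    and i: "i < n" and x: "x \<in> U"
  shows "((\<lambda>t. f (g (x(i := t)))) has_real_derivative
      (\<Sum>j<m. partial j f (g x) * partial i (\<lambda>y. g y j) x)) (at (x i))"
proof -
  have "((\<lambda>t. g (x(i := t)) j) has_real_derivative partial i (\<lambda>y. g y j) x) (at (x i))" for j
    using C_k_on_SucD(2)[OF C_inf_on_imp_C_k[OF g(1)] i x] .
  moreover have "\<forall>\<^sub>F t in nhds (x i). g (x(i := t)) \<in> V"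
    using eventually_upd[OF U x i] g(2) by (auto elim!: eventually_mono)
  ultimately show ?thesis
    using has_derivative_along_curve[OF V f, of "\<lambda>t. g (x(i := t))" "x i"] by simp
qed

lemma C_inf_on_imp_continuous: "C_inf_on n U f \<Longrightarrow> continuous_on U f"
  unfolding C_inf_on_def
  by (intro continuous_on_coordinatewise_then_product) (blast intro: C_k_on_imp_continuous)

text \<open>Induction on the order: a partial derivative of the composite is a sum of products of a
  composite \<open>partial j f\<close> after \<open>g\<close>, where \<open>partial j f\<close> has
  one order less, with a partial derivative of \<open>g\<close>, which has every order.\<close>

lemma C_k_on_compose:
  assumes U: "openin (Euclidean_space n) U" and V: "openin (Euclidean_space m) V"
    and g: "C_inf_on n U g" "g ` U \<subseteq> V"
  shows "C_k_on m k V f \<Longrightarrow> C_k_on n k U (\<lambda>x. f (g x))"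
proof (induction k arbitrary: f)
  case 0
  then show ?case
    using continuous_on_compose2[OF _ C_inf_on_imp_continuous[OF g(1)] g(2)] by simp
next
  case (Suc k)
  show ?case
  proof (rule C_k_on_SucI[OF U,
        where g = "\<lambda>i x. \<Sum>j<m. partial j f (g x) * partial i (\<lambda>y. g y j) x"])
    show "continuous_on U (\<lambda>x. f (g x))"
      using continuous_on_compose2[OF C_k_on_imp_continuous[OF Suc.prems]
          C_inf_on_imp_continuous[OF g(1)] g(2)] .
    show "C_k_on n k U (\<lambda>x. \<Sum>j<m. partial j f (g x) * partial i (\<lambda>y. g y j) x)" if "i < n" for i
      using C_k_on_SucD(1)[OF C_inf_on_imp_C_k[OF g(1)] that] C_k_on_SucD(1)[OF Suc.prems]
      by (intro C_k_on_sum[OF U] C_k_on_mult[OF U] Suc.IH) auto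
    show "((\<lambda>t. f (g (x(i := t)))) has_real_derivative
        (\<Sum>j<m. partial j f (g x) * partial i (\<lambda>y. g y j) x)) (at (x i))"
      if "i < n" "x \<in> U" for i x
      using has_derivative_compose_coord[OF U V _ g that] C_k_on_le[OF Suc.prems, of "Suc 0"] by simp
  qed
qed

lemma C_inf_on_compose:
  assumes "openin (Euclidean_space n) U" "openin (Euclidean_space m) V"
    "C_inf_on n U g" "g ` U \<subseteq> V" "C_inf_on m V f"
  shows "C_inf_on n U (f \<circ> g)"
  unfolding C_inf_on_def comp_def
proof (intro allI)
  show "C_k_on n k U (\<lambda>x. f (g x) j)" for j k
    using C_k_on_compose[OF assms(1-4) C_inf_on_imp_C_k[OF assms(5)]] .
qed

lemma C_inf_on_subset: "C_inf_on n U f \<Longrightarrow> V \<subseteq> U \<Longrightarrow> C_inf_on n V f"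
  unfolding C_inf_on_def by (blast intro: C_k_on_subset)

lemma C_inf_on_cong:
  assumes "openin (Euclidean_space n) U" "\<And>y. y \<in> U \<Longrightarrow> f y = g y"
  shows "C_inf_on n U f \<longleftrightarrow> C_inf_on n U g"
  unfolding C_inf_on_def using assms by (intro all_cong1 C_k_on_cong) auto

lemma C_inf_on_local:
  assumes "\<And>x. x \<in> U \<Longrightarrow> \<exists>V. openin (Euclidean_space n) V \<and> x \<in> V \<and> C_inf_on n V f"
    and "U \<subseteq> Eucl n"
  shows "C_inf_on n U f"
  unfolding C_inf_on_def
proof (intro allI C_k_on_local)
  fix j k x assume "x \<in> U"
  then show "\<exists>V. openin (Euclidean_space n) V \<and> x \<in> V \<and> C_k_on n k V (\<lambda>x. f x j)"
    using assms(1)[of x] unfolding C_inf_on_def by blast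
qed fact

lemma C_k_on_partial:
  assumes "C_inf_on n U f" "i < n"
  shows "C_k_on n k U (partial i (\<lambda>x. f x j))"
  using C_k_on_SucD(1)[OF C_inf_on_imp_C_k[OF assms(1)] assms(2)] .

section \<open>Jacobians\<close>

lemma jacobian_cong:
  assumes "openin (Euclidean_space n) U" "x \<in> U" "\<And>y. y \<in> U \<Longrightarrow> f y = g y"
  shows "jacobian n f x v = jacobian n g x v"
  unfolding jacobian_def using assms
  by (intro ext sum.cong refl arg_cong2[where f = "(*)"] partial_cong[where U = U and n = n]) auto

lemma partial_coord: "partial i (\<lambda>y. y j) x = (if i = j then 1 else 0)"
  unfolding partial_def by (rule DERIV_imp_deriv) (cases "i = j"; auto)

lemma jacobian_id: "v \<in> Eucl n \<Longrightarrow> jacobian n (\<lambda>x. x) x v = v"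
  by (auto simp: jacobian_def partial_coord Eucl_iff fun_eq_iff if_distrib[of "\<lambda>a. a * _"] cong: if_cong)

text \<open>The chain rule in matrix form: componentwise it is
  \<open>has_derivative_compose_coord\<close>, and the rest is an exchange of two finite
  sums.\<close>

lemma jacobian_compose:
  assumes U: "openin (Euclidean_space n) U" and V: "openin (Euclidean_space m) V"
    and g: "C_inf_on n U g" "g ` U \<subseteq> V" and f: "C_inf_on m V f" and x: "x \<in> U"
  shows "jacobian n (f \<circ> g) x v = jacobian m f (g x) (jacobian n g x v)"
proof
  fix j
  have "partial i (\<lambda>y. f (g y) j) x =
      (\<Sum>l<m. partial l (\<lambda>y. f y j) (g x) * partial i (\<lambda>y. g y l) x)" if "i < n" for i
    using has_derivative_compose_coord[OF U V C_inf_on_imp_C_k[OF f] g that x]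
    by (simp add: partial_def DERIV_imp_deriv)
  then have "jacobian n (f \<circ> g) x v j =
      (\<Sum>i<n. \<Sum>l<m. partial l (\<lambda>y. f y j) (g x) * partial i (\<lambda>y. g y l) x * v i)"
    by (simp add: jacobian_def sum_distrib_right)
  also have "\<dots> = (\<Sum>l<m. \<Sum>i<n. partial l (\<lambda>y. f y j) (g x) * partial i (\<lambda>y. g y l) x * v i)"
    by (rule sum.swap)
  finally show "jacobian n (f \<circ> g) x v j = jacobian m f (g x) (jacobian n g x v) j"
    by (simp add: jacobian_def sum_distrib_left mult.assoc)
qed

text \<open>The coordinates of \<open>f\<close> from \<open>m\<close> on are constantly 0 on
  \<open>U\<close>, hence so are their partial derivatives.\<close>

lemma jacobian_in_Eucl:
  assumes "openin (Euclidean_space n) U" "x \<in> U" "f ` U \<subseteq> Eucl m"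
  shows "jacobian n f x v \<in> Eucl m"
proof -
  have "partial i (\<lambda>y. f y j) x = 0" if "m \<le> j" "i < n" for i j
  proof -
    have "partial i (\<lambda>y. f y j) x = partial i (\<lambda>_. 0) x"
      using assms that by (intro partial_cong[OF assms(1,2)]) (auto simp: Eucl_iff image_subset_iff)
    then show ?thesis by (simp add: partial_def)
  qed
  then show ?thesis by (auto simp: Eucl_iff jacobian_def)
qed

lemma jacobian_add: "jacobian n f x (\<lambda>i. v i + w i) = (\<lambda>j. jacobian n f x v j + jacobian n f x w j)"
  by (auto simp: jacobian_def sum.distrib algebra_simps)

lemma jacobian_scale: "jacobian n f x (\<lambda>i. r * v i) = (\<lambda>j. r * jacobian n f x v j)"
  by (auto simp: jacobian_def sum_distrib_left algebra_simps)

lemma jacobian_zero: "jacobian n f x (\<lambda>_. 0) = (\<lambda>_. 0)"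
  by (auto simp: jacobian_def)

section \<open>Atlases and smooth maps\<close>

text \<open>A homeomorphism between open sets is an injection under which the open subsets of both
  sides correspond. This form mentions no subspace topology and serves both to use charts and to
  construct them.\<close>

lemma is_chart_iff:
  "is_chart X n c \<longleftrightarrow>
     openin X (chart_dom c) \<and> inj_on (chart_map c) (chart_dom c) \<and>
     chart_map c ` chart_dom c \<subseteq> Eucl n \<and>
     (\<forall>W\<subseteq>chart_dom c. openin X W \<longleftrightarrow> openin (Euclidean_space n) (chart_map c ` W))"
  (is "_ \<longleftrightarrow> ?R")
proof
  assume c: "is_chart X n c"
  let ?D = "chart_dom c" and ?f = "chart_map c"
  have D: "openin X ?D" and I: "openin (Euclidean_space n) (?f ` ?D)"
    and h: "homeomorphic_map (subtopology X ?D) (subtopology (Euclidean_space n) (?f ` ?D)) ?f"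
    using c by (auto simp: is_chart_def)
  have top: "topspace (subtopology X ?D) = ?D"
    using openin_subset[OF D] by auto
  have "openin X W \<longleftrightarrow> openin (Euclidean_space n) (?f ` W)" if "W \<subseteq> ?D" for W
    using homeomorphic_map_openness[OF h, of W] that top
      openin_open_subtopology[OF D] openin_open_subtopology[OF I] by (auto simp: image_mono)
  moreover have "inj_on ?f ?D" using homeomorphic_imp_injective_map[OF h] top by simp
  ultimately show ?R using D openin_subset[OF I] by blast
next
  assume R: ?R
  let ?D = "chart_dom c" and ?f = "chart_map c"
  have D: "openin X ?D" using R by blast
  then have I: "openin (Euclidean_space n) (?f ` ?D)" using R by blast
  have topD: "topspace (subtopology X ?D) = ?D"
    using openin_subset[OF D] by auto
  have topI: "topspace (subtopology (Euclidean_space n) (?f ` ?D)) = ?f ` ?D"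
    using openin_subset[OF I] by auto
  have "homeomorphic_map (subtopology X ?D) (subtopology (Euclidean_space n) (?f ` ?D)) ?f"
  proof (rule bijective_open_imp_homeomorphic_map)
    show "continuous_map (subtopology X ?D) (subtopology (Euclidean_space n) (?f ` ?D)) ?f"
      unfolding continuous_map_def topD topI
    proof (intro conjI allI impI)
      fix V assume "openin (subtopology (Euclidean_space n) (?f ` ?D)) V"
      then have V: "openin (Euclidean_space n) V" "V \<subseteq> ?f ` ?D"
        using openin_open_subtopology[OF I] by auto
      then have "?f ` {x \<in> ?D. ?f x \<in> V} = V" by auto
      then have "openin X {x \<in> ?D. ?f x \<in> V}" using R V by (metis (no_types, lifting) mem_Collect_eq subsetI)
      then show "openin (subtopology X ?D) {x \<in> ?D. ?f x \<in> V}"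
        using openin_open_subtopology[OF D] by auto
    qed auto
    show "open_map (subtopology X ?D) (subtopology (Euclidean_space n) (?f ` ?D)) ?f"
      unfolding open_map_def
      using openin_open_subtopology[OF I] openin_open_subtopology[OF D] R by (auto simp: image_mono)
    show "?f ` topspace (subtopology X ?D) = topspace (subtopology (Euclidean_space n) (?f ` ?D))"
      using topD topI by simp
    show "inj_on ?f (topspace (subtopology X ?D))"
      using topD R by simp
  qed
  then show "is_chart X n c" using D I by (simp add: is_chart_def)
qed

lemma is_chart_inj: "is_chart X n c \<Longrightarrow> inj_on (chart_map c) (chart_dom c)"
  by (simp add: is_chart_iff)

lemma is_chart_open_dom: "is_chart X n c \<Longrightarrow> openin X (chart_dom c)"
  by (simp add: is_chart_iff)

lemma is_chart_in_Eucl: "is_chart X n c \<Longrightarrow> p \<in> chart_dom c \<Longrightarrow> chart_map c p \<in> Eucl n"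
  by (auto simp: is_chart_iff)

lemma is_chart_image_open:
  "is_chart X n c \<Longrightarrow> openin X W \<Longrightarrow> W \<subseteq> chart_dom c \<Longrightarrow>
    openin (Euclidean_space n) (chart_map c ` W)"
  by (simp add: is_chart_iff)

lemma is_chart_inv [simp]:
  "is_chart X n c \<Longrightarrow> p \<in> chart_dom c \<Longrightarrow> chart_inv c (chart_map c p) = p"
  by (simp add: chart_inv_def is_chart_inj)

lemma is_chart_subset:
  assumes c: "is_chart X n c" and W: "openin X W"
  shows "is_chart X n (chart_dom c \<inter> W, chart_map c)"
  using assms unfolding is_chart_iff by (auto intro: inj_on_subset)

lemma compatible_transition:
  "compatible n c d \<Longrightarrow> C_inf_on n (chart_map c ` (chart_dom c \<inter> chart_dom d)) (chart_map d \<circ> chart_inv c)"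
  by (simp add: compatible_def)

text \<open>The part of the definition of a manifold that concerns the atlas: smoothness of maps depends
  on nothing else.\<close>

definition atlas_manifold :: "'p manifold \<Rightarrow> bool" where
  "atlas_manifold M \<longleftrightarrow>
     (\<forall>c\<in>charts M. is_chart (space_top M) (mdim M) c) \<and>
     (\<Union>c\<in>charts M. chart_dom c) = points M \<and>
     (\<forall>c\<in>charts M. \<forall>d\<in>charts M. compatible (mdim M) c d) \<and>
     (\<forall>c. is_chart (space_top M) (mdim M) c \<and> (\<forall>d\<in>charts M. compatible (mdim M) c d) \<longrightarrow>
          c \<in> charts M)"

lemma smooth_manifold_iff:
  "smooth_manifold M \<longleftrightarrow>
     Hausdorff_space (space_top M) \<and> second_countable (space_top M) \<and> atlas_manifold M"
  by (auto simp: smooth_manifold_def atlas_manifold_def)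

lemma smooth_imp_atlas_manifold: "smooth_manifold M \<Longrightarrow> atlas_manifold M"
  by (simp add: smooth_manifold_iff)

lemma chart_is_chart: "atlas_manifold M \<Longrightarrow> c \<in> charts M \<Longrightarrow> is_chart (space_top M) (mdim M) c"
  by (simp add: atlas_manifold_def)

lemma charts_compatible:
  "atlas_manifold M \<Longrightarrow> c \<in> charts M \<Longrightarrow> d \<in> charts M \<Longrightarrow> compatible (mdim M) c d"
  by (simp add: atlas_manifold_def)

lemma chart_inv_map [simp]:
  "atlas_manifold M \<Longrightarrow> c \<in> charts M \<Longrightarrow> p \<in> chart_dom c \<Longrightarrow> chart_inv c (chart_map c p) = p"
  by (meson chart_is_chart is_chart_inv)

lemma chart_dom_open: "atlas_manifold M \<Longrightarrow> c \<in> charts M \<Longrightarrow> openin (space_top M) (chart_dom c)"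
  by (meson chart_is_chart is_chart_open_dom)

lemma chart_dom_subset: "atlas_manifold M \<Longrightarrow> c \<in> charts M \<Longrightarrow> chart_dom c \<subseteq> points M"
  by (meson chart_dom_open openin_subset)

lemma chart_image_open:
  "atlas_manifold M \<Longrightarrow> c \<in> charts M \<Longrightarrow> openin (space_top M) W \<Longrightarrow> W \<subseteq> chart_dom c \<Longrightarrow>
    openin (Euclidean_space (mdim M)) (chart_map c ` W)"
  by (meson chart_is_chart is_chart_image_open)

lemma chart_map_in_Eucl:
  "atlas_manifold M \<Longrightarrow> c \<in> charts M \<Longrightarrow> p \<in> chart_dom c \<Longrightarrow> chart_map c p \<in> Eucl (mdim M)"
  by (meson chart_is_chart is_chart_in_Eucl)

lemma charts_at_iff: "c \<in> charts_at M p \<longleftrightarrow> c \<in> charts M \<and> p \<in> chart_dom c"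
  by (simp add: charts_at_def)

lemma charts_at_ex: "atlas_manifold M \<Longrightarrow> p \<in> points M \<Longrightarrow> \<exists>c. c \<in> charts_at M p"
  unfolding atlas_manifold_def charts_at_def by blast

lemma chart_aroundE:
  assumes "atlas_manifold M" "p \<in> points M"
  obtains c where "c \<in> charts M" "p \<in> chart_dom c"
  using assms charts_at_ex charts_at_iff by metis

text \<open>\<open>chart_inv\<close> inverts on the domain of the chart itself, so shrinking the
  domain changes it as a function; on the smaller image the two inverses agree.\<close>

lemma chart_inv_subset:
  assumes "is_chart X n c" "x \<in> chart_map c ` (chart_dom c \<inter> W)"
  shows "chart_inv (chart_dom c \<inter> W, chart_map c) x = chart_inv c x"
proof -
  obtain p where p: "p \<in> chart_dom c \<inter> W" "x = chart_map c p" using assms by blast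
  have "inj_on (chart_map c) (chart_dom c \<inter> W)"
    using is_chart_inj[OF assms(1)] by (rule inj_on_subset) auto
  then have "chart_inv (chart_dom c \<inter> W, chart_map c) x = p"
    unfolding chart_inv_def p(2) fst_conv snd_conv using p(1) by (rule inv_into_f_f)
  then show ?thesis using p is_chart_inv[OF assms(1)] by simp
qed

text \<open>A restricted chart is compatible with every chart with which the original one is, and
  maximality then puts it into the atlas.\<close>

lemma chart_subset:
  assumes M: "atlas_manifold M" and c: "c \<in> charts M" and W: "openin (space_top M) W"
  shows "(chart_dom c \<inter> W, chart_map c) \<in> charts M"
proof -
  note isc = chart_is_chart[OF M c]
  let ?c = "(chart_dom c \<inter> W, chart_map c)"
  have "compatible (mdim M) ?c d" if d: "d \<in> charts M" for d
  proof -
    note comp = charts_compatible[OF M c d]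
    have "C_inf_on (mdim M) (chart_map c ` (chart_dom c \<inter> W \<inter> chart_dom d)) (chart_map d \<circ> chart_inv c)"
      using compatible_transition[OF comp] by (rule C_inf_on_subset) auto
    moreover have "openin (Euclidean_space (mdim M)) (chart_map c ` (chart_dom c \<inter> W \<inter> chart_dom d))"
      using chart_dom_open[OF M c] chart_dom_open[OF M d] W by (intro chart_image_open[OF M c]) auto
    ultimately have "C_inf_on (mdim M) (chart_map c ` (chart_dom c \<inter> W \<inter> chart_dom d))
        (chart_map d \<circ> chart_inv ?c)"
      using chart_inv_subset[OF isc] by (subst C_inf_on_cong) auto
    moreover have "C_inf_on (mdim M) (chart_map d ` (chart_dom c \<inter> W \<inter> chart_dom d))
        (chart_map c \<circ> chart_inv d)"
      using comp unfolding compatible_def by (blast intro: C_inf_on_subset)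
    ultimately show ?thesis by (simp add: compatible_def)
  qed
  then show ?thesis using is_chart_subset[OF isc W] M unfolding atlas_manifold_def by blast
qed

text \<open>Near each point the transition from \<open>c\<close> to \<open>d\<close> factors through
  a chart of \<open>A\<close> around that point, and smoothness is local. Exchanging
  \<open>c\<close> and \<open>d\<close> gives the other half of compatibility.\<close>

lemma compatible_trans:
  assumes A: "\<And>a. a \<in> A \<Longrightarrow> is_chart X n a" "(\<Union>a\<in>A. chart_dom a) = topspace X"
    and c: "is_chart X n c" "\<And>a. a \<in> A \<Longrightarrow> compatible n c a"
    and d: "is_chart X n d" "\<And>a. a \<in> A \<Longrightarrow> compatible n d a"
  shows "C_inf_on n (chart_map c ` (chart_dom c \<inter> chart_dom d)) (chart_map d \<circ> chart_inv c)"
proof (rule C_inf_on_local)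
  fix x assume "x \<in> chart_map c ` (chart_dom c \<inter> chart_dom d)"
  then obtain p where p: "p \<in> chart_dom c" "p \<in> chart_dom d" "x = chart_map c p" by blast
  then obtain a where a: "a \<in> A" "p \<in> chart_dom a"
    using A(2) openin_subset[OF is_chart_open_dom[OF c(1)]] by blast
  note isa = A(1)[OF a(1)]
  let ?W = "chart_dom c \<inter> chart_dom d \<inter> chart_dom a"
  have W: "openin X ?W" using c(1) d(1) isa by (auto intro: is_chart_open_dom)
  have oc: "openin (Euclidean_space n) (chart_map c ` ?W)"
    and oa: "openin (Euclidean_space n) (chart_map a ` ?W)"
    using is_chart_image_open[OF c(1) W] is_chart_image_open[OF isa W] by auto
  have "C_inf_on n (chart_map c ` ?W) ((chart_map d \<circ> chart_inv a) \<circ> (chart_map a \<circ> chart_inv c))"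
  proof (rule C_inf_on_compose[OF oc oa])
    show "C_inf_on n (chart_map c ` ?W) (chart_map a \<circ> chart_inv c)"
      using compatible_transition[OF c(2)[OF a(1)]] by (rule C_inf_on_subset) auto
    show "C_inf_on n (chart_map a ` ?W) (chart_map d \<circ> chart_inv a)"
      using d(2)[OF a(1)] unfolding compatible_def by (blast intro: C_inf_on_subset)
    show "(chart_map a \<circ> chart_inv c) ` chart_map c ` ?W \<subseteq> chart_map a ` ?W"
      using c(1) by auto
  qed
  then have "C_inf_on n (chart_map c ` ?W) (chart_map d \<circ> chart_inv c)"
    using c(1) isa by (subst (asm) C_inf_on_cong[OF oc, where g = "chart_map d \<circ> chart_inv c"]) auto
  then show "\<exists>V. openin (Euclidean_space n) V \<and> x \<in> V \<and> C_inf_on n V (chart_map d \<circ> chart_inv c)"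
    using oc p a by blast
next
  show "chart_map c ` (chart_dom c \<inter> chart_dom d) \<subseteq> Eucl n"
    using is_chart_in_Eucl[OF c(1)] by blast
qed

text \<open>The charts of \<open>manifold_of_atlas\<close> are those compatible with
  \<open>A\<close>. They are compatible with each other by \<open>compatible_trans\<close>, and the
  atlas is maximal because it contains \<open>A\<close>. Tangent bundles, products and the point are
  all obtained from this lemma.\<close>

lemma atlas_manifold_of_atlas:
  assumes A: "\<And>a. a \<in> A \<Longrightarrow> is_chart X n a" "(\<Union>a\<in>A. chart_dom a) = topspace X"
    and comp: "\<And>a b. a \<in> A \<Longrightarrow> b \<in> A \<Longrightarrow>
      C_inf_on n (chart_map a ` (chart_dom a \<inter> chart_dom b)) (chart_map b \<circ> chart_inv a)"
  shows "atlas_manifold (manifold_of_atlas X n A)" and "A \<subseteq> charts (manifold_of_atlas X n A)"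
proof -
  have comp': "compatible n a b" if "a \<in> A" "b \<in> A" for a b
    using comp[OF that] comp[OF that(2,1)] by (simp add: compatible_def Int_commute)
  have *: "charts (manifold_of_atlas X n A) = {c. is_chart X n c \<and> (\<forall>d\<in>A. compatible n c d)}"
    "space_top (manifold_of_atlas X n A) = X" "mdim (manifold_of_atlas X n A) = n"
    by (auto simp: manifold_of_atlas_def)
  show sub: "A \<subseteq> charts (manifold_of_atlas X n A)"
    using A(1) comp' by (auto simp: *)
  have comp2: "compatible n c d" if "is_chart X n c" "\<forall>a\<in>A. compatible n c a"
    "is_chart X n d" "\<forall>a\<in>A. compatible n d a" for c d
    using compatible_trans[OF A, of c d] compatible_trans[OF A, of d c] that
    by (auto simp: compatible_def Int_commute)
  have "(\<Union>c\<in>charts (manifold_of_atlas X n A). chart_dom c) = topspace X"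
  proof
    show "(\<Union>c\<in>charts (manifold_of_atlas X n A). chart_dom c) \<subseteq> topspace X"
      using openin_subset[OF is_chart_open_dom] by (fastforce simp: *)
    show "topspace X \<subseteq> (\<Union>c\<in>charts (manifold_of_atlas X n A). chart_dom c)"
      using sub A(2) by blast
  qed
  then show "atlas_manifold (manifold_of_atlas X n A)"
    unfolding atlas_manifold_def using comp2 sub by (auto simp: *)
qed

text \<open>The test is made in every chart, whereas \<open>smooth_map\<close> asks only for some
  chart at each point. Coordinates of values of maps are functions of this kind, and closure under
  sums, products and composition is proved for them once.\<close>

definition smooth_fn :: "'p manifold \<Rightarrow> 'p set \<Rightarrow> ('p \<Rightarrow> real) \<Rightarrow> bool" where
  "smooth_fn M W h \<longleftrightarrow> openin (space_top M) W \<and>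
     (\<forall>e\<in>charts M. \<forall>k. C_k_on (mdim M) k (chart_map e ` (W \<inter> chart_dom e)) (h \<circ> chart_inv e))"

lemma smooth_fn_open: "smooth_fn M W h \<Longrightarrow> openin (space_top M) W"
  by (simp add: smooth_fn_def)

lemma smooth_fnD:
  "smooth_fn M W h \<Longrightarrow> e \<in> charts M \<Longrightarrow>
    C_k_on (mdim M) k (chart_map e ` (W \<inter> chart_dom e)) (\<lambda>x. h (chart_inv e x))"
  by (simp add: smooth_fn_def comp_def)

lemma smooth_fnI:
  "openin (space_top M) W \<Longrightarrow>
    (\<And>e k. e \<in> charts M \<Longrightarrow>
      C_k_on (mdim M) k (chart_map e ` (W \<inter> chart_dom e)) (\<lambda>x. h (chart_inv e x))) \<Longrightarrow>
    smooth_fn M W h"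
  unfolding smooth_fn_def comp_def by blast

lemma chart_Int_image_open:
  "atlas_manifold M \<Longrightarrow> e \<in> charts M \<Longrightarrow> openin (space_top M) W \<Longrightarrow>
    openin (Euclidean_space (mdim M)) (chart_map e ` (W \<inter> chart_dom e))"
  by (rule chart_image_open) (auto intro: chart_dom_open)

text \<open>One chart around each point suffices, since the transition maps are smooth and carry the
  property to all other charts.\<close>

lemma smooth_fnI_local:
  assumes M: "atlas_manifold M" and W: "openin (space_top M) W"
    and loc: "\<And>p. p \<in> W \<Longrightarrow> \<exists>c\<in>charts M. \<exists>V. openin (space_top M) V \<and> p \<in> V \<and> V \<subseteq> chart_dom c \<and>
      (\<forall>k. C_k_on (mdim M) k (chart_map c ` V) (h \<circ> chart_inv c))"
  shows "smooth_fn M W h"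
  unfolding smooth_fn_def
proof (intro conjI ballI allI W C_k_on_local)
  fix e k x assume e: "e \<in> charts M" and "x \<in> chart_map e ` (W \<inter> chart_dom e)"
  then obtain p where p: "p \<in> W" "p \<in> chart_dom e" "x = chart_map e p" by blast
  from loc[OF p(1)] obtain c V where c: "c \<in> charts M" and V: "openin (space_top M) V" "p \<in> V"
    "V \<subseteq> chart_dom c" "\<And>k. C_k_on (mdim M) k (chart_map c ` V) (h \<circ> chart_inv c)" by blast
  let ?A = "V \<inter> chart_dom e"
  have oA: "openin (Euclidean_space (mdim M)) (chart_map e ` ?A)"
    using chart_Int_image_open[OF M e V(1)] .
  have "C_k_on (mdim M) k (chart_map e ` ?A) (\<lambda>x. (h \<circ> chart_inv c) ((chart_map c \<circ> chart_inv e) x))"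
  proof (rule C_k_on_compose[OF oA chart_image_open[OF M c V(1,3)] _ _ V(4)])
    show "C_inf_on (mdim M) (chart_map e ` ?A) (chart_map c \<circ> chart_inv e)"
      using compatible_transition[OF charts_compatible[OF M e c]] V(3)
      by (elim C_inf_on_subset) auto
    show "(chart_map c \<circ> chart_inv e) ` chart_map e ` ?A \<subseteq> chart_map c ` V"
      using M e by auto
  qed
  then have "C_k_on (mdim M) k (chart_map e ` ?A) (h \<circ> chart_inv e)"
    by (rule C_k_on_cong_imp[OF oA, rotated]) (use M e c V(3) in \<open>auto simp: subset_iff\<close>)
  then show "\<exists>V. openin (Euclidean_space (mdim M)) V \<and> x \<in> V \<and> C_k_on (mdim M) k V (h \<circ> chart_inv e)"
    using oA V(2) p by blast
next
  fix e assume "e \<in> charts M"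
  then show "chart_map e ` (W \<inter> chart_dom e) \<subseteq> Eucl (mdim M)"
    using chart_map_in_Eucl[OF M] by blast
qed

lemma smooth_fn_local:
  assumes M: "atlas_manifold M"
    and loc: "\<And>p. p \<in> W \<Longrightarrow> \<exists>V. p \<in> V \<and> V \<subseteq> W \<and> smooth_fn M V h"
  shows "smooth_fn M W h"
proof (rule smooth_fnI_local[OF M])
  show W: "openin (space_top M) W"
    using loc by (subst openin_subopen) (blast dest: smooth_fn_open)
  fix p assume p: "p \<in> W"
  then obtain V where V: "p \<in> V" "smooth_fn M V h" using loc by blast
  obtain c where c: "c \<in> charts M" "p \<in> chart_dom c"
    using chart_aroundE[OF M] p openin_subset[OF W] by blast
  show "\<exists>c\<in>charts M. \<exists>V. openin (space_top M) V \<and> p \<in> V \<and> V \<subseteq> chart_dom c \<and>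
      (\<forall>k. C_k_on (mdim M) k (chart_map c ` V) (h \<circ> chart_inv c))"
    using c V smooth_fn_open[OF V(2)] chart_dom_open[OF M c(1)] unfolding smooth_fn_def
    by (intro bexI[of _ c] exI[of _ "V \<inter> chart_dom c"]) auto
qed

lemma smooth_fn_subset:
  assumes "smooth_fn M W h" "openin (space_top M) V" "V \<subseteq> W"
  shows "smooth_fn M V h"
  unfolding smooth_fn_def
proof (intro conjI ballI allI assms)
  fix e k assume "e \<in> charts M"
  then have "C_k_on (mdim M) k (chart_map e ` (W \<inter> chart_dom e)) (h \<circ> chart_inv e)"
    using assms by (simp add: smooth_fn_def)
  then show "C_k_on (mdim M) k (chart_map e ` (V \<inter> chart_dom e)) (h \<circ> chart_inv e)"
    by (rule C_k_on_subset) (use assms(3) in auto)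
qed

lemma smooth_fn_cong:
  assumes M: "atlas_manifold M" and h: "smooth_fn M W h" and eq: "\<And>p. p \<in> W \<Longrightarrow> h p = h' p"
  shows "smooth_fn M W h'"
  unfolding smooth_fn_def
proof (intro conjI ballI allI smooth_fn_open[OF h])
  fix e k assume e: "e \<in> charts M"
  then have "C_k_on (mdim M) k (chart_map e ` (W \<inter> chart_dom e)) (h \<circ> chart_inv e)"
    using h by (simp add: smooth_fn_def)
  then show "C_k_on (mdim M) k (chart_map e ` (W \<inter> chart_dom e)) (h' \<circ> chart_inv e)"
    by (rule C_k_on_cong_imp[OF chart_Int_image_open[OF M e smooth_fn_open[OF h]], rotated])
       (use M e eq in auto)
qed

context
  fixes M :: "'p manifold" and W
  assumes M: "atlas_manifold M" and W: "openin (space_top M) W"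
begin

lemma smooth_fn_const: "smooth_fn M W (\<lambda>_. a)"
  by (rule smooth_fnI[OF W], rule C_k_on_const[OF chart_Int_image_open[OF M _ W]])

lemma smooth_fn_add: "smooth_fn M W f \<Longrightarrow> smooth_fn M W g \<Longrightarrow> smooth_fn M W (\<lambda>p. f p + g p)"
  by (rule smooth_fnI[OF W], rule C_k_on_add[OF chart_Int_image_open[OF M _ W]])
     (auto dest: smooth_fnD simp del: C_k_on.simps)

lemma smooth_fn_mult: "smooth_fn M W f \<Longrightarrow> smooth_fn M W g \<Longrightarrow> smooth_fn M W (\<lambda>p. f p * g p)"
  by (rule smooth_fnI[OF W], rule C_k_on_mult[OF chart_Int_image_open[OF M _ W]])
     (auto dest: smooth_fnD simp del: C_k_on.simps)

lemma smooth_fn_sum: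
  "(\<And>i. i \<in> I \<Longrightarrow> smooth_fn M W (f i)) \<Longrightarrow> smooth_fn M W (\<lambda>p. \<Sum>i\<in>I. f i p)"
  by (induction I rule: infinite_finite_induct) (auto simp: smooth_fn_const smooth_fn_add)

text \<open>Here \<tau> is either a function on the target read in a chart or a partial derivative
  of a local representative; in the latter case the lemma says that the entries of a Jacobian depend
  smoothly on the moving base point.\<close>

lemma smooth_fn_C_k_compose:
  assumes U: "openin (Euclidean_space m) U" and \<tau>: "\<And>k. C_k_on m k U \<tau>"
    and h: "\<And>j. smooth_fn M W (\<lambda>p. h p j)" "h ` W \<subseteq> U"
  shows "smooth_fn M W (\<lambda>p. \<tau> (h p))"
  unfolding smooth_fn_def
proof (intro conjI ballI allI W)
  fix e k assume e: "e \<in> charts M"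
  have "C_k_on (mdim M) k (chart_map e ` (W \<inter> chart_dom e)) (\<lambda>x. \<tau> ((h \<circ> chart_inv e) x))"
  proof (rule C_k_on_compose[OF chart_Int_image_open[OF M e W] U _ _ \<tau>])
    show "C_inf_on (mdim M) (chart_map e ` (W \<inter> chart_dom e)) (h \<circ> chart_inv e)"
      using h(1) e by (simp add: C_inf_on_def smooth_fn_def comp_def)
    show "(h \<circ> chart_inv e) ` chart_map e ` (W \<inter> chart_dom e) \<subseteq> U"
      using h(2) M e by auto
  qed
  then show "C_k_on (mdim M) k (chart_map e ` (W \<inter> chart_dom e)) ((\<lambda>p. \<tau> (h p)) \<circ> chart_inv e)"
    by (simp add: comp_def)
qed

end

lemma smooth_fn_chart:
  assumes M: "atlas_manifold M" and c: "c \<in> charts M"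
  shows "smooth_fn M (chart_dom c) (\<lambda>p. chart_map c p j)"
  unfolding smooth_fn_def
proof (intro conjI ballI allI chart_dom_open[OF assms])
  fix e k assume e: "e \<in> charts M"
  show "C_k_on (mdim M) k (chart_map e ` (chart_dom c \<inter> chart_dom e)) ((\<lambda>p. chart_map c p j) \<circ> chart_inv e)"
    using C_inf_on_imp_C_k[OF compatible_transition[OF charts_compatible[OF M e c]]]
    by (simp add: comp_def Int_commute)
qed

text \<open>\<open>smooth_map\<close> wants a whole chart domain of the source to be mapped into
  \<open>chart_dom d\<close>. Such a chart comes from restricting any chart at \<open>p\<close> to
  \<open>W\<close>, so the domain of the test functions may be any open set.\<close>

lemma smooth_mapI:
  assumes M: "atlas_manifold M" and N: "atlas_manifold N"
    and f: "\<And>p. p \<in> points M \<Longrightarrow> f p \<in> points N"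
    and loc: "\<And>p. p \<in> points M \<Longrightarrow> \<exists>d\<in>charts_at N (f p). \<exists>W. p \<in> W \<and> f ` W \<subseteq> chart_dom d \<and>
      (\<forall>j. smooth_fn M W (\<lambda>q. chart_map d (f q) j))"
  shows "smooth_map M N f"
  unfolding smooth_map_def
proof (intro conjI ballI)
  show "f ` points M \<subseteq> points N" using f by blast
  fix p assume p: "p \<in> points M"
  obtain d W where d: "d \<in> charts_at N (f p)" and W: "p \<in> W" "f ` W \<subseteq> chart_dom d"
    and h: "\<And>j. smooth_fn M W (\<lambda>q. chart_map d (f q) j)"
    using loc[OF p] by blast
  obtain c where c: "c \<in> charts M" "p \<in> chart_dom c"
    using chart_aroundE[OF M p] .
  let ?c = "(chart_dom c \<inter> W, chart_map c)"
  have c': "?c \<in> charts M" using chart_subset[OF M c(1) smooth_fn_open[OF h]] .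
  have "C_inf_on (mdim M) (chart_map ?c ` chart_dom ?c) (chart_map d \<circ> f \<circ> chart_inv ?c)"
    unfolding C_inf_on_def
  proof (intro allI)
    fix j k
    have "C_k_on (mdim M) k (chart_map ?c ` (W \<inter> chart_dom ?c)) ((\<lambda>q. chart_map d (f q) j) \<circ> chart_inv ?c)"
      using h[of j] c' unfolding smooth_fn_def by blast
    moreover have "W \<inter> chart_dom ?c = chart_dom ?c" by auto
    ultimately show "C_k_on (mdim M) k (chart_map ?c ` chart_dom ?c) (\<lambda>x. (chart_map d \<circ> f \<circ> chart_inv ?c) x j)"
      by (simp add: comp_def)
  qed
  moreover have "?c \<in> charts_at M p" using c' c W by (simp add: charts_at_iff)
  moreover have "f ` chart_dom ?c \<subseteq> chart_dom d" using W by auto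
  ultimately show "\<exists>c\<in>charts_at M p. \<exists>d\<in>charts_at N (f p). f ` chart_dom c \<subseteq> chart_dom d \<and>
      C_inf_on (mdim M) (chart_map c ` chart_dom c) (chart_map d \<circ> f \<circ> chart_inv c)"
    using d by blast
qed

lemma smooth_map_points: "smooth_map M N f \<Longrightarrow> p \<in> points M \<Longrightarrow> f p \<in> points N"
  by (auto simp: smooth_map_def)

lemma smooth_mapE:
  assumes "smooth_map M N f" "p \<in> points M"
  obtains c d where "c \<in> charts M" "p \<in> chart_dom c" "d \<in> charts N" "f p \<in> chart_dom d"
    "f ` chart_dom c \<subseteq> chart_dom d"
    "C_inf_on (mdim M) (chart_map c ` chart_dom c) (chart_map d \<circ> f \<circ> chart_inv c)"
proof -
  have "\<exists>c\<in>charts_at M p. \<exists>d\<in>charts_at N (f p). f ` chart_dom c \<subseteq> chart_dom d \<and>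
      C_inf_on (mdim M) (chart_map c ` chart_dom c) (chart_map d \<circ> f \<circ> chart_inv c)"
    using assms unfolding smooth_map_def by (elim conjE) (rule bspec)
  then show thesis using that unfolding charts_at_iff Bex_def by (elim exE conjE)
qed

text \<open>Continuity is not written into \<open>smooth_map\<close>; it is inherited from the local
  representatives, because charts translate openness faithfully.\<close>

lemma smooth_map_vimage_open:
  assumes M: "atlas_manifold M" and N: "atlas_manifold N" and f: "smooth_map M N f"
    and V: "openin (space_top N) V"
  shows "openin (space_top M) {p \<in> points M. f p \<in> V}"
proof (subst openin_subopen, clarify)
  fix p assume p: "p \<in> points M" "f p \<in> V"
  obtain c d where c: "c \<in> charts M" "p \<in> chart_dom c" and d: "d \<in> charts N" "f p \<in> chart_dom d"
    and sub: "f ` chart_dom c \<subseteq> chart_dom d"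
    and C: "C_inf_on (mdim M) (chart_map c ` chart_dom c) (chart_map d \<circ> f \<circ> chart_inv c)"
    using smooth_mapE[OF f p(1)] .
  let ?A = "{q \<in> chart_dom c. f q \<in> V}"
  have key: "(chart_map d \<circ> f \<circ> chart_inv c) (chart_map c q) \<in> chart_map d ` (V \<inter> chart_dom d) \<longleftrightarrow>
      f q \<in> V" if q: "q \<in> chart_dom c" for q
  proof -
    have fq: "f q \<in> chart_dom d" using sub q by blast
    have "chart_map d (f q) \<in> chart_map d ` (V \<inter> chart_dom d) \<longleftrightarrow> f q \<in> V \<inter> chart_dom d"
      by (rule inj_on_image_mem_iff[OF is_chart_inj[OF chart_is_chart[OF N d(1)]] fq]) auto
    then show ?thesis using fq M c(1) q by simp
  qed
  have "openin (Euclidean_space (mdim M)) {x \<in> chart_map c ` chart_dom c.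
      (chart_map d \<circ> f \<circ> chart_inv c) x \<in> chart_map d ` (V \<inter> chart_dom d)}"
  proof (rule continuous_on_open_vimage_Eucl)
    show "openin (Euclidean_space (mdim M)) (chart_map c ` chart_dom c)"
      using chart_image_open[OF M c(1) chart_dom_open[OF M c(1)]] by simp
    show "continuous_on (chart_map c ` chart_dom c) (chart_map d \<circ> f \<circ> chart_inv c)"
      using C_inf_on_imp_continuous[OF C] .
    show "(chart_map d \<circ> f \<circ> chart_inv c) ` chart_map c ` chart_dom c \<subseteq> Eucl (mdim N)"
      using M c sub chart_map_in_Eucl[OF N d(1)] by auto
    show "openin (Euclidean_space (mdim N)) (chart_map d ` (V \<inter> chart_dom d))"
      using chart_Int_image_open[OF N d(1) V] .
  qed
  also have "{x \<in> chart_map c ` chart_dom c.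
      (chart_map d \<circ> f \<circ> chart_inv c) x \<in> chart_map d ` (V \<inter> chart_dom d)} = chart_map c ` ?A"
    using key by auto
  finally have "openin (space_top M) ?A"
    using chart_is_chart[OF M c(1)] unfolding is_chart_iff
    by (metis (no_types, lifting) mem_Collect_eq subsetI)
  then show "\<exists>T. openin (space_top M) T \<and> p \<in> T \<and> T \<subseteq> {p \<in> points M. f p \<in> V}"
    using p c chart_dom_subset[OF M c(1)] by (intro exI[of _ ?A]) auto
qed

text \<open>The converse of \<open>smooth_mapI\<close>, for an arbitrary chart \<open>d\<close> of
  the target and on the full preimage of its domain: near each point the coordinates in
  \<open>d\<close> are a transition map after the representative that \<open>smooth_map\<close>
  provides.\<close>

lemma smooth_map_coord:
  assumes M: "atlas_manifold M" and N: "atlas_manifold N" and f: "smooth_map M N f"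
    and d: "d \<in> charts N"
  shows "smooth_fn M {p \<in> points M. f p \<in> chart_dom d} (\<lambda>p. chart_map d (f p) j)"
proof (rule smooth_fnI_local[OF M])
  show o: "openin (space_top M) {p \<in> points M. f p \<in> chart_dom d}"
    using smooth_map_vimage_open[OF M N f chart_dom_open[OF N d]] .
  fix p assume "p \<in> {p \<in> points M. f p \<in> chart_dom d}"
  then have p: "p \<in> points M" "f p \<in> chart_dom d" by auto
  obtain c e where c: "c \<in> charts M" "p \<in> chart_dom c" and e: "e \<in> charts N" "f p \<in> chart_dom e"
    and sub: "f ` chart_dom c \<subseteq> chart_dom e"
    and C: "C_inf_on (mdim M) (chart_map c ` chart_dom c) (chart_map e \<circ> f \<circ> chart_inv c)"
    using smooth_mapE[OF f p(1)] .
  let ?V = "{p \<in> points M. f p \<in> chart_dom d} \<inter> chart_dom c"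
  have V: "openin (space_top M) ?V" using o chart_dom_open[OF M c(1)] by auto
  have oV: "openin (Euclidean_space (mdim M)) (chart_map c ` ?V)"
    using chart_image_open[OF M c(1) V] by simp
  have "C_inf_on (mdim M) (chart_map c ` ?V) ((chart_map d \<circ> chart_inv e) \<circ> (chart_map e \<circ> f \<circ> chart_inv c))"
  proof (rule C_inf_on_compose[OF oV])
    show "openin (Euclidean_space (mdim N)) (chart_map e ` (chart_dom e \<inter> chart_dom d))"
      using chart_image_open[OF N e(1)] chart_dom_open[OF N d] chart_dom_open[OF N e(1)] by auto
    show "C_inf_on (mdim M) (chart_map c ` ?V) (chart_map e \<circ> f \<circ> chart_inv c)"
      using C by (rule C_inf_on_subset) auto
    show "C_inf_on (mdim N) (chart_map e ` (chart_dom e \<inter> chart_dom d)) (chart_map d \<circ> chart_inv e)"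
      using compatible_transition[OF charts_compatible[OF N e(1) d]] .
    show "(chart_map e \<circ> f \<circ> chart_inv c) ` chart_map c ` ?V \<subseteq> chart_map e ` (chart_dom e \<inter> chart_dom d)"
      using M c sub by auto
  qed
  then have "C_inf_on (mdim M) (chart_map c ` ?V) (chart_map d \<circ> f \<circ> chart_inv c)"
    using M N c e sub
    by (subst (asm) C_inf_on_cong[OF oV, where g = "chart_map d \<circ> f \<circ> chart_inv c"])
       (auto simp: image_subset_iff)
  then have "\<forall>k. C_k_on (mdim M) k (chart_map c ` ?V) ((\<lambda>p. chart_map d (f p) j) \<circ> chart_inv c)"
    using C_inf_on_imp_C_k by (fastforce simp: comp_def)
  then show "\<exists>c\<in>charts M. \<exists>V. openin (space_top M) V \<and> p \<in> V \<and> V \<subseteq> chart_dom c \<and>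
      (\<forall>k. C_k_on (mdim M) k (chart_map c ` V) ((\<lambda>p. chart_map d (f p) j) \<circ> chart_inv c))"
    using V p c by (intro bexI[OF _ c(1)] exI[of _ ?V]) auto
qed

lemma smooth_fn_pullback:
  assumes M: "atlas_manifold M" and N: "atlas_manifold N" and f: "smooth_map M N f"
    and h: "smooth_fn N W h"
  shows "smooth_fn M {p \<in> points M. f p \<in> W} (\<lambda>p. h (f p))"
proof (rule smooth_fn_local[OF M])
  note W = smooth_fn_open[OF h]
  fix p assume "p \<in> {p \<in> points M. f p \<in> W}"
  then have p: "p \<in> points M" "f p \<in> W" by auto
  obtain d where d: "d \<in> charts N" "f p \<in> chart_dom d"
    using chart_aroundE[OF N smooth_map_points[OF f p(1)]] .
  let ?V = "{p \<in> points M. f p \<in> W \<inter> chart_dom d}"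
  have V: "openin (space_top M) ?V"
    using smooth_map_vimage_open[OF M N f] W chart_dom_open[OF N d(1)] by blast
  have "smooth_fn M ?V (\<lambda>p. (h \<circ> chart_inv d) (chart_map d (f p)))"
  proof (rule smooth_fn_C_k_compose[OF M V, where \<tau> = "h \<circ> chart_inv d" and h = "\<lambda>p. chart_map d (f p)"])
    show "openin (Euclidean_space (mdim N)) (chart_map d ` (W \<inter> chart_dom d))"
      using chart_Int_image_open[OF N d(1) W] .
    show "C_k_on (mdim N) k (chart_map d ` (W \<inter> chart_dom d)) (h \<circ> chart_inv d)" for k
      using h d(1) by (simp add: smooth_fn_def)
    show "smooth_fn M ?V (\<lambda>p. chart_map d (f p) j)" for j
      using smooth_map_coord[OF M N f d(1)] V by (rule smooth_fn_subset) auto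
  qed auto
  then have "smooth_fn M ?V (\<lambda>p. h (f p))"
    by (rule smooth_fn_cong[OF M]) (use N d in auto)
  then show "\<exists>V. p \<in> V \<and> V \<subseteq> {p \<in> points M. f p \<in> W} \<and> smooth_fn M V (\<lambda>p. h (f p))"
    using p d by (intro exI[of _ ?V]) auto
qed

text \<open>The coordinates of \<open>g\<close> are smooth functions, and \<open>f\<close> pulls
  smooth functions back.\<close>

lemma smooth_map_compose:
  assumes M: "atlas_manifold M" and N: "atlas_manifold N" and P: "atlas_manifold P"
    and f: "smooth_map M N f" and g: "smooth_map N P g"
  shows "smooth_map M P (g \<circ> f)"
proof (rule smooth_mapI[OF M P])
  show "(g \<circ> f) p \<in> points P" if "p \<in> points M" for p
    using smooth_map_points[OF g smooth_map_points[OF f that]] by simp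
  fix p assume p: "p \<in> points M"
  obtain d where d: "d \<in> charts P" "g (f p) \<in> chart_dom d"
    using chart_aroundE[OF P smooth_map_points[OF g smooth_map_points[OF f p]]] .
  note smooth_fn_pullback[OF M N f smooth_map_coord[OF N P g d(1)]]
  then show "\<exists>d\<in>charts_at P ((g \<circ> f) p). \<exists>W. p \<in> W \<and> (g \<circ> f) ` W \<subseteq> chart_dom d \<and>
      (\<forall>j. smooth_fn M W (\<lambda>q. chart_map d ((g \<circ> f) q) j))"
    using d p smooth_map_points[OF f p]
    by (intro bexI[of _ d] exI[of _ "{p \<in> points M. f p \<in> {q \<in> points N. g q \<in> chart_dom d}}"])
       (auto simp: charts_at_iff)
qed

lemma smooth_map_cong:
  assumes M: "atlas_manifold M" and N: "atlas_manifold N" and f: "smooth_map M N f"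
    and eq: "\<And>p. p \<in> points M \<Longrightarrow> f p = g p"
  shows "smooth_map M N g"
proof (rule smooth_mapI[OF M N])
  show "g p \<in> points N" if "p \<in> points M" for p
    using smooth_map_points[OF f that] eq that by simp
  fix p assume p: "p \<in> points M"
  obtain d where d: "d \<in> charts N" "f p \<in> chart_dom d"
    using chart_aroundE[OF N smooth_map_points[OF f p]] .
  have "smooth_fn M {p \<in> points M. f p \<in> chart_dom d} (\<lambda>p. chart_map d (g p) j)" for j
    using smooth_map_coord[OF M N f d(1)] by (rule smooth_fn_cong[OF M]) (use eq in auto)
  then show "\<exists>d\<in>charts_at N (g p). \<exists>W. p \<in> W \<and> g ` W \<subseteq> chart_dom d \<and>
      (\<forall>j. smooth_fn M W (\<lambda>q. chart_map d (g q) j))"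
    using d p eq by (intro bexI[of _ d] exI[of _ "{p \<in> points M. f p \<in> chart_dom d}"])
      (auto simp: charts_at_iff)
qed

lemma smooth_map_id:
  assumes M: "atlas_manifold M" shows "smooth_map M M (\<lambda>p. p)"
proof (rule smooth_mapI[OF M M])
  fix p assume "p \<in> points M"
  then obtain c where c: "c \<in> charts_at M p" using charts_at_ex[OF M] by blast
  then show "\<exists>d\<in>charts_at M p. \<exists>W. p \<in> W \<and> (\<lambda>p. p) ` W \<subseteq> chart_dom d \<and>
      (\<forall>j. smooth_fn M W (\<lambda>q. chart_map d q j))"
    using smooth_fn_chart[OF M] by (intro bexI[OF _ c] exI[of _ "chart_dom c"]) (auto simp: charts_at_iff)
qed

section \<open>Tangent vectors and tangent maps\<close>

text \<open>\<open>vtake\<close> and \<open>vdrop\<close> undo \<open>vec_append\<close>. The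
  padding by zeros puts the first part into \<open>Eucl m\<close>.\<close>

definition vtake :: "nat \<Rightarrow> (nat \<Rightarrow> real) \<Rightarrow> nat \<Rightarrow> real" where
  "vtake m z = (\<lambda>i. if i < m then z i else 0)"

definition vdrop :: "nat \<Rightarrow> (nat \<Rightarrow> real) \<Rightarrow> nat \<Rightarrow> real" where
  "vdrop m z = (\<lambda>i. z (i + m))"

lemma vtake_append [simp]: "u \<in> Eucl m \<Longrightarrow> vtake m (vec_append m u v) = u"
  by (auto simp: vtake_def vec_append_def Eucl_iff fun_eq_iff)

lemma vdrop_append [simp]: "vdrop m (vec_append m u v) = v"
  by (auto simp: vdrop_def vec_append_def)

lemma append_take_drop [simp]: "vec_append m (vtake m z) (vdrop m z) = z"
  by (auto simp: vdrop_def vtake_def vec_append_def)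

lemma vtake_in_Eucl [simp]: "vtake m z \<in> Eucl m"
  by (auto simp: vtake_def Eucl_iff)

lemma vdrop_in_Eucl: "z \<in> Eucl (m + n) \<Longrightarrow> vdrop m z \<in> Eucl n"
  by (auto simp: vdrop_def Eucl_iff)

lemma vec_append_in_Eucl: "v \<in> Eucl n \<Longrightarrow> vec_append m u v \<in> Eucl (m + n)"
  by (auto simp: vec_append_def Eucl_iff)

lemma vec_append_inj:
  "u \<in> Eucl m \<Longrightarrow> u' \<in> Eucl m \<Longrightarrow> vec_append m u v = vec_append m u' v' \<longleftrightarrow> u = u' \<and> v = v'"
  by (metis vdrop_append vtake_append)

lemma C_k_on_vtake: "openin (Euclidean_space n) U \<Longrightarrow> C_k_on n k U (\<lambda>z. vtake m z j)"
  by (cases "j < m") (simp_all add: vtake_def C_k_on_const C_k_on_coord)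

lemma C_inf_on_vtake: "openin (Euclidean_space n) U \<Longrightarrow> C_inf_on n U (vtake m)"
  by (simp add: C_inf_on_def C_k_on_vtake)

lemma C_inf_on_vdrop: "openin (Euclidean_space n) U \<Longrightarrow> C_inf_on n U (vdrop m)"
  by (simp add: C_inf_on_def vdrop_def C_k_on_coord)

lemma C_inf_on_append:
  assumes "C_inf_on n U f" "C_inf_on n U g"
  shows "C_inf_on n U (\<lambda>x. vec_append m (f x) (g x))"
  unfolding C_inf_on_def
proof (intro allI)
  show "C_k_on n k U (\<lambda>x. vec_append m (f x) (g x) j)" for j k
    using C_inf_on_imp_C_k[OF assms(1), of k j] C_inf_on_imp_C_k[OF assms(2), of k "j - m"]
    by (cases "j < m") (simp_all add: vec_append_def)
qed

lemma openin_Eucl_append: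
  assumes U: "openin (Euclidean_space m) U" and V: "openin (Euclidean_space n) V"
  shows "openin (Euclidean_space (m + n)) {z \<in> Eucl (m + n). vtake m z \<in> U \<and> vdrop m z \<in> V}"
proof -
  have o: "openin (Euclidean_space (m + n)) (Eucl (m + n))" by simp
  have "openin (Euclidean_space (m + n)) {z \<in> Eucl (m + n). vtake m z \<in> U}"
    by (rule continuous_on_open_vimage_Eucl[OF o C_inf_on_imp_continuous[OF C_inf_on_vtake[OF o]] _ U]) auto
  moreover have "openin (Euclidean_space (m + n)) {z \<in> Eucl (m + n). vdrop m z \<in> V}"
    by (rule continuous_on_open_vimage_Eucl[OF o C_inf_on_imp_continuous[OF C_inf_on_vdrop[OF o]] _ V])
       (auto simp: vdrop_in_Eucl)
  ultimately have "openin (Euclidean_space (m + n))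
      ({z \<in> Eucl (m + n). vtake m z \<in> U} \<inter> {z \<in> Eucl (m + n). vdrop m z \<in> V})" by blast
  then show ?thesis by (rule back_subst[of "openin (Euclidean_space (m + n))"]) auto
qed

lemma jacobian_vtake: "m \<le> n \<Longrightarrow> jacobian n (vtake m) x v = vtake m v"
proof -
  assume mn: "m \<le> n"
  show "jacobian n (vtake m) x v = vtake m v"
  proof
    fix j
    show "jacobian n (vtake m) x v j = vtake m v j"
    proof (cases "j < m")
      case True
      have "jacobian n (vtake m) x v j = (\<Sum>i<n. if i = j then v i else 0)"
        unfolding jacobian_def using True by (intro sum.cong) (auto simp: vtake_def partial_coord)
      then show ?thesis using True mn by (simp add: vtake_def)
    next
      case False
      then show ?thesis by (simp add: jacobian_def vtake_def partial_def)
    qed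
  qed
qed

text \<open>For \<open>j + m >= n\<close> the sum contributes nothing to component \<open>j\<close>,
  and there \<open>v\<close> has to vanish.\<close>

lemma jacobian_vdrop: "v \<in> Eucl n \<Longrightarrow> jacobian n (vdrop m) x v = vdrop m v"
  by (auto simp: jacobian_def vdrop_def partial_coord Eucl_iff fun_eq_iff if_distrib[of "\<lambda>a. a * _"] cong: if_cong)

text \<open>The derivative at \<open>p\<close> read in the charts \<open>c\<close> and
  \<open>d\<close>. For the identity map it is the coordinate change of tangent vectors, so tangent
  spaces and tangent maps are governed by the same chain rule.\<close>

definition local_deriv ::
    "'p manifold \<Rightarrow> 'p chart \<Rightarrow> 'q chart \<Rightarrow> ('p \<Rightarrow> 'q) \<Rightarrow> 'p \<Rightarrow> (nat \<Rightarrow> real) \<Rightarrow> nat \<Rightarrow> real" where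
  "local_deriv M c d f p = jacobian (mdim M) (chart_map d \<circ> f \<circ> chart_inv c) (chart_map c p)"

lemma local_rep_C_inf:
  assumes M: "atlas_manifold M" and N: "atlas_manifold N" and f: "smooth_map M N f"
    and c: "c \<in> charts M" and d: "d \<in> charts N"
  shows "C_inf_on (mdim M) (chart_map c ` {p \<in> chart_dom c. f p \<in> chart_dom d}) (chart_map d \<circ> f \<circ> chart_inv c)"
    and "openin (Euclidean_space (mdim M)) (chart_map c ` {p \<in> chart_dom c. f p \<in> chart_dom d})"
proof -
  have *: "{p \<in> chart_dom c. f p \<in> chart_dom d} = {p \<in> points M. f p \<in> chart_dom d} \<inter> chart_dom c"
    using chart_dom_subset[OF M c] by auto
  show "C_inf_on (mdim M) (chart_map c ` {p \<in> chart_dom c. f p \<in> chart_dom d}) (chart_map d \<circ> f \<circ> chart_inv c)"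
    unfolding C_inf_on_def *
    using smooth_fnD[OF smooth_map_coord[OF M N f d] c] by simp
  show "openin (Euclidean_space (mdim M)) (chart_map c ` {p \<in> chart_dom c. f p \<in> chart_dom d})"
    unfolding *
    by (rule chart_Int_image_open[OF M c smooth_map_vimage_open[OF M N f chart_dom_open[OF N d]]])
qed

lemma local_deriv_in_Eucl:
  assumes M: "atlas_manifold M" and N: "atlas_manifold N" and f: "smooth_map M N f"
    and c: "c \<in> charts_at M p" and d: "d \<in> charts_at N (f p)"
  shows "local_deriv M c d f p v \<in> Eucl (mdim N)"
proof -
  have c': "c \<in> charts M" "p \<in> chart_dom c" and d': "d \<in> charts N" "f p \<in> chart_dom d"
    using c d by (auto simp: charts_at_iff)
  show ?thesis unfolding local_deriv_def
    by (rule jacobian_in_Eucl[OF local_rep_C_inf(2)[OF M N f c'(1) d'(1)]])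
       (use c' d' M chart_map_in_Eucl[OF N d'(1)] in auto)
qed

text \<open>On a small neighbourhood of \<open>chart_map c p\<close> the chart \<open>d\<close> and
  its inverse can be inserted between \<open>f\<close> and \<open>g\<close> without changing the
  composite, and \<open>jacobian_compose\<close> applies. The sets \<open>?U\<close> and
  \<open>?V\<close> are chosen such that all three charts cover the points met on the way.\<close>

lemma local_deriv_compose:
  assumes M: "atlas_manifold M" and N: "atlas_manifold N" and P: "atlas_manifold P"
    and f: "smooth_map M N f" and g: "smooth_map N P g"
    and c: "c \<in> charts_at M p" and d: "d \<in> charts_at N (f p)" and e: "e \<in> charts_at P (g (f p))"
  shows "local_deriv M c e (g \<circ> f) p v = local_deriv N d e g (f p) (local_deriv M c d f p v)"
proof -
  have c': "c \<in> charts M" "p \<in> chart_dom c" and d': "d \<in> charts N" "f p \<in> chart_dom d"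
    and e': "e \<in> charts P" "g (f p) \<in> chart_dom e"
    using c d e by (auto simp: charts_at_iff)
  let ?U = "chart_map c ` {q \<in> chart_dom c. f q \<in> {r \<in> chart_dom d. g r \<in> chart_dom e}}"
  let ?V = "chart_map d ` {r \<in> chart_dom d. g r \<in> chart_dom e}"
  have V': "openin (space_top N) {r \<in> chart_dom d. g r \<in> chart_dom e}"
  proof -
    have "{r \<in> chart_dom d. g r \<in> chart_dom e} = {r \<in> points N. g r \<in> chart_dom e} \<inter> chart_dom d"
      using chart_dom_subset[OF N d'(1)] by auto
    then show ?thesis
      using smooth_map_vimage_open[OF N P g chart_dom_open[OF P e'(1)]] chart_dom_open[OF N d'(1)] by auto
  qed
  have U': "{q \<in> chart_dom c. f q \<in> {r \<in> chart_dom d. g r \<in> chart_dom e}} =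
      {q \<in> points M. f q \<in> {r \<in> chart_dom d. g r \<in> chart_dom e}} \<inter> chart_dom c"
    using chart_dom_subset[OF M c'(1)] by auto
  have U: "openin (Euclidean_space (mdim M)) ?U"
    unfolding U' by (rule chart_Int_image_open[OF M c'(1) smooth_map_vimage_open[OF M N f V']])
  note V = local_rep_C_inf[OF N P g d'(1) e'(1)]
  have x: "chart_map c p \<in> ?U" using c' d' e' by auto
  have "local_deriv M c e (g \<circ> f) p v =
      jacobian (mdim M) ((chart_map e \<circ> g \<circ> chart_inv d) \<circ> (chart_map d \<circ> f \<circ> chart_inv c)) (chart_map c p) v"
    unfolding local_deriv_def by (rule jacobian_cong[OF U x]) (use M N c' d' in auto)
  also have "\<dots> = jacobian (mdim N) (chart_map e \<circ> g \<circ> chart_inv d)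
      ((chart_map d \<circ> f \<circ> chart_inv c) (chart_map c p))
      (jacobian (mdim M) (chart_map d \<circ> f \<circ> chart_inv c) (chart_map c p) v)"
  proof (rule jacobian_compose[OF U V(2) _ _ V(1) x])
    show "C_inf_on (mdim M) ?U (chart_map d \<circ> f \<circ> chart_inv c)"
      using local_rep_C_inf(1)[OF M N f c'(1) d'(1)] by (rule C_inf_on_subset) auto
    show "(chart_map d \<circ> f \<circ> chart_inv c) ` ?U \<subseteq> ?V"
      using M c' by auto
  qed
  finally show ?thesis using M c' by (simp add: local_deriv_def)
qed

lemma local_deriv_id:
  assumes M: "atlas_manifold M" and c: "c \<in> charts_at M p" and v: "v \<in> Eucl (mdim M)"
  shows "local_deriv M c c (\<lambda>p. p) p v = v"
proof -
  have c': "c \<in> charts M" "p \<in> chart_dom c" using c by (auto simp: charts_at_iff)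
  have "local_deriv M c c (\<lambda>p. p) p v = jacobian (mdim M) (\<lambda>x. x) (chart_map c p) v"
    unfolding local_deriv_def
    by (rule jacobian_cong[OF chart_image_open[OF M c'(1) chart_dom_open[OF M c'(1)]]]) (use M c' in auto)
  then show ?thesis using jacobian_id[OF v] by simp
qed

lemma local_deriv_cong:
  assumes M: "atlas_manifold M" and c: "c \<in> charts_at M p" and eq: "\<And>q. q \<in> points M \<Longrightarrow> f q = g q"
  shows "local_deriv M c d f p v = local_deriv M c d g p v"
proof -
  have c': "c \<in> charts M" "p \<in> chart_dom c" using c by (auto simp: charts_at_iff)
  show ?thesis unfolding local_deriv_def
    by (rule jacobian_cong[OF chart_image_open[OF M c'(1) chart_dom_open[OF M c'(1)]]])
       (use M c' eq chart_dom_subset[OF M c'(1)] in auto)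
qed

text \<open>The chain rule with an identity map before or after \<open>f\<close>: the change of the
  source chart and that of the target chart.\<close>

lemma local_deriv_change:
  assumes M: "atlas_manifold M" and N: "atlas_manifold N" and f: "smooth_map M N f"
    and c: "c \<in> charts_at M p" "c' \<in> charts_at M p"
    and d: "d \<in> charts_at N (f p)" "d' \<in> charts_at N (f p)"
  shows "local_deriv M c' d f p (local_deriv M c c' (\<lambda>p. p) p v) = local_deriv M c d f p v"
    and "local_deriv N d d' (\<lambda>p. p) (f p) (local_deriv M c d f p v) = local_deriv M c d' f p v"
  using local_deriv_compose[OF M M N smooth_map_id[OF M] f c(1), of c' d v]
    local_deriv_compose[OF M N N f smooth_map_id[OF N] c(1) d(1), of d' v] assms
  by (simp_all add: comp_def)

lemma tangent_space_iff:
  "v \<in> tangent_space M p \<longleftrightarrow>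
     (\<forall>c. c \<notin> charts_at M p \<longrightarrow> v c = (\<lambda>_. 0)) \<and>
     (\<forall>c\<in>charts_at M p. v c \<in> Eucl (mdim M)) \<and>
     (\<forall>c\<in>charts_at M p. \<forall>d\<in>charts_at M p. v d = local_deriv M c d (\<lambda>p. p) p (v c))"
  unfolding tangent_space_def local_deriv_def comp_def by blast

lemma tangent_spaceI:
  assumes "\<And>c. c \<notin> charts_at M p \<Longrightarrow> v c = (\<lambda>_. 0)"
    and "\<And>c. c \<in> charts_at M p \<Longrightarrow> v c \<in> Eucl (mdim M)"
    and "\<And>c d. c \<in> charts_at M p \<Longrightarrow> d \<in> charts_at M p \<Longrightarrow> v d = local_deriv M c d (\<lambda>p. p) p (v c)"
  shows "v \<in> tangent_space M p"
  unfolding tangent_space_iff using assms by blast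

lemma tangent_space_in_Eucl: "v \<in> tangent_space M p \<Longrightarrow> c \<in> charts_at M p \<Longrightarrow> v c \<in> Eucl (mdim M)"
  unfolding tangent_space_iff by blast

lemma tangent_space_change:
  "v \<in> tangent_space M p \<Longrightarrow> c \<in> charts_at M p \<Longrightarrow> d \<in> charts_at M p \<Longrightarrow>
    v d = local_deriv M c d (\<lambda>p. p) p (v c)"
  unfolding tangent_space_iff by blast

lemma tangent_space_notin: "v \<in> tangent_space M p \<Longrightarrow> c \<notin> charts_at M p \<Longrightarrow> v c = (\<lambda>_. 0)"
  unfolding tangent_space_iff by blast

text \<open>The components in the other charts at \<open>p\<close> are forced by the coordinate
  change, and those in charts not at \<open>p\<close> are 0.\<close>

lemma tangent_eqI:
  assumes "v \<in> tangent_space M p" "w \<in> tangent_space M p" "c \<in> charts_at M p" "v c = w c"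
  shows "v = w"
proof
  fix d show "v d = w d"
  proof (cases "d \<in> charts_at M p")
    case True
    show ?thesis
      unfolding tangent_space_change[OF assms(1,3) True] tangent_space_change[OF assms(2,3) True]
      by (simp add: assms(4))
  next
    case False
    then show ?thesis
      by (simp add: tangent_space_notin[OF assms(1)] tangent_space_notin[OF assms(2)])
  qed
qed

text \<open>The tangent vector at \<open>p\<close> whose coordinates in the chart \<open>c\<close>
  are \<open>w\<close>. With \<open>tangent_eqI\<close> it makes reading a tangent vector in
  \<open>c\<close> a bijection onto \<open>Eucl (mdim M)\<close>.\<close>

definition tvec :: "'p manifold \<Rightarrow> 'p \<Rightarrow> 'p chart \<Rightarrow> (nat \<Rightarrow> real) \<Rightarrow> 'p tvec" where
  "tvec M p c w = (\<lambda>d. if d \<in> charts_at M p then local_deriv M c d (\<lambda>p. p) p w else (\<lambda>_. 0))"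

lemma tvec_in:
  assumes M: "atlas_manifold M" and c: "c \<in> charts_at M p" and w: "w \<in> Eucl (mdim M)"
  shows "tvec M p c w \<in> tangent_space M p" and "tvec M p c w c = w"
proof -
  note id = smooth_map_id[OF M]
  show "tvec M p c w c = w" using c local_deriv_id[OF assms] by (simp add: tvec_def)
  show "tvec M p c w \<in> tangent_space M p"
  proof (rule tangent_spaceI)
    fix d e assume d: "d \<in> charts_at M p"
    show "tvec M p c w d \<in> Eucl (mdim M)"
      using d local_deriv_in_Eucl[OF M M id c d] by (simp add: tvec_def)
    assume e: "e \<in> charts_at M p"
    show "tvec M p c w e = local_deriv M d e (\<lambda>p. p) p (tvec M p c w d)"
      using d e local_deriv_change(2)[OF M M id c c d e] by (simp add: tvec_def)
  qed (simp add: tvec_def)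
qed

lemma tangent_add:
  assumes v: "v \<in> tangent_space M p" and w: "w \<in> tangent_space M p"
  shows "(\<lambda>c i. v c i + w c i) \<in> tangent_space M p"
proof (rule tangent_spaceI)
  fix c d assume c: "c \<in> charts_at M p"
  show "(\<lambda>i. v c i + w c i) \<in> Eucl (mdim M)"
    using tangent_space_in_Eucl[OF v c] tangent_space_in_Eucl[OF w c] by (simp add: Eucl_iff)
  assume d: "d \<in> charts_at M p"
  show "(\<lambda>i. v d i + w d i) = local_deriv M c d (\<lambda>p. p) p (\<lambda>i. v c i + w c i)"
    unfolding tangent_space_change[OF v c d] tangent_space_change[OF w c d]
    by (simp add: local_deriv_def jacobian_add)
qed (simp add: tangent_space_notin[OF v] tangent_space_notin[OF w])

lemma tangent_scale:
  assumes v: "v \<in> tangent_space M p"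
  shows "(\<lambda>c i. r * v c i) \<in> tangent_space M p"
proof (rule tangent_spaceI)
  fix c d assume c: "c \<in> charts_at M p"
  show "(\<lambda>i. r * v c i) \<in> Eucl (mdim M)"
    using tangent_space_in_Eucl[OF v c] by (simp add: Eucl_iff)
  assume d: "d \<in> charts_at M p"
  show "(\<lambda>i. r * v d i) = local_deriv M c d (\<lambda>p. p) p (\<lambda>i. r * v c i)"
    unfolding tangent_space_change[OF v c d] by (simp add: local_deriv_def jacobian_scale)
qed (simp add: tangent_space_notin[OF v])

lemma tangent_zero: "(\<lambda>_ _. 0) \<in> tangent_space M p"
  by (rule tangent_spaceI) (auto simp: Eucl_iff local_deriv_def jacobian_zero)

lemma fst_tangent_map [simp]: "fst (tangent_map M N f x) = f (fst x)"
  by (simp add: tangent_map_def split_beta)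

lemma tangent_map_notin: "d \<notin> charts_at N (f p) \<Longrightarrow> snd (tangent_map M N f (p, v)) d = (\<lambda>_. 0)"
  by (simp add: tangent_map_def)

context
  fixes M :: "'p manifold" and N :: "'q manifold" and f
  assumes M: "atlas_manifold M" and N: "atlas_manifold N" and f: "smooth_map M N f"
begin

text \<open>The chart picked by \<open>SOME\<close> in \<open>tangent_map\<close> is irrelevant:
  passing from it to \<open>c\<close> changes the coordinates of \<open>v\<close> and the local
  derivative by mutually cancelling factors.\<close>

lemma tangent_map_chart:
  assumes v: "v \<in> tangent_space M p" and c: "c \<in> charts_at M p" and d: "d \<in> charts_at N (f p)"
  shows "snd (tangent_map M N f (p, v)) d = local_deriv M c d f p (v c)"
proof -
  define c0 where "c0 = (SOME c. c \<in> charts_at M p)"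
  have c0: "c0 \<in> charts_at M p" unfolding c0_def using c by (rule someI)
  have "snd (tangent_map M N f (p, v)) d = local_deriv M c0 d f p (v c0)"
    using d by (simp add: tangent_map_def c0_def local_deriv_def Let_def)
  also have "v c0 = local_deriv M c c0 (\<lambda>p. p) p (v c)"
    by (rule tangent_space_change[OF v c c0])
  finally show ?thesis using local_deriv_change(1)[OF M N f c c0 d d] by simp
qed

lemma tangent_map_in:
  assumes p: "p \<in> points M" and v: "v \<in> tangent_space M p"
  shows "snd (tangent_map M N f (p, v)) \<in> tangent_space N (f p)"
proof -
  obtain c where c: "c \<in> charts_at M p" using charts_at_ex[OF M p] by blast
  note * = tangent_map_chart[OF v c]
  show ?thesis
  proof (rule tangent_spaceI)
    show "snd (tangent_map M N f (p, v)) d = (\<lambda>_. 0)" if "d \<notin> charts_at N (f p)" for d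
      using that by (simp add: tangent_map_notin)
    show "snd (tangent_map M N f (p, v)) d \<in> Eucl (mdim N)" if "d \<in> charts_at N (f p)" for d
      using *[OF that] local_deriv_in_Eucl[OF M N f c that] by simp
    show "snd (tangent_map M N f (p, v)) e =
        local_deriv N d e (\<lambda>p. p) (f p) (snd (tangent_map M N f (p, v)) d)"
      if "d \<in> charts_at N (f p)" "e \<in> charts_at N (f p)" for d e
      using *[OF that(1)] *[OF that(2)] local_deriv_change(2)[OF M N f c c that] by simp
  qed
qed

lemma tangent_map_points: "x \<in> tangent_points M \<Longrightarrow> tangent_map M N f x \<in> tangent_points N"
  using tangent_map_in[of "fst x" "snd x"] smooth_map_points[OF f, of "fst x"]
  by (cases "tangent_map M N f x")
     (metis (no_types, lifting) SigmaE2 SigmaI fst_conv fst_tangent_map prod.collapse snd_conv tangent_points_def)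

text \<open>Values of tangent maps are compared in a single pair of charts; all other components
  follow from \<open>tangent_eqI\<close>.\<close>

lemma tangent_map_eqI:
  assumes p: "p \<in> points M" and v: "v \<in> tangent_space M p" and w: "w \<in> tangent_space N (f p)"
    and c: "c \<in> charts_at M p" and d: "d \<in> charts_at N (f p)" and eq: "local_deriv M c d f p (v c) = w d"
  shows "tangent_map M N f (p, v) = (f p, w)"
  using tangent_eqI[OF tangent_map_in[OF p v] w d] tangent_map_chart[OF v c d] eq
  by (simp add: prod_eq_iff)

lemma tangent_map_add:
  assumes p: "p \<in> points M" and v: "v \<in> tangent_space M p" and w: "w \<in> tangent_space M p"
  shows "tangent_map M N f (p, \<lambda>c i. v c i + w c i) =
    (f p, \<lambda>d i. snd (tangent_map M N f (p, v)) d i + snd (tangent_map M N f (p, w)) d i)"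
proof -
  obtain c where c: "c \<in> charts_at M p" using charts_at_ex[OF M p] by blast
  obtain d where d: "d \<in> charts_at N (f p)" using charts_at_ex[OF N smooth_map_points[OF f p]] by blast
  show ?thesis
    by (rule tangent_map_eqI[OF p tangent_add[OF v w] tangent_add[OF tangent_map_in[OF p v] tangent_map_in[OF p w]] c d])
       (simp add: tangent_map_chart[OF v c d] tangent_map_chart[OF w c d] local_deriv_def jacobian_add)
qed

lemma tangent_map_scale:
  assumes p: "p \<in> points M" and v: "v \<in> tangent_space M p"
  shows "tangent_map M N f (p, \<lambda>c i. r * v c i) = (f p, \<lambda>d i. r * snd (tangent_map M N f (p, v)) d i)"
proof -
  obtain c where c: "c \<in> charts_at M p" using charts_at_ex[OF M p] by blast
  obtain d where d: "d \<in> charts_at N (f p)" using charts_at_ex[OF N smooth_map_points[OF f p]] by blast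
  show ?thesis
    by (rule tangent_map_eqI[OF p tangent_scale[OF v] tangent_scale[OF tangent_map_in[OF p v]] c d])
       (simp add: tangent_map_chart[OF v c d] local_deriv_def jacobian_scale)
qed

text \<open>Arrows carry functions restricted to the points of the manifold; this removes or adds
  such a restriction under \<open>tangent_map\<close>. Both sides pick the same chart, as the choice
  depends only on the base point.\<close>

lemma tangent_map_cong:
  assumes x: "x \<in> tangent_points M" and eq: "\<And>q. q \<in> points M \<Longrightarrow> f q = g q"
  shows "tangent_map M N f x = tangent_map M N g x"
proof -
  obtain p v where pv: "x = (p, v)" "p \<in> points M" "v \<in> tangent_space M p"
    using x by (auto simp: tangent_points_def)
  have c: "(SOME c. c \<in> charts_at M p) \<in> charts_at M p"
    using charts_at_ex[OF M pv(2)] by (rule someI_ex)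
  have "local_deriv M (SOME c. c \<in> charts_at M p) d f p w =
      local_deriv M (SOME c. c \<in> charts_at M p) d g p w" for d :: "'q chart" and w
    by (rule local_deriv_cong[OF M c eq])
  then show ?thesis using eq[OF pv(2)]
    by (simp add: tangent_map_def pv(1) Let_def local_deriv_def cong: if_cong)
qed

end

lemma tangent_map_compose:
  assumes M: "atlas_manifold M" and N: "atlas_manifold N" and P: "atlas_manifold P"
    and f: "smooth_map M N f" and g: "smooth_map N P g" and x: "x \<in> tangent_points M"
  shows "tangent_map M P (g \<circ> f) x = tangent_map N P g (tangent_map M N f x)"
proof -
  obtain p v where pv: "x = (p, v)" "p \<in> points M" "v \<in> tangent_space M p"
    using x by (auto simp: tangent_points_def)
  obtain c where c: "c \<in> charts_at M p" using charts_at_ex[OF M pv(2)] by blast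
  note fp = smooth_map_points[OF f pv(2)]
  obtain d where d: "d \<in> charts_at N (f p)" using charts_at_ex[OF N fp] by blast
  obtain e where e: "e \<in> charts_at P (g (f p))"
    using charts_at_ex[OF P smooth_map_points[OF g fp]] by blast
  let ?w = "snd (tangent_map M N f (p, v))"
  have w: "?w \<in> tangent_space N (f p)" by (rule tangent_map_in[OF M N f pv(2,3)])
  have Tf: "tangent_map M N f x = (f p, ?w)" by (simp add: pv(1) prod_eq_iff)
  have "tangent_map M P (g \<circ> f) (p, v) = ((g \<circ> f) p, snd (tangent_map N P g (f p, ?w)))"
  proof (rule tangent_map_eqI[OF M P smooth_map_compose[OF M N P f g] pv(2,3) _ c])
    show "snd (tangent_map N P g (f p, ?w)) \<in> tangent_space P ((g \<circ> f) p)"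
      using tangent_map_in[OF N P g fp w] by simp
    show "e \<in> charts_at P ((g \<circ> f) p)" using e by simp
    show "local_deriv M c e (g \<circ> f) p (v c) = snd (tangent_map N P g (f p, ?w)) e"
      using tangent_map_chart[OF N P g w d e] tangent_map_chart[OF M N f pv(3) c d]
        local_deriv_compose[OF M N P f g c d e] by simp
  qed
  then show ?thesis unfolding Tf by (simp add: pv(1) prod_eq_iff)
qed

lemma tangent_map_id:
  assumes M: "atlas_manifold M" and x: "x \<in> tangent_points M"
  shows "tangent_map M M (\<lambda>p. p) x = x"
proof -
  obtain p v where pv: "x = (p, v)" "p \<in> points M" "v \<in> tangent_space M p"
    using x by (auto simp: tangent_points_def)
  obtain c where c: "c \<in> charts_at M p" using charts_at_ex[OF M pv(2)] by blast
  show ?thesis unfolding pv(1)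
    by (rule tangent_map_eqI[OF M M smooth_map_id[OF M] pv(2,3,3) c c])
       (rule local_deriv_id[OF M c tangent_space_in_Eucl[OF pv(3) c]])
qed

text \<open>Only a one-sided inverse enters, so the lemma can be applied with the roles exchanged:
  once it gives injectivity of a tangent map, once it shows that a candidate for the preimage has
  the right image.\<close>

lemma tangent_map_inverse:
  assumes M: "atlas_manifold M" and N: "atlas_manifold N"
    and f: "smooth_map M N f" and g: "smooth_map N M g"
    and gf: "\<forall>p\<in>points M. g (f p) = p" and x: "x \<in> tangent_points M"
  shows "tangent_map N M g (tangent_map M N f x) = x"
proof -
  have "tangent_map N M g (tangent_map M N f x) = tangent_map M M (g \<circ> f) x"
    by (rule tangent_map_compose[OF M N M f g x, symmetric])
  also have "\<dots> = tangent_map M M (\<lambda>p. p) x"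
    by (rule tangent_map_cong[OF M M smooth_map_compose[OF M N M f g] x]) (simp add: gf)
  finally show ?thesis using tangent_map_id[OF M x] by simp
qed

section \<open>The atlas of the tangent bundle\<close>

lemma tangent_chart_dom: "chart_dom (tangent_chart M c) = Sigma (chart_dom c) (tangent_space M)"
  by (simp add: tangent_chart_def)

lemma tangent_chart_map:
  "chart_map (tangent_chart M c) x = vec_append (mdim M) (chart_map c (fst x)) (snd x c)"
  by (simp add: tangent_chart_def split_beta)

context
  fixes M :: "'p manifold"
  assumes M: "atlas_manifold M"
begin

lemma tangent_chart_in_Eucl:
  assumes "c \<in> charts M" "x \<in> chart_dom (tangent_chart M c)"
  shows "chart_map (tangent_chart M c) x \<in> Eucl (2 * mdim M)"
proof -
  have "snd x c \<in> Eucl (mdim M)"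
    using assms by (intro tangent_space_in_Eucl[of _ M "fst x"]) (auto simp: tangent_chart_dom charts_at_iff)
  then show ?thesis unfolding tangent_chart_map mult_2 by (rule vec_append_in_Eucl)
qed

lemma tangent_chart_inj:
  assumes c: "c \<in> charts M"
  shows "inj_on (chart_map (tangent_chart M c)) (chart_dom (tangent_chart M c))"
proof (rule inj_onI)
  fix x y assume x: "x \<in> chart_dom (tangent_chart M c)" and y: "y \<in> chart_dom (tangent_chart M c)"
    and eq: "chart_map (tangent_chart M c) x = chart_map (tangent_chart M c) y"
  have xy: "fst x \<in> chart_dom c" "snd x \<in> tangent_space M (fst x)"
    "fst y \<in> chart_dom c" "snd y \<in> tangent_space M (fst y)"
    using x y by (auto simp: tangent_chart_dom)
  have "chart_map c (fst x) = chart_map c (fst y)" and s: "snd x c = snd y c"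
    using eq xy chart_map_in_Eucl[OF M c] by (simp_all add: tangent_chart_map vec_append_inj)
  then have "fst x = fst y"
    using is_chart_inj[OF chart_is_chart[OF M c]] xy by (auto dest: inj_onD)
  then show "x = y"
    using tangent_eqI[of "snd x" M "fst x" "snd y" c] xy s c by (auto simp: charts_at_iff prod_eq_iff)
qed

text \<open>The image is a full cylinder, since by \<open>tvec_in\<close> every vector of
  \<open>Eucl (mdim M)\<close> is the coordinate vector of some tangent vector.\<close>

lemma tangent_chart_image:
  assumes c: "c \<in> charts M" and W: "W \<subseteq> chart_dom c"
  shows "chart_map (tangent_chart M c) ` Sigma W (tangent_space M) =
    {z \<in> Eucl (2 * mdim M). vtake (mdim M) z \<in> chart_map c ` W}"
proof (intro equalityI subsetI)
  fix z assume "z \<in> chart_map (tangent_chart M c) ` Sigma W (tangent_space M)"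
  then obtain x where x: "x \<in> Sigma W (tangent_space M)" "z = chart_map (tangent_chart M c) x" by blast
  then have "x \<in> chart_dom (tangent_chart M c)" using W by (auto simp: tangent_chart_dom)
  then show "z \<in> {z \<in> Eucl (2 * mdim M). vtake (mdim M) z \<in> chart_map c ` W}"
    using x tangent_chart_in_Eucl[OF c] chart_map_in_Eucl[OF M c] W by (auto simp: tangent_chart_map subset_iff)
next
  fix z assume z: "z \<in> {z \<in> Eucl (2 * mdim M). vtake (mdim M) z \<in> chart_map c ` W}"
  then obtain p where p: "p \<in> W" "vtake (mdim M) z = chart_map c p" by auto
  have c': "c \<in> charts_at M p" using p W c by (auto simp: charts_at_iff)
  have "vdrop (mdim M) z \<in> Eucl (mdim M)" using z by (auto intro: vdrop_in_Eucl simp: mult_2)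
  note v = tvec_in[OF M c' this]
  have "chart_map (tangent_chart M c) (p, tvec M p c (vdrop (mdim M) z)) = z"
    using v(2) p(2)[symmetric] by (simp add: tangent_chart_map)
  then show "z \<in> chart_map (tangent_chart M c) ` Sigma W (tangent_space M)"
    using v(1) p(1) by force
qed

lemma tangent_chart_image_open:
  assumes c: "c \<in> charts M" and W: "W \<subseteq> chart_dom c" "openin (space_top M) W"
  shows "openin (Euclidean_space (2 * mdim M)) (chart_map (tangent_chart M c) ` Sigma W (tangent_space M))"
proof -
  have *: "{z \<in> Eucl (2 * mdim M). vtake (mdim M) z \<in> chart_map c ` W} =
    {z \<in> Eucl (mdim M + mdim M). vtake (mdim M) z \<in> chart_map c ` W \<and> vdrop (mdim M) z \<in> Eucl (mdim M)}"
    by (auto simp: mult_2 intro: vdrop_in_Eucl)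
  show ?thesis
    unfolding tangent_chart_image[OF c W(1)] * unfolding mult_2
    by (rule openin_Eucl_append[OF chart_image_open[OF M c W(2,1)]]) simp
qed

lemma tangent_chart_inv:
  assumes "c \<in> charts M" "x \<in> chart_dom (tangent_chart M c)"
  shows "chart_inv (tangent_chart M c) (chart_map (tangent_chart M c) x) = x"
  unfolding chart_inv_def using tangent_chart_inj[OF assms(1)] assms(2) by (rule inv_into_f_f)

text \<open>With \<tau> the transition from \<open>c\<close> to \<open>d\<close>, the transition of
  the tangent charts applies \<tau> to the base coordinates and the Jacobian of \<tau> to the fibre
  coordinates. It is linear in the fibre, with partial derivatives of \<tau> as
  coefficients.\<close>

lemma tangent_chart_transition:
  assumes c: "c \<in> charts M" and d: "d \<in> charts M"
  shows "C_inf_on (2 * mdim M)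
    (chart_map (tangent_chart M c) ` Sigma (chart_dom c \<inter> chart_dom d) (tangent_space M))
    (chart_map (tangent_chart M d) \<circ> chart_inv (tangent_chart M c))"
proof -
  let ?n = "mdim M" and ?W = "chart_dom c \<inter> chart_dom d"
  let ?U = "chart_map (tangent_chart M c) ` Sigma ?W (tangent_space M)"
  let ?\<tau> = "chart_map d \<circ> chart_inv c"
  have W: "openin (space_top M) ?W" using chart_dom_open[OF M c] chart_dom_open[OF M d] by blast
  have U: "openin (Euclidean_space (2 * ?n)) ?U"
    by (rule tangent_chart_image_open[OF c _ W]) auto
  have oW: "openin (Euclidean_space ?n) (chart_map c ` ?W)"
    by (rule chart_image_open[OF M c W]) auto
  have \<tau>: "C_inf_on ?n (chart_map c ` ?W) ?\<tau>"
    by (rule compatible_transition[OF charts_compatible[OF M c d]])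
  have sub: "vtake ?n ` ?U \<subseteq> chart_map c ` ?W"
    using tangent_chart_image[OF c, of ?W] by auto
  note comp = C_k_on_compose[OF U oW C_inf_on_vtake[OF U] sub]
  let ?J = "\<lambda>z. jacobian ?n ?\<tau> (vtake ?n z) (vdrop ?n z)"
  have "C_inf_on (2 * ?n) ?U (\<lambda>z. vec_append ?n (?\<tau> (vtake ?n z)) (?J z))"
  proof (rule C_inf_on_append)
    show "C_inf_on (2 * ?n) ?U (\<lambda>z. ?\<tau> (vtake ?n z))"
      unfolding C_inf_on_def using comp[OF C_inf_on_imp_C_k[OF \<tau>]] by blast
    show "C_inf_on (2 * ?n) ?U ?J"
      unfolding C_inf_on_def jacobian_def
    proof (intro allI C_k_on_sum[OF U] C_k_on_mult[OF U])
      fix j k i assume "i \<in> {..<?n}"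
      then show "C_k_on (2 * ?n) k ?U (\<lambda>z. partial i (\<lambda>y. ?\<tau> y j) (vtake ?n z))"
        by (intro comp C_k_on_partial[OF \<tau>]) auto
      show "C_k_on (2 * ?n) k ?U (\<lambda>z. vdrop ?n z i)"
        using C_inf_on_vdrop[OF U] by (rule C_inf_on_imp_C_k)
    qed
  qed
  \<comment> \<open>On the fibre this is the coordinate change that defines
    \<open>tangent_space\<close>.\<close>
  moreover have "vec_append ?n (?\<tau> (vtake ?n z)) (?J z) =
      (chart_map (tangent_chart M d) \<circ> chart_inv (tangent_chart M c)) z" if "z \<in> ?U" for z
  proof -
    obtain p v where pv: "p \<in> chart_dom c" "p \<in> chart_dom d" "v \<in> tangent_space M p"
      "z = chart_map (tangent_chart M c) (p, v)" using \<open>z \<in> ?U\<close> by blast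
    have "(p, v) \<in> chart_dom (tangent_chart M c)" using pv by (simp add: tangent_chart_dom)
    then have inv: "chart_inv (tangent_chart M c) z = (p, v)"
      using tangent_chart_inv[OF c] pv(4) by simp
    have t: "vtake ?n z = chart_map c p" "vdrop ?n z = v c"
      using pv(4) chart_map_in_Eucl[OF M c pv(1)] by (simp_all add: tangent_chart_map)
    have "v d = local_deriv M c d (\<lambda>p. p) p (v c)"
      using pv c d by (intro tangent_space_change) (auto simp: charts_at_iff)
    then show ?thesis using M c pv(1)
      by (simp add: inv t tangent_chart_map local_deriv_def comp_def)
  qed
  ultimately show ?thesis
    by (subst C_inf_on_cong[OF U, symmetric]) auto
qed

lemma tangent_chart_dom_Int:
  "chart_dom (tangent_chart M c) \<inter> chart_dom (tangent_chart M d) =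
    Sigma (chart_dom c \<inter> chart_dom d) (tangent_space M)"
  by (auto simp: tangent_chart_dom)

text \<open>The defining predicate of \<open>tangent_topology\<close> must first be shown to be a
  topology. Intersections are the point in question: images commute with them because tangent charts
  are injective.\<close>

lemma openin_tangent_topology:
  "openin (tangent_topology M) W \<longleftrightarrow> W \<subseteq> tangent_points M \<and>
     (\<forall>c\<in>charts M. openin (Euclidean_space (2 * mdim M))
        (chart_map (tangent_chart M c) ` (W \<inter> chart_dom (tangent_chart M c))))"
proof -
  let ?P = "\<lambda>W. W \<subseteq> tangent_points M \<and> (\<forall>c\<in>charts M. openin (Euclidean_space (2 * mdim M))
        (chart_map (tangent_chart M c) ` (W \<inter> chart_dom (tangent_chart M c))))"
  have "istopology ?P"
    unfolding istopology_def
  proof (intro conjI allI impI ballI)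
    fix S T assume ST: "?P S" "?P T"
    then show "S \<inter> T \<subseteq> tangent_points M" by blast
    fix c assume c: "c \<in> charts M"
    let ?f = "chart_map (tangent_chart M c)" and ?D = "chart_dom (tangent_chart M c)"
    have "?f ` (S \<inter> T \<inter> ?D) = ?f ` ((S \<inter> ?D) \<inter> (T \<inter> ?D))" by (rule arg_cong[of _ _ "image ?f"]) blast
    also have "\<dots> = ?f ` (S \<inter> ?D) \<inter> ?f ` (T \<inter> ?D)"
      by (rule inj_on_image_Int[OF tangent_chart_inj[OF c]]) auto
    finally show "openin (Euclidean_space (2 * mdim M)) (?f ` (S \<inter> T \<inter> ?D))"
      using ST c by auto
  next
    fix K assume K: "\<forall>S\<in>K. ?P S"
    then show "\<Union>K \<subseteq> tangent_points M" by blast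
    fix c assume c: "c \<in> charts M"
    let ?f = "chart_map (tangent_chart M c)" and ?D = "chart_dom (tangent_chart M c)"
    have "?f ` (\<Union>K \<inter> ?D) = \<Union>((\<lambda>S. ?f ` (S \<inter> ?D)) ` K)" by blast
    then show "openin (Euclidean_space (2 * mdim M)) (?f ` (\<Union>K \<inter> ?D))"
      using K c by auto
  qed
  then show ?thesis unfolding tangent_topology_def by (simp add: topology_inverse')
qed

lemma topspace_tangent_topology: "topspace (tangent_topology M) = tangent_points M"
proof
  show "topspace (tangent_topology M) \<subseteq> tangent_points M"
    using openin_tangent_topology openin_topspace by blast
  have "tangent_points M \<inter> chart_dom (tangent_chart M c) = Sigma (chart_dom c) (tangent_space M)"
    if "c \<in> charts M" for c
    using chart_dom_subset[OF M that] by (auto simp: tangent_chart_dom tangent_points_def)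
  then have "openin (tangent_topology M) (tangent_points M)"
    using tangent_chart_image_open chart_dom_open[OF M] by (simp add: openin_tangent_topology)
  then show "tangent_points M \<subseteq> topspace (tangent_topology M)"
    by (rule openin_subset)
qed

text \<open>Openness asks for the image in every tangent chart. For a set inside one chart domain,
  the image in another chart is a preimage under a transition map, which is continuous.\<close>

lemma tangent_chart_openin_iff:
  assumes c: "c \<in> charts M" and W: "W \<subseteq> chart_dom (tangent_chart M c)"
  shows "openin (tangent_topology M) W \<longleftrightarrow>
    openin (Euclidean_space (2 * mdim M)) (chart_map (tangent_chart M c) ` W)"
proof
  assume "openin (tangent_topology M) W"
  moreover have "W \<inter> chart_dom (tangent_chart M c) = W" using W by blast
  ultimately show "openin (Euclidean_space (2 * mdim M)) (chart_map (tangent_chart M c) ` W)"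
    using c unfolding openin_tangent_topology by metis
next
  assume o: "openin (Euclidean_space (2 * mdim M)) (chart_map (tangent_chart M c) ` W)"
  show "openin (tangent_topology M) W"
    unfolding openin_tangent_topology
  proof (intro conjI ballI)
    show "W \<subseteq> tangent_points M"
      using W chart_dom_subset[OF M c] by (auto simp: tangent_chart_dom tangent_points_def)
    fix d assume d: "d \<in> charts M"
    let ?C = "tangent_chart M c" and ?D = "tangent_chart M d"
    let ?U = "chart_map ?D ` Sigma (chart_dom d \<inter> chart_dom c) (tangent_space M)"
    have "openin (Euclidean_space (2 * mdim M))
        {z \<in> ?U. (chart_map ?C \<circ> chart_inv ?D) z \<in> chart_map ?C ` W}"
    proof (rule continuous_on_open_vimage_Eucl[OF _ _ _ o])
      show "openin (Euclidean_space (2 * mdim M)) ?U"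
        using chart_dom_open[OF M c] chart_dom_open[OF M d]
        by (intro tangent_chart_image_open[OF d]) auto
      show "continuous_on ?U (chart_map ?C \<circ> chart_inv ?D)"
        by (rule C_inf_on_imp_continuous[OF tangent_chart_transition[OF d c]])
      show "(chart_map ?C \<circ> chart_inv ?D) ` ?U \<subseteq> Eucl (2 * mdim M)"
      proof (clarsimp simp: image_subset_iff)
        fix p v assume pv: "p \<in> chart_dom d" "p \<in> chart_dom c" "v \<in> tangent_space M p"
        then have "(p, v) \<in> chart_dom ?D" "(p, v) \<in> chart_dom ?C" by (auto simp: tangent_chart_dom)
        then show "chart_map ?C (chart_inv ?D (chart_map ?D (p, v))) \<in> Eucl (2 * mdim M)"
          using tangent_chart_inv[OF d] tangent_chart_in_Eucl[OF c] by simp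
      qed
    qed
    also have "{z \<in> ?U. (chart_map ?C \<circ> chart_inv ?D) z \<in> chart_map ?C ` W} =
        chart_map ?D ` (W \<inter> chart_dom ?D)"
    proof -
      have 1: "(chart_map ?C \<circ> chart_inv ?D) (chart_map ?D x) \<in> chart_map ?C ` W \<longleftrightarrow> x \<in> W"
        if "x \<in> chart_dom ?D \<inter> chart_dom ?C" for x
        using tangent_chart_inv[OF d, of x] inj_on_image_mem_iff[OF tangent_chart_inj[OF c], of x W] W that
        by simp
      have 2: "W \<inter> chart_dom ?D = {x \<in> chart_dom ?D \<inter> chart_dom ?C. x \<in> W}" using W by auto
      show ?thesis unfolding 2 tangent_chart_dom_Int[symmetric] using 1 by blast
    qed
    finally show "openin (Euclidean_space (2 * mdim M)) (chart_map ?D ` (W \<inter> chart_dom ?D))" .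
  qed
qed

lemma tangent_chart_is_chart:
  assumes c: "c \<in> charts M"
  shows "is_chart (tangent_topology M) (2 * mdim M) (tangent_chart M c)"
  unfolding is_chart_iff
  using tangent_chart_openin_iff[OF c] tangent_chart_inj[OF c] tangent_chart_in_Eucl[OF c]
    tangent_chart_image_open[OF c subset_refl chart_dom_open[OF M c]]
  by (auto simp flip: tangent_chart_dom)

lemma atlas_tangent_bundle: "atlas_manifold (tangent_bundle M)"
  and tangent_chart_in_charts: "c \<in> charts M \<Longrightarrow> tangent_chart M c \<in> charts (tangent_bundle M)"
proof -
  have *: "(\<Union>a\<in>tangent_chart M ` charts M. chart_dom a) = topspace (tangent_topology M)"
  proof -
    have "(\<Union>c\<in>charts M. chart_dom c) = points M" using M by (simp add: atlas_manifold_def)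
    then show ?thesis unfolding topspace_tangent_topology tangent_points_def image_image tangent_chart_dom
      by blast
  qed
  have isc: "is_chart (tangent_topology M) (2 * mdim M) a" if "a \<in> tangent_chart M ` charts M" for a
    using that tangent_chart_is_chart by blast
  have tr: "C_inf_on (2 * mdim M) (chart_map a ` (chart_dom a \<inter> chart_dom b)) (chart_map b \<circ> chart_inv a)"
    if ab: "a \<in> tangent_chart M ` charts M" "b \<in> tangent_chart M ` charts M" for a b
  proof -
    obtain c where "c \<in> charts M" "a = tangent_chart M c" using ab by blast
    moreover obtain d where "d \<in> charts M" "b = tangent_chart M d" using ab by blast
    ultimately show ?thesis using tangent_chart_transition by (simp add: tangent_chart_dom_Int)
  qed
  note A = atlas_manifold_of_atlas[OF isc * tr, folded tangent_bundle_def]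
  show "atlas_manifold (tangent_bundle M)" by (rule A(1))
  show "c \<in> charts M \<Longrightarrow> tangent_chart M c \<in> charts (tangent_bundle M)" using A(2) by blast
qed

lemma points_tangent_bundle: "points (tangent_bundle M) = tangent_points M"
  by (simp add: tangent_bundle_def manifold_of_atlas_def topspace_tangent_topology)

text \<open>The base coordinates of \<open>F\<close> are those of the smooth map \<open>f\<close>,
  so only the fibre coordinates remain to be tested, in one chart at each point.\<close>

lemma smooth_tangentI:
  assumes Q: "atlas_manifold Q" and f: "smooth_map Q M f"
    and F: "\<And>q. q \<in> points Q \<Longrightarrow> fst (F q) = f q \<and> snd (F q) \<in> tangent_space M (f q)"
    and loc: "\<And>q. q \<in> points Q \<Longrightarrow>
      \<exists>c\<in>charts_at M (f q). \<exists>W. q \<in> W \<and> (\<forall>j. smooth_fn Q W (\<lambda>q. snd (F q) c j))"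
  shows "smooth_map Q (tangent_bundle M) F"
proof (rule smooth_mapI[OF Q atlas_tangent_bundle])
  have F': "F q \<in> tangent_points M" if "q \<in> points Q" for q
    using F[OF that] smooth_map_points[OF f that] by (cases "F q") (auto simp: tangent_points_def)
  then show "\<And>q. q \<in> points Q \<Longrightarrow> F q \<in> points (tangent_bundle M)" by (simp add: points_tangent_bundle)
  fix q assume q: "q \<in> points Q"
  obtain c W where c: "c \<in> charts_at M (f q)" and W: "q \<in> W"
    and s: "\<And>j. smooth_fn Q W (\<lambda>q. snd (F q) c j)" using loc[OF q] by blast
  have c': "c \<in> charts M" "f q \<in> chart_dom c" using c by (auto simp: charts_at_iff)
  let ?V = "{q \<in> points Q. f q \<in> chart_dom c} \<inter> W"
  note Wo = smooth_fn_open[OF s]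
  have V: "openin (space_top Q) ?V"
    using smooth_map_vimage_open[OF Q M f chart_dom_open[OF M c'(1)]] Wo by auto
  have dom: "F q \<in> chart_dom (tangent_chart M c)" if "q \<in> ?V" for q
    using that F[of q] by (cases "F q") (auto simp: tangent_chart_dom)
  have "smooth_fn Q ?V (\<lambda>q. chart_map (tangent_chart M c) (F q) j)" for j
  proof (cases "j < mdim M")
    case True
    have "smooth_fn Q ?V (\<lambda>q. chart_map c (f q) j)"
      using smooth_map_coord[OF Q M f c'(1)] V by (rule smooth_fn_subset) auto
    then show ?thesis
      by (rule smooth_fn_cong[OF Q]) (use True F in \<open>auto simp: tangent_chart_map vec_append_def\<close>)
  next
    case False
    have "smooth_fn Q ?V (\<lambda>q. snd (F q) c (j - mdim M))"
      using s V by (rule smooth_fn_subset) auto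
    then show ?thesis using False by (simp add: tangent_chart_map vec_append_def)
  qed
  moreover have "tangent_chart M c \<in> charts_at (tangent_bundle M) (F q)"
    using tangent_chart_in_charts[OF c'(1)] dom[of q] q c' W by (simp add: charts_at_iff)
  moreover have "q \<in> ?V" using q c' W by simp
  ultimately show "\<exists>d\<in>charts_at (tangent_bundle M) (F q). \<exists>W. q \<in> W \<and> F ` W \<subseteq> chart_dom d \<and>
      (\<forall>j. smooth_fn Q W (\<lambda>q. chart_map d (F q) j))"
    using dom by (intro bexI[of _ "tangent_chart M c"] exI[of _ ?V]) (auto simp del: C_k_on.simps)
qed

text \<open>The converse of \<open>smooth_tangentI\<close>: in a tangent chart the first
  \<open>mdim M\<close> coordinates describe the base map and the following ones the fibre.\<close>

lemma smooth_tangentD: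
  assumes Q: "atlas_manifold Q" and F: "smooth_map Q (tangent_bundle M) F"
  shows "c \<in> charts M \<Longrightarrow> smooth_fn Q {q \<in> points Q. fst (F q) \<in> chart_dom c} (\<lambda>q. snd (F q) c j)"
    and "smooth_map Q M (\<lambda>q. fst (F q))"
    and "q \<in> points Q \<Longrightarrow> F q \<in> tangent_points M"
proof -
  note TM = atlas_tangent_bundle
  show F': "F q \<in> tangent_points M" if "q \<in> points Q" for q
    using smooth_map_points[OF F that] by (simp add: points_tangent_bundle)
  have dom: "{q \<in> points Q. F q \<in> chart_dom (tangent_chart M c)} = {q \<in> points Q. fst (F q) \<in> chart_dom c}"
    for c using F' by (fastforce simp: tangent_points_def tangent_chart_dom)
  note co = smooth_map_coord[OF Q TM F tangent_chart_in_charts, unfolded dom tangent_chart_map]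
  show "smooth_fn Q {q \<in> points Q. fst (F q) \<in> chart_dom c} (\<lambda>q. snd (F q) c j)"
    if "c \<in> charts M" for c
    using co[OF that, of "j + mdim M"] by (simp add: vec_append_def)
  show "smooth_map Q M (\<lambda>q. fst (F q))"
  proof (rule smooth_mapI[OF Q M])
    show "fst (F q) \<in> points M" if "q \<in> points Q" for q
      using F'[OF that] by (auto simp: tangent_points_def)
    fix q assume q: "q \<in> points Q"
    then have "fst (F q) \<in> points M" using F'[OF q] by (auto simp: tangent_points_def)
    then obtain c where c: "c \<in> charts M" "fst (F q) \<in> chart_dom c" using chart_aroundE[OF M] by blast
    let ?V = "{q \<in> points Q. fst (F q) \<in> chart_dom c}"
    have "smooth_fn Q ?V (\<lambda>q. chart_map c (fst (F q)) j)" for j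
    proof (cases "j < mdim M")
      case True
      then show ?thesis using co[OF c(1), of j] by (simp add: vec_append_def)
    next
      \<comment> \<open>The coordinates of a chart from \<open>mdim M\<close> on are constantly
        0.\<close>
      case False
      have "smooth_fn Q ?V (\<lambda>_. 0)"
        by (rule smooth_fn_const[OF Q smooth_fn_open[OF co[OF c(1)]]])
      then show ?thesis
        by (rule smooth_fn_cong[OF Q])
           (use False chart_map_in_Eucl[OF M c(1)] in \<open>auto simp: Eucl_iff\<close>)
    qed
    then show "\<exists>d\<in>charts_at M (fst (F q)). \<exists>W. q \<in> W \<and> (\<lambda>q. fst (F q)) ` W \<subseteq> chart_dom d \<and>
        (\<forall>j. smooth_fn Q W (\<lambda>q. chart_map d (fst (F q)) j))"
      using c q by (intro bexI[of _ c] exI[of _ ?V]) (auto simp: charts_at_iff)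
  qed
qed

end

text \<open>The fibre coordinates of the composite are sums of products of entries of the Jacobian
  of \<open>g\<close>, taken at the base point of \<open>H q\<close>, with fibre coordinates of
  \<open>H q\<close>. Including \<open>H\<close> in the statement lets
  \<open>smooth_tangentI\<close> and \<open>smooth_tangentD\<close> do the work.\<close>

lemma smooth_tangent_map_compose:
  assumes Q: "atlas_manifold Q" and M: "atlas_manifold M" and N: "atlas_manifold N"
    and H: "smooth_map Q (tangent_bundle M) H" and g: "smooth_map M N g"
  shows "smooth_map Q (tangent_bundle N) (\<lambda>q. tangent_map M N g (H q))"
proof (rule smooth_tangentI[OF N Q])
  note h = smooth_tangentD(2)[OF M Q H] and HP = smooth_tangentD(3)[OF M Q H]
  show "smooth_map Q N (g \<circ> (\<lambda>q. fst (H q)))"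
    by (rule smooth_map_compose[OF Q M N h g])
  have pv: "fst (H q) \<in> points M" "snd (H q) \<in> tangent_space M (fst (H q))" if "q \<in> points Q" for q
    using HP[OF that] by (auto simp: tangent_points_def)
  show "fst (tangent_map M N g (H q)) = (g \<circ> (\<lambda>q. fst (H q))) q \<and>
      snd (tangent_map M N g (H q)) \<in> tangent_space N ((g \<circ> (\<lambda>q. fst (H q))) q)"
    if "q \<in> points Q" for q
    using tangent_map_in[OF M N g pv[OF that]] by simp
  fix q assume q: "q \<in> points Q"
  obtain c where c: "c \<in> charts M" "fst (H q) \<in> chart_dom c" using chart_aroundE[OF M pv(1)[OF q]] .
  obtain d where d: "d \<in> charts N" "g (fst (H q)) \<in> chart_dom d"
    using chart_aroundE[OF N smooth_map_points[OF g pv(1)[OF q]]] .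
  let ?S = "{p \<in> chart_dom c. g p \<in> chart_dom d}"
  let ?W = "{q \<in> points Q. fst (H q) \<in> ?S}"
  let ?\<tau> = "chart_map d \<circ> g \<circ> chart_inv c"
  have S: "openin (space_top M) ?S"
  proof -
    have "?S = {p \<in> points M. g p \<in> chart_dom d} \<inter> chart_dom c"
      using chart_dom_subset[OF M c(1)] by auto
    then show ?thesis
      using smooth_map_vimage_open[OF M N g chart_dom_open[OF N d(1)]] chart_dom_open[OF M c(1)] by auto
  qed
  have W: "openin (space_top Q) ?W" by (rule smooth_map_vimage_open[OF Q M h S])
  note \<tau> = local_rep_C_inf[OF M N g c(1) d(1)]
  have s: "smooth_fn Q ?W (\<lambda>q. \<Sum>i<mdim M. partial i (\<lambda>y. ?\<tau> y j) (chart_map c (fst (H q))) * snd (H q) c i)" for j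
  proof (intro smooth_fn_sum[OF Q W] smooth_fn_mult[OF Q W])
    fix i assume i: "i \<in> {..<mdim M}"
    show "smooth_fn Q ?W (\<lambda>q. partial i (\<lambda>y. ?\<tau> y j) (chart_map c (fst (H q))))"
    proof (rule smooth_fn_C_k_compose[OF Q W \<tau>(2), where h = "\<lambda>q. chart_map c (fst (H q))"])
      show "C_k_on (mdim M) k (chart_map c ` ?S) (partial i (\<lambda>y. ?\<tau> y j))" for k
        using C_k_on_partial[OF \<tau>(1)] i by simp
      show "smooth_fn Q ?W (\<lambda>q. chart_map c (fst (H q)) j)" for j
        using smooth_map_coord[OF Q M h c(1)] W by (rule smooth_fn_subset) auto
    qed auto
    show "smooth_fn Q ?W (\<lambda>q. snd (H q) c i)"
      using smooth_tangentD(1)[OF M Q H c(1)] W by (rule smooth_fn_subset) auto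
  qed
  have "smooth_fn Q ?W (\<lambda>q. snd (tangent_map M N g (H q)) d j)" for j
  proof (rule smooth_fn_cong[OF Q s])
    fix q assume q: "q \<in> ?W"
    then have "snd (tangent_map M N g (fst (H q), snd (H q))) d = local_deriv M c d g (fst (H q)) (snd (H q) c)"
      using c d pv by (intro tangent_map_chart[OF M N g]) (auto simp: charts_at_iff)
    then show "(\<Sum>i<mdim M. partial i (\<lambda>y. ?\<tau> y j) (chart_map c (fst (H q))) * snd (H q) c i) =
        snd (tangent_map M N g (H q)) d j"
      by (simp add: local_deriv_def jacobian_def)
  qed
  then show "\<exists>c\<in>charts_at N ((g \<circ> (\<lambda>q. fst (H q))) q). \<exists>W. q \<in> W \<and>
      (\<forall>j. smooth_fn Q W (\<lambda>q. snd (tangent_map M N g (H q)) c j))"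
    using c d q by (intro bexI[of _ d] exI[of _ ?W]) (auto simp: charts_at_iff)
qed

section \<open>Products of manifolds\<close>

lemma Tup_in_tup_times [simp]: "Tup x y \<in> tup_times A B \<longleftrightarrow> x \<in> A \<and> y \<in> B"
  by (auto simp: tup_times_def)

lemma tup_timesE:
  assumes "z \<in> tup_times A B"
  obtains x y where "z = Tup x y" "x \<in> A" "y \<in> B"
  using assms by (auto simp: tup_times_def)

lemma tup_times_iff: "z \<in> tup_times A B \<longleftrightarrow> z = Tup (tfst z) (tsnd z) \<and> tfst z \<in> A \<and> tsnd z \<in> B"
  by (auto simp: tup_times_def)

lemma tup_times_mono: "A \<subseteq> A' \<Longrightarrow> B \<subseteq> B' \<Longrightarrow> tup_times A B \<subseteq> tup_times A' B'"
  by (auto simp: tup_times_def)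

lemma tup_map_Tup [simp]: "tup_map f g (Tup x y) = Tup (f x) (g y)"
  by (simp add: tup_map_def)

lemma tup_assoc_Tup [simp]: "tup_assoc (Tup (Tup x y) z) = Tup x (Tup y z)"
  by (simp add: tup_assoc_def)

lemma openin_tup_prod:
  "openin (tup_prod_topology X Y) W \<longleftrightarrow> W \<subseteq> tup_times (topspace X) (topspace Y) \<and>
     (\<forall>z\<in>W. \<exists>U V. openin X U \<and> openin Y V \<and> z \<in> tup_times U V \<and> tup_times U V \<subseteq> W)"
  (is "_ \<longleftrightarrow> ?R")
proof
  assume "openin (tup_prod_topology X Y) W"
  then obtain O' where O': "openin (prod_topology X Y) O'"
    "W = (\<lambda>z. (tfst z, tsnd z)) -` O' \<inter> tup_times (topspace X) (topspace Y)"
    by (auto simp: tup_prod_topology_def openin_pullback_topology)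
  show ?R
  proof (intro conjI ballI)
    show "W \<subseteq> tup_times (topspace X) (topspace Y)" using O' by blast
    fix z assume z: "z \<in> W"
    then have "(tfst z, tsnd z) \<in> O'" using O' by blast
    then obtain U V where UV: "openin X U" "openin Y V" "tfst z \<in> U" "tsnd z \<in> V" "U \<times> V \<subseteq> O'"
      using O'(1) unfolding openin_prod_topology_alt by meson
    have "tup_times U V \<subseteq> W"
      using UV O'(2) openin_subset[OF UV(1)] openin_subset[OF UV(2)] by (auto simp: tup_times_def)
    then show "\<exists>U V. openin X U \<and> openin Y V \<and> z \<in> tup_times U V \<and> tup_times U V \<subseteq> W"
      using UV z O'(2) by (intro exI[of _ U] exI[of _ V]) (auto simp: tup_times_iff)
  qed
next
  assume R: ?R
  let ?O = "{(x, y). Tup x y \<in> W}"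
  have "openin (prod_topology X Y) ?O"
    unfolding openin_prod_topology_alt
  proof (intro allI impI)
    fix x y assume "(x, y) \<in> ?O"
    then have "Tup x y \<in> W" by simp
    then obtain U V where "openin X U" "openin Y V" "Tup x y \<in> tup_times U V" "tup_times U V \<subseteq> W"
      using R by meson
    then show "\<exists>U V. openin X U \<and> openin Y V \<and> x \<in> U \<and> y \<in> V \<and> U \<times> V \<subseteq> ?O"
      by (intro exI[of _ U] exI[of _ V]) auto
  qed
  moreover have "W = (\<lambda>z. (tfst z, tsnd z)) -` ?O \<inter> tup_times (topspace X) (topspace Y)"
    using R by (auto simp: tup_times_iff)
  ultimately show "openin (tup_prod_topology X Y) W"
    unfolding tup_prod_topology_def openin_pullback_topology by blast
qed

lemma openin_tup_times:
  "openin X U \<Longrightarrow> openin Y V \<Longrightarrow> openin (tup_prod_topology X Y) (tup_times U V)"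
  unfolding openin_tup_prod by (auto simp: tup_times_def dest: openin_subset)

lemma topspace_tup_prod [simp]:
  "topspace (tup_prod_topology X Y) = tup_times (topspace X) (topspace Y)"
proof
  show "topspace (tup_prod_topology X Y) \<subseteq> tup_times (topspace X) (topspace Y)"
    using openin_topspace[of "tup_prod_topology X Y"] unfolding openin_tup_prod by blast
  show "tup_times (topspace X) (topspace Y) \<subseteq> topspace (tup_prod_topology X Y)"
    by (rule openin_subset[OF openin_tup_times]) auto
qed

lemma Hausdorff_tup_prod:
  assumes X: "Hausdorff_space X" and Y: "Hausdorff_space Y"
  shows "Hausdorff_space (tup_prod_topology X Y)"
  unfolding Hausdorff_space_def
proof (intro allI impI, elim conjE)
  fix z w assume zw: "z \<in> topspace (tup_prod_topology X Y)" "w \<in> topspace (tup_prod_topology X Y)" "z \<noteq> w"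
  obtain x y x' y' where *: "z = Tup x y" "w = Tup x' y'"
    "x \<in> topspace X" "y \<in> topspace Y" "x' \<in> topspace X" "y' \<in> topspace Y"
    using zw by (auto elim!: tup_timesE)
  consider "x \<noteq> x'" | "y \<noteq> y'" using zw * by auto
  then show "\<exists>U V. openin (tup_prod_topology X Y) U \<and> openin (tup_prod_topology X Y) V \<and>
      z \<in> U \<and> w \<in> V \<and> disjnt U V"
  proof cases
    case 1
    then obtain U V where "openin X U" "openin X V" "x \<in> U" "x' \<in> V" "disjnt U V"
      using X * unfolding Hausdorff_space_def by metis
    then show ?thesis using *
      by (intro exI[of _ "tup_times U (topspace Y)"] exI[of _ "tup_times V (topspace Y)"])
         (auto simp: disjnt_iff openin_tup_times tup_times_iff)
  next
    case 2
    then obtain U V where "openin Y U" "openin Y V" "y \<in> U" "y' \<in> V" "disjnt U V"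
      using Y * unfolding Hausdorff_space_def by metis
    then show ?thesis using *
      by (intro exI[of _ "tup_times (topspace X) U"] exI[of _ "tup_times (topspace X) V"])
         (auto simp: disjnt_iff openin_tup_times tup_times_iff)
  qed
qed

lemma second_countable_tup_prod:
  assumes X: "second_countable X" and Y: "second_countable Y"
  shows "second_countable (tup_prod_topology X Y)"
proof -
  obtain A where A: "countable A" "\<And>V. V \<in> A \<Longrightarrow> openin X V"
    "\<And>U x. openin X U \<Longrightarrow> x \<in> U \<Longrightarrow> \<exists>V\<in>A. x \<in> V \<and> V \<subseteq> U"
    using X unfolding second_countable_def by metis
  obtain B where B: "countable B" "\<And>V. V \<in> B \<Longrightarrow> openin Y V"
    "\<And>U x. openin Y U \<Longrightarrow> x \<in> U \<Longrightarrow> \<exists>V\<in>B. x \<in> V \<and> V \<subseteq> U"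
    using Y unfolding second_countable_def by metis
  let ?C = "(\<lambda>(U, V). tup_times U V) ` (A \<times> B)"
  show ?thesis unfolding second_countable_def
  proof (intro exI[of _ ?C] conjI ballI allI impI)
    show "countable ?C" using A(1) B(1) by blast
    show "openin (tup_prod_topology X Y) W" if "W \<in> ?C" for W
      using that A(2) B(2) by (auto intro: openin_tup_times)
    fix W z assume Wz: "openin (tup_prod_topology X Y) W \<and> z \<in> W"
    then obtain U V where UV: "openin X U" "openin Y V" "z \<in> tup_times U V" "tup_times U V \<subseteq> W"
      unfolding openin_tup_prod by meson
    obtain U' V' where *: "U' \<in> A" "tfst z \<in> U'" "U' \<subseteq> U" "V' \<in> B" "tsnd z \<in> V'" "V' \<subseteq> V"
      using A(3)[OF UV(1), of "tfst z"] B(3)[OF UV(2), of "tsnd z"] UV(3) by (auto simp: tup_times_iff)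
    have "tup_times U' V' \<subseteq> W" using tup_times_mono[OF *(3,6)] UV(4) by (rule order_trans)
    moreover have "z \<in> tup_times U' V'" using * UV(3) by (simp add: tup_times_iff)
    ultimately show "\<exists>V\<in>?C. z \<in> V \<and> V \<subseteq> W" using * by blast
  qed
qed

lemma openin_Eucl_ball: "openin (Euclidean_space m) {u \<in> Eucl m. \<forall>i<m. \<bar>u i - a i\<bar> < e}"
proof -
  let ?T = "{y :: nat \<Rightarrow> real. \<forall>i\<in>{..<m}. y (id i) \<in> {a i - e<..<a i + e}}"
  have "open ?T" by (rule product_topology_basis') auto
  moreover have "{u \<in> Eucl m. \<forall>i<m. \<bar>u i - a i\<bar> < e} = ?T \<inter> Eucl m"
    by (auto simp: abs_diff_less_iff)
  ultimately show ?thesis unfolding openin_Euclidean_space by blast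
qed

section \<open>Charts of a product\<close>

lemma prod_chart_dom [simp]: "chart_dom (prod_chart m c d) = tup_times (chart_dom c) (chart_dom d)"
  by (simp add: prod_chart_def)

lemma prod_chart_map:
  "chart_map (prod_chart m c d) z = vec_append m (chart_map c (tfst z)) (chart_map d (tsnd z))"
  by (simp add: prod_chart_def)

context
  fixes X Y :: "'a tup topology" and m n c d
  assumes c: "is_chart X m c" and d: "is_chart Y n d"
begin

lemma prod_chart_image:
  assumes U: "U \<subseteq> chart_dom c" and V: "V \<subseteq> chart_dom d"
  shows "chart_map (prod_chart m c d) ` tup_times U V =
    {z \<in> Eucl (m + n). vtake m z \<in> chart_map c ` U \<and> vdrop m z \<in> chart_map d ` V}"
proof (intro equalityI subsetI)
  fix z assume "z \<in> chart_map (prod_chart m c d) ` tup_times U V"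
  then obtain x y where "x \<in> U" "y \<in> V" "z = vec_append m (chart_map c x) (chart_map d y)"
    by (auto simp: prod_chart_map tup_times_def)
  moreover have "chart_map c x \<in> Eucl m" "chart_map d y \<in> Eucl n" if "x \<in> U" "y \<in> V" for x y
    using is_chart_in_Eucl[OF c] is_chart_in_Eucl[OF d] that U V by auto
  ultimately show "z \<in> {z \<in> Eucl (m + n). vtake m z \<in> chart_map c ` U \<and> vdrop m z \<in> chart_map d ` V}"
    by (simp add: vec_append_in_Eucl)
next
  fix z assume "z \<in> {z \<in> Eucl (m + n). vtake m z \<in> chart_map c ` U \<and> vdrop m z \<in> chart_map d ` V}"
  then obtain x y where xy: "x \<in> U" "y \<in> V" "vtake m z = chart_map c x" "vdrop m z = chart_map d y"
    by blast
  have "z = chart_map (prod_chart m c d) (Tup x y)"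
    using append_take_drop[of m z] by (simp add: prod_chart_map xy)
  then show "z \<in> chart_map (prod_chart m c d) ` tup_times U V" using xy by auto
qed

lemma prod_chart_inj: "inj_on (chart_map (prod_chart m c d)) (chart_dom (prod_chart m c d))"
proof (rule inj_onI)
  fix z w assume zw: "z \<in> chart_dom (prod_chart m c d)" "w \<in> chart_dom (prod_chart m c d)"
    and eq: "chart_map (prod_chart m c d) z = chart_map (prod_chart m c d) w"
  obtain x y x' y' where *: "z = Tup x y" "w = Tup x' y'"
    "x \<in> chart_dom c" "y \<in> chart_dom d" "x' \<in> chart_dom c" "y' \<in> chart_dom d"
    using zw by (auto elim!: tup_timesE)
  then have "chart_map c x = chart_map c x'" "chart_map d y = chart_map d y'"
    using eq is_chart_in_Eucl[OF c] by (simp_all add: prod_chart_map vec_append_inj)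
  then show "z = w" using * is_chart_inj[OF c] is_chart_inj[OF d] by (simp add: inj_on_eq_iff)
qed

text \<open>An open set is a union of rectangles, and rectangles go to open rectangles. Conversely,
  a coordinate box around an image point splits into a box in the first \<open>m\<close> and one in
  the last \<open>n\<close> coordinates, and the preimages of these under \<open>c\<close> and
  \<open>d\<close> form an open rectangle.\<close>

lemma prod_chart_is_chart: "is_chart (tup_prod_topology X Y) (m + n) (prod_chart m c d)"
  unfolding is_chart_iff
proof (intro conjI allI impI)
  let ?f = "chart_map (prod_chart m c d)"
  show "openin (tup_prod_topology X Y) (chart_dom (prod_chart m c d))"
    using is_chart_open_dom[OF c] is_chart_open_dom[OF d] by (simp add: openin_tup_times)
  show "inj_on ?f (chart_dom (prod_chart m c d))" by (rule prod_chart_inj)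
  show "?f ` chart_dom (prod_chart m c d) \<subseteq> Eucl (m + n)"
    using prod_chart_image[of "chart_dom c" "chart_dom d"] by auto
  fix W assume W: "W \<subseteq> chart_dom (prod_chart m c d)"
  show "openin (tup_prod_topology X Y) W \<longleftrightarrow> openin (Euclidean_space (m + n)) (?f ` W)"
  proof
    assume o: "openin (tup_prod_topology X Y) W"
    show "openin (Euclidean_space (m + n)) (?f ` W)"
    proof (subst openin_subopen, clarify)
      fix z assume z: "z \<in> W"
      then obtain U V where UV: "openin X U" "openin Y V" "z \<in> tup_times U V" "tup_times U V \<subseteq> W"
        using o unfolding openin_tup_prod by meson
      have zd: "z \<in> tup_times (chart_dom c) (chart_dom d)" using z W by auto
      let ?U = "U \<inter> chart_dom c" and ?V = "V \<inter> chart_dom d"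
      have "openin (Euclidean_space (m + n)) (?f ` tup_times ?U ?V)"
        unfolding prod_chart_image[OF Int_lower2 Int_lower2]
      proof (rule openin_Eucl_append)
        show "openin (Euclidean_space m) (chart_map c ` ?U)"
          using UV(1) is_chart_open_dom[OF c] by (intro is_chart_image_open[OF c]) auto
        show "openin (Euclidean_space n) (chart_map d ` ?V)"
          using UV(2) is_chart_open_dom[OF d] by (intro is_chart_image_open[OF d]) auto
      qed
      moreover have "z \<in> tup_times ?U ?V" using UV(3) zd by (auto simp: tup_times_iff)
      moreover have "tup_times ?U ?V \<subseteq> W" using UV(4) by (auto simp: tup_times_def)
      ultimately show "\<exists>T. openin (Euclidean_space (m + n)) T \<and> ?f z \<in> T \<and> T \<subseteq> ?f ` W"
        by blast
    qed
  next
    assume o: "openin (Euclidean_space (m + n)) (?f ` W)"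
    show "openin (tup_prod_topology X Y) W"
      unfolding openin_tup_prod
    proof (intro conjI ballI)
      show "W \<subseteq> tup_times (topspace X) (topspace Y)"
        using W[unfolded prod_chart_dom] tup_times_mono[OF openin_subset[OF is_chart_open_dom[OF c]]
            openin_subset[OF is_chart_open_dom[OF d]]] by (rule order_trans)
      fix z assume z: "z \<in> W"
      then obtain x y where xy: "z = Tup x y" "x \<in> chart_dom c" "y \<in> chart_dom d"
        using W[unfolded prod_chart_dom] by (blast elim: tup_timesE)
      obtain e where e: "e > 0" "\<And>u. u \<in> Eucl (m + n) \<Longrightarrow> (\<forall>i<m+n. \<bar>u i - ?f z i\<bar> < e) \<Longrightarrow> u \<in> ?f ` W"
        using o z unfolding openin_Euclidean_space_box by (meson imageI)
      let ?U = "{p \<in> chart_dom c. \<forall>i<m. \<bar>chart_map c p i - chart_map c x i\<bar> < e}"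
      let ?V = "{q \<in> chart_dom d. \<forall>i<n. \<bar>chart_map d q i - chart_map d y i\<bar> < e}"
      have "openin X ?U"
      proof -
        have "chart_map c ` ?U = chart_map c ` chart_dom c \<inter>
            {u \<in> Eucl m. \<forall>i<m. \<bar>u i - chart_map c x i\<bar> < e}"
          using is_chart_in_Eucl[OF c] by auto
        then have "openin (Euclidean_space m) (chart_map c ` ?U)"
          using is_chart_image_open[OF c is_chart_open_dom[OF c]] openin_Eucl_ball by auto
        then show ?thesis using c unfolding is_chart_iff by (metis (no_types, lifting) mem_Collect_eq subsetI)
      qed
      moreover have "openin Y ?V"
      proof -
        have "chart_map d ` ?V = chart_map d ` chart_dom d \<inter>
            {u \<in> Eucl n. \<forall>i<n. \<bar>u i - chart_map d y i\<bar> < e}"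
          using is_chart_in_Eucl[OF d] by auto
        then have "openin (Euclidean_space n) (chart_map d ` ?V)"
          using is_chart_image_open[OF d is_chart_open_dom[OF d]] openin_Eucl_ball by auto
        then show ?thesis using d unfolding is_chart_iff by (metis (no_types, lifting) mem_Collect_eq subsetI)
      qed
      moreover have "z \<in> tup_times ?U ?V" using xy e(1) by simp
      moreover have "tup_times ?U ?V \<subseteq> W"
      proof
        fix w assume "w \<in> tup_times ?U ?V"
        then obtain p q where pq: "w = Tup p q" "p \<in> ?U" "q \<in> ?V" by (rule tup_timesE)
        have "?f w \<in> ?f ` W"
        proof (rule e(2))
          show "?f w \<in> Eucl (m + n)"
            using pq is_chart_in_Eucl[OF d] by (simp add: prod_chart_map vec_append_in_Eucl)
          show "\<forall>i<m + n. \<bar>?f w i - ?f z i\<bar> < e"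
            using pq xy by (auto simp: prod_chart_map vec_append_def)
        qed
        moreover have "w \<in> chart_dom (prod_chart m c d)" using pq by simp
        ultimately show "w \<in> W" using prod_chart_inj W by (meson inj_on_image_mem_iff)
      qed
      ultimately show "\<exists>U V. openin X U \<and> openin Y V \<and> z \<in> tup_times U V \<and> tup_times U V \<subseteq> W"
        by blast
    qed
  qed
qed

end

text \<open>The transition acts separately on the two halves of the coordinate vector, so it is
  assembled from the two given transitions after \<open>vtake\<close> and
  \<open>vdrop\<close>.\<close>

lemma prod_chart_transition:
  assumes c: "is_chart X m c" "is_chart X m c'" and d: "is_chart Y n d" "is_chart Y n d'"
    and cc: "compatible m c c'" and dd: "compatible n d d'"
  shows "C_inf_on (m + n)
    (chart_map (prod_chart m c d) ` (chart_dom (prod_chart m c d) \<inter> chart_dom (prod_chart m c' d')))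
    (chart_map (prod_chart m c' d') \<circ> chart_inv (prod_chart m c d))"
proof -
  let ?U = "chart_dom c \<inter> chart_dom c'" and ?V = "chart_dom d \<inter> chart_dom d'"
  let ?C = "prod_chart m c d" and ?C' = "prod_chart m c' d'"
  have dom: "chart_dom ?C \<inter> chart_dom ?C' = tup_times ?U ?V" by (auto simp: tup_times_iff)
  let ?I = "chart_map ?C ` tup_times ?U ?V"
  have I: "?I = {z \<in> Eucl (m + n). vtake m z \<in> chart_map c ` ?U \<and> vdrop m z \<in> chart_map d ` ?V}"
    by (rule prod_chart_image[OF c(1) d(1)]) auto
  have oU: "openin (Euclidean_space m) (chart_map c ` ?U)"
    using is_chart_open_dom[OF c(1)] is_chart_open_dom[OF c(2)] by (intro is_chart_image_open[OF c(1)]) auto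
  have oV: "openin (Euclidean_space n) (chart_map d ` ?V)"
    using is_chart_open_dom[OF d(1)] is_chart_open_dom[OF d(2)] by (intro is_chart_image_open[OF d(1)]) auto
  have oI: "openin (Euclidean_space (m + n)) ?I"
    unfolding I by (rule openin_Eucl_append[OF oU oV])
  have "C_inf_on (m + n) ?I (\<lambda>z. vec_append m (((chart_map c' \<circ> chart_inv c) \<circ> vtake m) z)
      (((chart_map d' \<circ> chart_inv d) \<circ> vdrop m) z))"
  proof (rule C_inf_on_append)
    show "C_inf_on (m + n) ?I ((chart_map c' \<circ> chart_inv c) \<circ> vtake m)"
      using I by (intro C_inf_on_compose[OF oI oU C_inf_on_vtake[OF oI] _ compatible_transition[OF cc]]) auto
    show "C_inf_on (m + n) ?I ((chart_map d' \<circ> chart_inv d) \<circ> vdrop m)"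
      using I by (intro C_inf_on_compose[OF oI oV C_inf_on_vdrop[OF oI] _ compatible_transition[OF dd]]) auto
  qed
  moreover have "vec_append m (((chart_map c' \<circ> chart_inv c) \<circ> vtake m) z)
      (((chart_map d' \<circ> chart_inv d) \<circ> vdrop m) z) = (chart_map ?C' \<circ> chart_inv ?C) z"
    if z: "z \<in> ?I" for z
  proof -
    obtain x y where xy: "x \<in> ?U" "y \<in> ?V" "z = chart_map ?C (Tup x y)"
      using z by (auto elim!: imageE tup_timesE)
    have "chart_inv ?C z = Tup x y"
      using xy is_chart_inv[OF prod_chart_is_chart[OF c(1) d(1)], of "Tup x y"] by simp
    moreover have "vtake m z = chart_map c x" "vdrop m z = chart_map d y"
      using xy is_chart_in_Eucl[OF c(1)] by (simp_all add: prod_chart_map)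
    ultimately show ?thesis
      using xy is_chart_inv[OF c(1)] is_chart_inv[OF d(1)] by (simp add: prod_chart_map)
  qed
  ultimately show ?thesis unfolding dom
    by (subst C_inf_on_cong[OF oI, symmetric]) auto
qed

section \<open>The product manifold, its projections and its tangent vectors\<close>

lemma points_prod [simp]: "points (prod_manifold M N) = tup_times (points M) (points N)"
  by (simp add: prod_manifold_def manifold_of_atlas_def)

lemma mdim_prod [simp]: "mdim (prod_manifold M N) = mdim M + mdim N"
  by (simp add: prod_manifold_def manifold_of_atlas_def)

lemma space_top_prod: "space_top (prod_manifold M N) = tup_prod_topology (space_top M) (space_top N)"
  by (simp add: prod_manifold_def manifold_of_atlas_def)

context
  fixes M N :: "'a tup manifold"
  assumes M: "atlas_manifold M" and N: "atlas_manifold N"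
begin

lemma atlas_prod: "atlas_manifold (prod_manifold M N)"
  and prod_chart_in_charts:
    "c \<in> charts M \<Longrightarrow> d \<in> charts N \<Longrightarrow> prod_chart (mdim M) c d \<in> charts (prod_manifold M N)"
proof -
  let ?A = "{prod_chart (mdim M) c d | c d. c \<in> charts M \<and> d \<in> charts N}"
  have isc: "is_chart (tup_prod_topology (space_top M) (space_top N)) (mdim M + mdim N) a"
    if "a \<in> ?A" for a
    using that prod_chart_is_chart[OF chart_is_chart[OF M] chart_is_chart[OF N]] by blast
  have cover: "(\<Union>a\<in>?A. chart_dom a) = topspace (tup_prod_topology (space_top M) (space_top N))"
  proof (intro equalityI subsetI)
    fix z assume "z \<in> (\<Union>a\<in>?A. chart_dom a)"
    then obtain c d where "c \<in> charts M" "d \<in> charts N" "z \<in> tup_times (chart_dom c) (chart_dom d)"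
      by (smt (verit) UN_E mem_Collect_eq prod_chart_dom)
    then show "z \<in> topspace (tup_prod_topology (space_top M) (space_top N))"
      using chart_dom_subset[OF M] chart_dom_subset[OF N] by (auto simp: tup_times_iff subset_iff)
  next
    fix z assume "z \<in> topspace (tup_prod_topology (space_top M) (space_top N))"
    then obtain x y where xy: "z = Tup x y" "x \<in> points M" "y \<in> points N"
      by (auto elim: tup_timesE)
    obtain c where c: "c \<in> charts M" "x \<in> chart_dom c" using chart_aroundE[OF M xy(2)] .
    obtain d where d: "d \<in> charts N" "y \<in> chart_dom d" using chart_aroundE[OF N xy(3)] .
    have "z \<in> chart_dom (prod_chart (mdim M) c d)" using xy c d by simp
    then show "z \<in> (\<Union>a\<in>?A. chart_dom a)" using c d by blast
  qed
  have tr: "C_inf_on (mdim M + mdim N) (chart_map a ` (chart_dom a \<inter> chart_dom b)) (chart_map b \<circ> chart_inv a)"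
    if ab: "a \<in> ?A" "b \<in> ?A" for a b
  proof -
    obtain c d where "c \<in> charts M" "d \<in> charts N" "a = prod_chart (mdim M) c d" using ab by blast
    moreover obtain c' d' where "c' \<in> charts M" "d' \<in> charts N" "b = prod_chart (mdim M) c' d'"
      using ab by blast
    ultimately show ?thesis
      using prod_chart_transition[OF chart_is_chart[OF M] chart_is_chart[OF M] chart_is_chart[OF N]
          chart_is_chart[OF N] charts_compatible[OF M] charts_compatible[OF N]] by blast
  qed
  note A = atlas_manifold_of_atlas[OF isc cover tr, folded prod_manifold_def]
  show "atlas_manifold (prod_manifold M N)" by (rule A(1))
  show "c \<in> charts M \<Longrightarrow> d \<in> charts N \<Longrightarrow> prod_chart (mdim M) c d \<in> charts (prod_manifold M N)"
    using A(2) by blast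
qed

lemma prod_chart_at:
  "c \<in> charts_at M (tfst z) \<Longrightarrow> d \<in> charts_at N (tsnd z) \<Longrightarrow> z \<in> points (prod_manifold M N) \<Longrightarrow>
    prod_chart (mdim M) c d \<in> charts_at (prod_manifold M N) z"
  using prod_chart_in_charts[of c d] by (auto simp: charts_at_iff tup_times_iff)

lemma smooth_tfst: "smooth_map (prod_manifold M N) M tfst"
proof (rule smooth_mapI[OF atlas_prod M])
  fix z assume z: "z \<in> points (prod_manifold M N)"
  then show pz: "tfst z \<in> points M" by (auto simp: tup_times_iff)
  obtain c where c: "c \<in> charts M" "tfst z \<in> chart_dom c" using chart_aroundE[OF M pz] .
  obtain d where d: "d \<in> charts N" "tsnd z \<in> chart_dom d"
    using chart_aroundE[OF N, of "tsnd z"] z by (auto simp: tup_times_iff)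
  let ?C = "prod_chart (mdim M) c d"
  note C = prod_chart_in_charts[OF c(1) d(1)]
  have "smooth_fn (prod_manifold M N) (chart_dom ?C) (\<lambda>z. chart_map c (tfst z) j)" for j
  proof (cases "j < mdim M")
    case True
    then show ?thesis using smooth_fn_chart[OF atlas_prod C, of j]
      by (simp add: prod_chart_map vec_append_def)
  next
    case False
    show ?thesis
      using smooth_fn_const[OF atlas_prod chart_dom_open[OF atlas_prod C], of 0]
      by (rule smooth_fn_cong[OF atlas_prod])
         (use False chart_map_in_Eucl[OF M c(1)] in \<open>auto simp: Eucl_iff tup_times_iff\<close>)
  qed
  then show "\<exists>d\<in>charts_at M (tfst z). \<exists>W. z \<in> W \<and> tfst ` W \<subseteq> chart_dom d \<and>
      (\<forall>j. smooth_fn (prod_manifold M N) W (\<lambda>q. chart_map d (tfst q) j))"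
    using c d z by (intro bexI[of _ c] exI[of _ "chart_dom ?C"]) (auto simp: charts_at_iff tup_times_iff)
qed

lemma smooth_tsnd: "smooth_map (prod_manifold M N) N tsnd"
proof (rule smooth_mapI[OF atlas_prod N])
  fix z assume z: "z \<in> points (prod_manifold M N)"
  then show pz: "tsnd z \<in> points N" by (auto simp: tup_times_iff)
  obtain c where c: "c \<in> charts M" "tfst z \<in> chart_dom c"
    using chart_aroundE[OF M, of "tfst z"] z by (auto simp: tup_times_iff)
  obtain d where d: "d \<in> charts N" "tsnd z \<in> chart_dom d" using chart_aroundE[OF N pz] .
  let ?C = "prod_chart (mdim M) c d"
  note C = prod_chart_in_charts[OF c(1) d(1)]
  have "smooth_fn (prod_manifold M N) (chart_dom ?C) (\<lambda>z. chart_map d (tsnd z) j)" for j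
    using smooth_fn_chart[OF atlas_prod C, of "j + mdim M"]
    by (simp add: prod_chart_map vec_append_def)
  then show "\<exists>d\<in>charts_at N (tsnd z). \<exists>W. z \<in> W \<and> tsnd ` W \<subseteq> chart_dom d \<and>
      (\<forall>j. smooth_fn (prod_manifold M N) W (\<lambda>q. chart_map d (tsnd q) j))"
    using c d z by (intro bexI[of _ d] exI[of _ "chart_dom ?C"]) (auto simp: charts_at_iff tup_times_iff)
qed

text \<open>In a product chart the coordinates of the pair are those of \<open>f\<close> followed by
  those of \<open>g\<close>. With the two projections this is the universal property of the product,
  from which the smoothness of all rearrangements of factors is obtained.\<close>

lemma smooth_Tup:
  assumes Q: "atlas_manifold Q" and f: "smooth_map Q M f" and g: "smooth_map Q N g"
  shows "smooth_map Q (prod_manifold M N) (\<lambda>q. Tup (f q) (g q))"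
proof (rule smooth_mapI[OF Q atlas_prod])
  fix q assume q: "q \<in> points Q"
  note fq = smooth_map_points[OF f q] and gq = smooth_map_points[OF g q]
  show "Tup (f q) (g q) \<in> points (prod_manifold M N)" using fq gq by simp
  obtain c where c: "c \<in> charts M" "f q \<in> chart_dom c" using chart_aroundE[OF M fq] .
  obtain d where d: "d \<in> charts N" "g q \<in> chart_dom d" using chart_aroundE[OF N gq] .
  let ?C = "prod_chart (mdim M) c d"
  note C = prod_chart_in_charts[OF c(1) d(1)]
  let ?W = "{q \<in> points Q. f q \<in> chart_dom c} \<inter> {q \<in> points Q. g q \<in> chart_dom d}"
  have W: "openin (space_top Q) ?W"
    using smooth_map_vimage_open[OF Q M f chart_dom_open[OF M c(1)]]
      smooth_map_vimage_open[OF Q N g chart_dom_open[OF N d(1)]] by (rule openin_Int)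
  have "smooth_fn Q ?W (\<lambda>q. chart_map ?C (Tup (f q) (g q)) j)" for j
    using smooth_fn_subset[OF smooth_map_coord[OF Q M f c(1), of j] W]
      smooth_fn_subset[OF smooth_map_coord[OF Q N g d(1), of "j - mdim M"] W]
    by (cases "j < mdim M") (auto simp: prod_chart_map vec_append_def)
  then show "\<exists>d\<in>charts_at (prod_manifold M N) (Tup (f q) (g q)). \<exists>W. q \<in> W \<and>
      (\<lambda>q. Tup (f q) (g q)) ` W \<subseteq> chart_dom d \<and>
      (\<forall>j. smooth_fn Q W (\<lambda>q. chart_map d (Tup (f q) (g q)) j))"
    using q c d C by (intro bexI[of _ ?C] exI[of _ ?W]) (auto simp: charts_at_iff)
qed

text \<open>Read in a product chart the projections are \<open>vtake\<close> and
  \<open>vdrop\<close>, which are linear and hence their own Jacobians.\<close>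

lemma prod_local_deriv:
  assumes c: "c \<in> charts_at M (tfst z)" and d: "d \<in> charts_at N (tsnd z)"
    and z: "z \<in> points (prod_manifold M N)" and w: "w \<in> Eucl (mdim M + mdim N)"
  shows "local_deriv (prod_manifold M N) (prod_chart (mdim M) c d) c tfst z w = vtake (mdim M) w"
    and "local_deriv (prod_manifold M N) (prod_chart (mdim M) c d) d tsnd z w = vdrop (mdim M) w"
proof -
  let ?C = "prod_chart (mdim M) c d"
  have c': "c \<in> charts M" "tfst z \<in> chart_dom c" and d': "d \<in> charts N" "tsnd z \<in> chart_dom d"
    using c d by (auto simp: charts_at_iff)
  note C = prod_chart_in_charts[OF c'(1) d'(1)]
  have zC: "z \<in> chart_dom ?C" using c' d' z by (auto simp: tup_times_iff)
  have o: "openin (Euclidean_space (mdim M + mdim N)) (chart_map ?C ` chart_dom ?C)"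
    using chart_image_open[OF atlas_prod C chart_dom_open[OF atlas_prod C]] by simp
  have inv: "chart_inv ?C (chart_map ?C y) = y" if "y \<in> chart_dom ?C" for y
    using chart_inv_map[OF atlas_prod C that] .
  have "local_deriv (prod_manifold M N) ?C c tfst z w =
      jacobian (mdim M + mdim N) (vtake (mdim M)) (chart_map ?C z) w"
    unfolding local_deriv_def mdim_prod
  proof (rule jacobian_cong[OF o])
    fix y assume "y \<in> chart_map ?C ` chart_dom ?C"
    then obtain p where "p \<in> chart_dom ?C" "y = chart_map ?C p" by blast
    then show "(chart_map c \<circ> tfst \<circ> chart_inv ?C) y = vtake (mdim M) y"
      using inv chart_map_in_Eucl[OF M c'(1)] by (auto simp: prod_chart_map tup_times_iff simp del: prod_chart_dom)
         (simp add: tup_times_iff chart_map_in_Eucl[OF M c'(1)])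
  qed (use zC in blast)
  then show "local_deriv (prod_manifold M N) ?C c tfst z w = vtake (mdim M) w"
    by (simp add: jacobian_vtake)
  have "local_deriv (prod_manifold M N) ?C d tsnd z w =
      jacobian (mdim M + mdim N) (vdrop (mdim M)) (chart_map ?C z) w"
    unfolding local_deriv_def mdim_prod
  proof (rule jacobian_cong[OF o])
    fix y assume "y \<in> chart_map ?C ` chart_dom ?C"
    then obtain p where "p \<in> chart_dom ?C" "y = chart_map ?C p" by blast
    then show "(chart_map d \<circ> tsnd \<circ> chart_inv ?C) y = vdrop (mdim M) y"
      using inv by (simp add: prod_chart_map del: prod_chart_dom)
  qed (use zC in blast)
  then show "local_deriv (prod_manifold M N) ?C d tsnd z w = vdrop (mdim M) w"
    using w by (simp add: jacobian_vdrop)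
qed

lemma tangent_prod_coords:
  assumes c: "c \<in> charts_at M (tfst z)" and d: "d \<in> charts_at N (tsnd z)"
    and z: "z \<in> points (prod_manifold M N)" and u: "u \<in> tangent_space (prod_manifold M N) z"
  shows "u (prod_chart (mdim M) c d) =
    vec_append (mdim M) (snd (tangent_map (prod_manifold M N) M tfst (z, u)) c)
      (snd (tangent_map (prod_manifold M N) N tsnd (z, u)) d)"
proof -
  let ?C = "prod_chart (mdim M) c d"
  note C = prod_chart_at[OF c d z]
  have "u ?C \<in> Eucl (mdim M + mdim N)" using tangent_space_in_Eucl[OF u C] by simp
  note * = prod_local_deriv[OF c d z this]
  show ?thesis
    using tangent_map_chart[OF atlas_prod M smooth_tfst u C c]
      tangent_map_chart[OF atlas_prod N smooth_tsnd u C d] * by simp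
qed

text \<open>Equality may be tested in one product chart, and the coordinates there are read off from
  the two projections by \<open>tangent_prod_coords\<close>.\<close>

lemma tangent_prod_inject:
  assumes x: "x \<in> tangent_points (prod_manifold M N)" and y: "y \<in> tangent_points (prod_manifold M N)"
    and 1: "tangent_map (prod_manifold M N) M tfst x = tangent_map (prod_manifold M N) M tfst y"
    and 2: "tangent_map (prod_manifold M N) N tsnd x = tangent_map (prod_manifold M N) N tsnd y"
  shows "x = y"
proof -
  obtain z u where xu: "x = (z, u)" "z \<in> points (prod_manifold M N)" "u \<in> tangent_space (prod_manifold M N) z"
    using x by (auto simp: tangent_points_def)
  obtain z' u' where yu: "y = (z', u')" "z' \<in> points (prod_manifold M N)"
    "u' \<in> tangent_space (prod_manifold M N) z'"
    using y by (auto simp: tangent_points_def)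
  have "tfst z = tfst z'" "tsnd z = tsnd z'"
    using arg_cong[OF 1, of fst] arg_cong[OF 2, of fst] xu yu by simp_all
  then have zz: "z' = z" using xu yu by (auto simp: tup_times_iff)
  obtain c where c: "c \<in> charts_at M (tfst z)"
    using charts_at_ex[OF M, of "tfst z"] xu by (auto simp: tup_times_iff)
  obtain d where d: "d \<in> charts_at N (tsnd z)"
    using charts_at_ex[OF N, of "tsnd z"] xu by (auto simp: tup_times_iff)
  have "u = u'"
  proof (rule tangent_eqI[OF xu(3) _ prod_chart_at[OF c d xu(2)]])
    show "u' \<in> tangent_space (prod_manifold M N) z" using yu zz by simp
    show "u (prod_chart (mdim M) c d) = u' (prod_chart (mdim M) c d)"
      using tangent_prod_coords[OF c d xu(2,3)] tangent_prod_coords[OF c d, of u'] xu yu zz 1 2 by simp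
  qed
  then show ?thesis using xu yu zz by simp
qed

lemma tangent_prod_exists:
  assumes x: "x \<in> tangent_points M" and y: "y \<in> tangent_points N"
  shows "\<exists>z\<in>tangent_points (prod_manifold M N).
    tangent_map (prod_manifold M N) M tfst z = x \<and> tangent_map (prod_manifold M N) N tsnd z = y"
proof -
  obtain p v where xv: "x = (p, v)" "p \<in> points M" "v \<in> tangent_space M p"
    using x by (auto simp: tangent_points_def)
  obtain q w where yw: "y = (q, w)" "q \<in> points N" "w \<in> tangent_space N q"
    using y by (auto simp: tangent_points_def)
  obtain c where c: "c \<in> charts_at M (tfst (Tup p q))" using charts_at_ex[OF M xv(2)] by auto
  obtain d where d: "d \<in> charts_at N (tsnd (Tup p q))" using charts_at_ex[OF N yw(2)] by auto
  have z: "Tup p q \<in> points (prod_manifold M N)" using xv yw by simp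
  \<comment> \<open>The witness is prescribed in a product chart by concatenating the coordinates of
    \<open>v\<close> and \<open>w\<close>; \<open>tvec\<close> supplies its components in all other
    charts.\<close>
  let ?C = "prod_chart (mdim M) c d" and ?e = "vec_append (mdim M) (v c) (w d)"
  note C = prod_chart_at[OF c d z]
  have v: "v c \<in> Eucl (mdim M)" using tangent_space_in_Eucl[OF xv(3)] c by simp
  have w: "w d \<in> Eucl (mdim N)" using tangent_space_in_Eucl[OF yw(3)] d by simp
  have e: "?e \<in> Eucl (mdim M + mdim N)" using w by (rule vec_append_in_Eucl)
  then have "?e \<in> Eucl (mdim (prod_manifold M N))" by simp
  note u = tvec_in[OF atlas_prod C this]
  let ?u = "tvec (prod_manifold M N) (Tup p q) ?C ?e"
  have "tangent_map (prod_manifold M N) M tfst (Tup p q, ?u) = (tfst (Tup p q), v)"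
    by (rule tangent_map_eqI[OF atlas_prod M smooth_tfst z u(1) _ C c])
       (use xv in simp, use prod_local_deriv(1)[OF c d z e] u(2) v in simp)
  moreover have "tangent_map (prod_manifold M N) N tsnd (Tup p q, ?u) = (tsnd (Tup p q), w)"
    by (rule tangent_map_eqI[OF atlas_prod N smooth_tsnd z u(1) _ C d])
       (use yw in simp, use prod_local_deriv(2)[OF c d z e] u(2) in simp)
  moreover have "(Tup p q, ?u) \<in> tangent_points (prod_manifold M N)"
    using u(1) z by (simp add: tangent_points_def)
  ultimately show ?thesis using xv yw by (intro bexI[of _ "(Tup p q, ?u)"]) auto
qed

end

text \<open>The identification of pairs of tangent vectors with tangent vectors of the product. The
  maximal atlas of a product contains charts that are not products of charts, on which the pair has
  no evident coordinate formula; hence the description by the two projections.\<close>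

definition tangent_pair ::
    "'a tup manifold \<Rightarrow> 'a tup manifold \<Rightarrow> 'a tup \<times> 'a tup tvec \<Rightarrow> 'a tup \<times> 'a tup tvec \<Rightarrow>
      'a tup \<times> 'a tup tvec" where
  "tangent_pair M N x y = (THE z. z \<in> tangent_points (prod_manifold M N) \<and>
     tangent_map (prod_manifold M N) M tfst z = x \<and> tangent_map (prod_manifold M N) N tsnd z = y)"

context
  fixes M N :: "'a tup manifold"
  assumes M: "atlas_manifold M" and N: "atlas_manifold N"
begin

lemma tangent_pair:
  assumes x: "x \<in> tangent_points M" and y: "y \<in> tangent_points N"
  shows "tangent_pair M N x y \<in> tangent_points (prod_manifold M N)"
    and "tangent_map (prod_manifold M N) M tfst (tangent_pair M N x y) = x"
    and "tangent_map (prod_manifold M N) N tsnd (tangent_pair M N x y) = y"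
proof -
  have "\<exists>!z. z \<in> tangent_points (prod_manifold M N) \<and>
     tangent_map (prod_manifold M N) M tfst z = x \<and> tangent_map (prod_manifold M N) N tsnd z = y"
    using tangent_prod_exists[OF M N x y] tangent_prod_inject[OF M N] by metis
  from theI'[OF this] show "tangent_pair M N x y \<in> tangent_points (prod_manifold M N)"
    and "tangent_map (prod_manifold M N) M tfst (tangent_pair M N x y) = x"
    and "tangent_map (prod_manifold M N) N tsnd (tangent_pair M N x y) = y"
    unfolding tangent_pair_def by blast+
qed

text \<open>The way in which all equations between tangent pairs are proved: compare the two
  projections, where functoriality applies.\<close>

lemma tangent_pair_eqI:
  assumes "z \<in> tangent_points (prod_manifold M N)"
    "tangent_map (prod_manifold M N) M tfst z = x" "tangent_map (prod_manifold M N) N tsnd z = y"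
    "x \<in> tangent_points M" "y \<in> tangent_points N"
  shows "tangent_pair M N x y = z"
  using tangent_prod_inject[OF M N tangent_pair(1)[OF assms(4,5)] assms(1)]
    tangent_pair(2,3)[OF assms(4,5)] assms by simp

lemma fst_tangent_pair:
  assumes "x \<in> tangent_points M" "y \<in> tangent_points N"
  shows "fst (tangent_pair M N x y) = Tup (fst x) (fst y)"
proof -
  have "tfst (fst (tangent_pair M N x y)) = fst x" "tsnd (fst (tangent_pair M N x y)) = fst y"
    using arg_cong[OF tangent_pair(2)[OF assms], of fst] arg_cong[OF tangent_pair(3)[OF assms], of fst] by simp_all
  moreover have "fst (tangent_pair M N x y) \<in> points (prod_manifold M N)"
    using tangent_pair(1)[OF assms] by (auto simp: tangent_points_def)
  ultimately show ?thesis by (auto simp: tup_times_iff)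
qed

text \<open>\<open>smooth_tangentI\<close> needs one chart at each point, so a product chart can be
  taken; there the fibre coordinates are those of \<open>F q\<close> followed by those of
  \<open>G q\<close>.\<close>

lemma smooth_tangent_pair:
  assumes Q: "atlas_manifold Q" and F: "smooth_map Q (tangent_bundle M) F"
    and G: "smooth_map Q (tangent_bundle N) G"
  shows "smooth_map Q (tangent_bundle (prod_manifold M N)) (\<lambda>q. tangent_pair M N (F q) (G q))"
proof (rule smooth_tangentI[OF atlas_prod[OF M N] Q])
  note f = smooth_tangentD[OF M Q F] and g = smooth_tangentD[OF N Q G]
  let ?f = "\<lambda>q. Tup (fst (F q)) (fst (G q))"
  show "smooth_map Q (prod_manifold M N) ?f" by (rule smooth_Tup[OF M N Q f(2) g(2)])
  show P: "fst (tangent_pair M N (F q) (G q)) = ?f q \<and>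
      snd (tangent_pair M N (F q) (G q)) \<in> tangent_space (prod_manifold M N) (?f q)"
    if "q \<in> points Q" for q
    using fst_tangent_pair[OF f(3)[OF that] g(3)[OF that]] tangent_pair(1)[OF f(3)[OF that] g(3)[OF that]]
    by (auto simp: tangent_points_def)
  fix q assume q: "q \<in> points Q"
  obtain c where c: "c \<in> charts M" "fst (F q) \<in> chart_dom c"
    using chart_aroundE[OF M smooth_map_points[OF f(2) q]] .
  obtain d where d: "d \<in> charts N" "fst (G q) \<in> chart_dom d"
    using chart_aroundE[OF N smooth_map_points[OF g(2) q]] .
  let ?C = "prod_chart (mdim M) c d"
  let ?W = "{q \<in> points Q. fst (F q) \<in> chart_dom c} \<inter> {q \<in> points Q. fst (G q) \<in> chart_dom d}"
  have W: "openin (space_top Q) ?W"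
    using smooth_fn_open[OF f(1)[OF c(1)]] smooth_fn_open[OF g(1)[OF d(1)]] by (rule openin_Int)
  have coord: "snd (tangent_pair M N (F q) (G q)) ?C = vec_append (mdim M) (snd (F q) c) (snd (G q) d)"
    if q: "q \<in> ?W" for q
  proof -
    have q': "q \<in> points Q" using q by blast
    note P' = P[OF q'] and T = tangent_pair(2,3)[OF f(3)[OF q'] g(3)[OF q']]
    have eq: "(?f q, snd (tangent_pair M N (F q) (G q))) = tangent_pair M N (F q) (G q)"
      using P' by (metis prod.collapse)
    have "snd (tangent_pair M N (F q) (G q)) ?C =
      vec_append (mdim M)
        (snd (tangent_map (prod_manifold M N) M tfst (?f q, snd (tangent_pair M N (F q) (G q)))) c)
        (snd (tangent_map (prod_manifold M N) N tsnd (?f q, snd (tangent_pair M N (F q) (G q)))) d)"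
      using q c d smooth_map_points[OF f(2) q'] smooth_map_points[OF g(2) q'] P'
      by (intro tangent_prod_coords[OF M N]) (auto simp: charts_at_iff)
    then show ?thesis unfolding eq T .
  qed
  have "smooth_fn Q ?W (\<lambda>q. snd (tangent_pair M N (F q) (G q)) ?C j)" for j
  proof -
    have 1: "smooth_fn Q ?W (\<lambda>q. snd (F q) c j)" for j
      by (rule smooth_fn_subset[OF f(1)[OF c(1)] W]) auto
    have 2: "smooth_fn Q ?W (\<lambda>q. snd (G q) d j)" for j
      by (rule smooth_fn_subset[OF g(1)[OF d(1)] W]) auto
    have "smooth_fn Q ?W (\<lambda>q. vec_append (mdim M) (snd (F q) c) (snd (G q) d) j)"
      using 1[of j] 2[of "j - mdim M"] by (cases "j < mdim M") (simp_all add: vec_append_def)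
    then show ?thesis by (rule smooth_fn_cong[OF Q]) (simp add: coord)
  qed
  then show "\<exists>c\<in>charts_at (prod_manifold M N) (?f q). \<exists>W. q \<in> W \<and>
      (\<forall>j. smooth_fn Q W (\<lambda>q. snd (tangent_pair M N (F q) (G q)) c j))"
    using c d q prod_chart_in_charts[OF M N c(1) d(1)]
    by (intro bexI[of _ ?C] exI[of _ ?W]) (auto simp: charts_at_iff)
qed

end

lemma smooth_manifold_prod:
  "smooth_manifold M \<Longrightarrow> smooth_manifold N \<Longrightarrow> smooth_manifold (prod_manifold M N)"
  unfolding smooth_manifold_iff space_top_prod
  by (simp add: Hausdorff_tup_prod second_countable_tup_prod atlas_prod)

lemma smooth_tup_map:
  assumes "atlas_manifold M" "atlas_manifold M'" "atlas_manifold N" "atlas_manifold N'"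
    and f: "smooth_map M N f" and g: "smooth_map M' N' g"
  shows "smooth_map (prod_manifold M M') (prod_manifold N N') (tup_map f g)"
proof -
  note MM = atlas_prod[OF assms(1,2)]
  have "smooth_map (prod_manifold M M') (prod_manifold N N') (\<lambda>z. Tup ((f \<circ> tfst) z) ((g \<circ> tsnd) z))"
    by (rule smooth_Tup[OF assms(3,4) MM smooth_map_compose[OF MM assms(1,3) smooth_tfst[OF assms(1,2)] f]
        smooth_map_compose[OF MM assms(2,4) smooth_tsnd[OF assms(1,2)] g]])
  moreover have "tup_map f g = (\<lambda>z. Tup ((f \<circ> tfst) z) ((g \<circ> tsnd) z))"
    by (simp add: tup_map_def fun_eq_iff)
  ultimately show ?thesis by (simp only:)
qed

text \<open>After \<open>tup_map f g\<close> the projections are \<open>f\<close> after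
  \<open>tfst\<close> and \<open>g\<close> after \<open>tsnd\<close>, so functoriality yields both
  components.\<close>

lemma tangent_map_tup_map:
  assumes M: "atlas_manifold M" "atlas_manifold M'" and N: "atlas_manifold N" "atlas_manifold N'"
    and f: "smooth_map M N f" and g: "smooth_map M' N' g"
    and x: "x \<in> tangent_points (prod_manifold M M')"
  shows "tangent_map (prod_manifold M M') (prod_manifold N N') (tup_map f g) x =
    tangent_pair N N' (tangent_map M N f (tangent_map (prod_manifold M M') M tfst x))
      (tangent_map M' N' g (tangent_map (prod_manifold M M') M' tsnd x))"
proof -
  note MM = atlas_prod[OF M] and NN = atlas_prod[OF N] and fg = smooth_tup_map[OF M N f g]
  note p1 = smooth_tfst[OF M] and p2 = smooth_tsnd[OF M]
  have "tangent_map (prod_manifold N N') N tfst (tangent_map (prod_manifold M M') (prod_manifold N N') (tup_map f g) x)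
      = tangent_map (prod_manifold M M') N (tfst \<circ> tup_map f g) x"
    by (rule tangent_map_compose[OF MM NN N(1) fg smooth_tfst[OF N] x, symmetric])
  also have "tfst \<circ> tup_map f g = f \<circ> tfst" by (auto simp: tup_map_def)
  also have "tangent_map (prod_manifold M M') N (f \<circ> tfst) x =
      tangent_map M N f (tangent_map (prod_manifold M M') M tfst x)"
    by (rule tangent_map_compose[OF MM M(1) N(1) p1 f x])
  finally have 1: "tangent_map (prod_manifold N N') N tfst
      (tangent_map (prod_manifold M M') (prod_manifold N N') (tup_map f g) x) =
      tangent_map M N f (tangent_map (prod_manifold M M') M tfst x)" .
  have "tangent_map (prod_manifold N N') N' tsnd (tangent_map (prod_manifold M M') (prod_manifold N N') (tup_map f g) x)
      = tangent_map (prod_manifold M M') N' (tsnd \<circ> tup_map f g) x"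
    by (rule tangent_map_compose[OF MM NN N(2) fg smooth_tsnd[OF N] x, symmetric])
  also have "tsnd \<circ> tup_map f g = g \<circ> tsnd" by (auto simp: tup_map_def)
  also have "tangent_map (prod_manifold M M') N' (g \<circ> tsnd) x =
      tangent_map M' N' g (tangent_map (prod_manifold M M') M' tsnd x)"
    by (rule tangent_map_compose[OF MM M(2) N(2) p2 g x])
  finally have 2: "tangent_map (prod_manifold N N') N' tsnd
      (tangent_map (prod_manifold M M') (prod_manifold N N') (tup_map f g) x) =
      tangent_map M' N' g (tangent_map (prod_manifold M M') M' tsnd x)" .
  show ?thesis
    by (rule tangent_pair_eqI[OF N tangent_map_points[OF MM NN fg x] 1 2, symmetric])
       (rule tangent_map_points[OF M(1) N(1) f tangent_map_points[OF MM M(1) p1 x]],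
        rule tangent_map_points[OF M(2) N(2) g tangent_map_points[OF MM M(2) p2 x]])
qed

lemma image_eq_iff_surj: "(\<And>x. x \<in> A \<Longrightarrow> h x \<in> B) \<Longrightarrow> h ` A = B \<longleftrightarrow> (\<forall>y\<in>B. \<exists>x\<in>A. h x = y)"
  by (auto simp: set_eq_iff image_iff) metis

text \<open>One inclusion of the fibrewise image equation is automatic. What is left is a lifting
  property for points of the tangent bundle, stated without splitting them into base and
  vector.\<close>

lemma surjective_submersion_iff:
  "surjective_submersion M N f \<longleftrightarrow> smooth_map M N f \<and> f ` points M = points N \<and>
     (\<forall>p\<in>points M. \<forall>y\<in>tangent_points N. fst y = f p \<longrightarrow>
        (\<exists>x\<in>tangent_points M. fst x = p \<and> tangent_map M N f x = y))"
  if M: "atlas_manifold M" and N: "atlas_manifold N"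
proof -
  have *: "tangent_map M N f ` ({p} \<times> tangent_space M p) = {f p} \<times> tangent_space N (f p) \<longleftrightarrow>
      (\<forall>y\<in>tangent_points N. fst y = f p \<longrightarrow> (\<exists>x\<in>tangent_points M. fst x = p \<and> tangent_map M N f x = y))"
    if f: "smooth_map M N f" and p: "p \<in> points M" for p
  proof -
    note fp = smooth_map_points[OF f p]
    have 1: "{f p} \<times> tangent_space N (f p) = {y \<in> tangent_points N. fst y = f p}"
      using fp by (auto simp: tangent_points_def)
    have 2: "{p} \<times> tangent_space M p = {x \<in> tangent_points M. fst x = p}"
      using p by (auto simp: tangent_points_def)
    let ?A = "{x \<in> tangent_points M. fst x = p}" and ?B = "{y \<in> tangent_points N. fst y = f p}"
    have "tangent_map M N f ` ?A = ?B \<longleftrightarrow> (\<forall>y\<in>?B. \<exists>x\<in>?A. tangent_map M N f x = y)"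
      by (rule image_eq_iff_surj) (use tangent_map_points[OF M N f] in auto)
    also have "\<dots> \<longleftrightarrow> (\<forall>y\<in>tangent_points N. fst y = f p \<longrightarrow>
        (\<exists>x\<in>tangent_points M. fst x = p \<and> tangent_map M N f x = y))"
      by (simp only: Ball_def Bex_def mem_Collect_eq conj_assoc imp_conjL)
    finally show ?thesis unfolding 1 2 .
  qed
  show ?thesis
  proof (cases "smooth_map M N f")
    case True
    then show ?thesis
      unfolding surjective_submersion_def by (simp only: *[OF True] simp_thms cong: ball_cong)
  qed (simp add: surjective_submersion_def)
qed

text \<open>A tangent vector of the product of the bases is lifted by lifting its two projections
  and pairing the lifts.\<close>

lemma surjective_submersion_prod:
  assumes M: "atlas_manifold M" "atlas_manifold M'" and N: "atlas_manifold N" "atlas_manifold N'"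
    and f: "surjective_submersion M N f" and g: "surjective_submersion M' N' g"
  shows "surjective_submersion (prod_manifold M M') (prod_manifold N N')
    (restrict (tup_map f g) (points (prod_manifold M M')))"
    (is "surjective_submersion ?M ?N ?h")
proof -
  note MM = atlas_prod[OF M] and NN = atlas_prod[OF N]
  note f' = f[unfolded surjective_submersion_iff[OF M(1) N(1)]]
  note g' = g[unfolded surjective_submersion_iff[OF M(2) N(2)]]
  have sf: "smooth_map M N f" and fi: "f ` points M = points N"
    and fs: "\<And>p y. p \<in> points M \<Longrightarrow> y \<in> tangent_points N \<Longrightarrow> fst y = f p \<Longrightarrow>
      \<exists>x\<in>tangent_points M. fst x = p \<and> tangent_map M N f x = y"
    using f' by simp_all
  have sg: "smooth_map M' N' g" and gi: "g ` points M' = points N'"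
    and gs: "\<And>p y. p \<in> points M' \<Longrightarrow> y \<in> tangent_points N' \<Longrightarrow> fst y = g p \<Longrightarrow>
      \<exists>x\<in>tangent_points M'. fst x = p \<and> tangent_map M' N' g x = y"
    using g' by simp_all
  note fg = smooth_tup_map[OF M N sf sg]
  have h: "smooth_map ?M ?N ?h"
    by (rule smooth_map_cong[OF MM NN fg]) simp
  show ?thesis
    unfolding surjective_submersion_iff[OF MM NN]
  proof (intro conjI ballI impI h)
    show "?h ` points ?M = points ?N"
    proof (intro equalityI subsetI)
      show "y \<in> points ?N" if "y \<in> ?h ` points ?M" for y
        using that smooth_map_points[OF h] by blast
      fix y assume "y \<in> points ?N"
      then obtain a b where ab: "y = Tup a b" "a \<in> points N" "b \<in> points N'" by (auto elim: tup_timesE)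
      obtain x where x: "x \<in> points M" "f x = a" using ab(2) unfolding fi[symmetric] by blast
      obtain x' where x': "x' \<in> points M'" "g x' = b" using ab(3) unfolding gi[symmetric] by blast
      have "y = ?h (Tup x x')" using x x' ab by simp
      then show "y \<in> ?h ` points ?M" using x x' by (intro image_eqI[of _ _ "Tup x x'"]) auto
    qed
    fix z y assume z: "z \<in> points ?M" and y: "y \<in> tangent_points ?N" and yz: "fst y = ?h z"
    obtain p q where pq: "z = Tup p q" "p \<in> points M" "q \<in> points M'" using z by (auto elim: tup_timesE)
    let ?y1 = "tangent_map ?N N tfst y" and ?y2 = "tangent_map ?N N' tsnd y"
    have y1: "?y1 \<in> tangent_points N" "fst ?y1 = f p"
      using tangent_map_points[OF NN N(1) smooth_tfst[OF N] y] yz pq by simp_all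
    have y2: "?y2 \<in> tangent_points N'" "fst ?y2 = g q"
      using tangent_map_points[OF NN N(2) smooth_tsnd[OF N] y] yz pq by simp_all
    obtain v where v: "v \<in> tangent_points M" "fst v = p" "tangent_map M N f v = ?y1"
      using fs[OF pq(2) y1] by blast
    obtain w where w: "w \<in> tangent_points M'" "fst w = q" "tangent_map M' N' g w = ?y2"
      using gs[OF pq(3) y2] by blast
    let ?x = "tangent_pair M M' v w"
    note x = tangent_pair[OF M v(1) w(1)]
    have "tangent_map ?M ?N ?h ?x = tangent_map ?M ?N (tup_map f g) ?x"
      by (rule tangent_map_cong[OF MM NN h x(1)]) simp
    also have "\<dots> = tangent_pair N N' ?y1 ?y2"
      using tangent_map_tup_map[OF M N sf sg x(1)] x v w by simp
    also have "\<dots> = y"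
      by (rule tangent_pair_eqI[OF N y refl refl y1(1) y2(1)])
    finally show "\<exists>x\<in>tangent_points ?M. fst x = z \<and> tangent_map ?M ?N ?h x = y"
      using x(1) fst_tangent_pair[OF M v(1) w(1)] v w pq by (intro bexI[of _ ?x]) auto
  qed
qed

section \<open>The one-point manifold\<close>

lemma point_manifold: "smooth_manifold (point_manifold :: 'a tup manifold)"
  and points_point [simp]: "points (point_manifold :: 'a tup manifold) = {Pt}"
proof -
  show "points (point_manifold :: 'a tup manifold) = {Pt}" by (simp add: point_manifold_def manifold_of_atlas_def)
  let ?c = "({Pt}, \<lambda>_ _. 0) :: 'a tup chart"
  have E: "Eucl 0 = {\<lambda>_. 0}" by (auto simp: Eucl_iff)
  have o: "openin (Euclidean_space 0) {\<lambda>_. 0}" using openin_topspace[of "Euclidean_space 0"] by (simp add: E)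
  have c: "is_chart (discrete_topology {Pt}) 0 ?c"
    unfolding is_chart_iff using o by (auto simp: E subset_singleton_iff)
  have "atlas_manifold (point_manifold :: 'a tup manifold)"
    unfolding point_manifold_def
  proof (rule atlas_manifold_of_atlas(1))
    show "C_inf_on 0 (chart_map a ` (chart_dom a \<inter> chart_dom b)) (chart_map b \<circ> chart_inv a)"
      if "a \<in> {?c}" "b \<in> {?c}" for a b
      using that o by (auto simp: C_inf_on_def intro: C_k_on_const)
  qed (use c in auto)
  then show "smooth_manifold (point_manifold :: 'a tup manifold)"
    unfolding smooth_manifold_iff
    by (simp add: point_manifold_def manifold_of_atlas_def second_countable_discrete_topology Hausdorff_space_discrete_topology)
qed

lemma smooth_map_point:
  fixes M :: "'a manifold"
  assumes M: "atlas_manifold M"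
  shows "smooth_map M (point_manifold :: 'b tup manifold) (\<lambda>_. Pt)"
proof (rule smooth_mapI[OF M smooth_imp_atlas_manifold[OF point_manifold]])
  fix p assume p: "p \<in> points M"
  obtain d :: "'b tup chart" where d: "d \<in> charts_at point_manifold Pt"
    using charts_at_ex[OF smooth_imp_atlas_manifold[OF point_manifold], of Pt] by auto
  then show "\<exists>d\<in>charts_at (point_manifold :: 'b tup manifold) Pt. \<exists>W. p \<in> W \<and> (\<lambda>_. Pt) ` W \<subseteq> chart_dom d \<and>
      (\<forall>j. smooth_fn M W (\<lambda>q. chart_map d Pt j))"
    using p by (intro bexI[OF _ d] exI[of _ "points M"]) (auto simp: charts_at_iff smooth_fn_const[OF M])
qed simp

lemma surjective_submersion_point:
  "surjective_submersion point_manifold point_manifold (restrict id (points point_manifold))"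
proof -
  note P = smooth_imp_atlas_manifold[OF point_manifold]
  have s: "smooth_map point_manifold point_manifold (restrict id (points point_manifold))"
    by (rule smooth_map_cong[OF P P smooth_map_id[OF P]]) simp
  have "tangent_map point_manifold point_manifold (restrict id (points point_manifold)) y = y"
    if "y \<in> tangent_points point_manifold" for y
    using tangent_map_cong[OF P P s that, of "\<lambda>p. p"] tangent_map_id[OF P that] by simp
  then show ?thesis
    unfolding surjective_submersion_iff[OF P P] using s by auto
qed

text \<open>Composites and products of diffeomorphisms come with an inverse that is known only on
  the points; this form accepts it in place of \<open>inv_into\<close>.\<close>

lemma diffeomorphism_iff:
  assumes M: "atlas_manifold M" and N: "atlas_manifold N"
  shows "diffeomorphism M N f \<longleftrightarrow> smooth_map M N f \<and>
    (\<exists>g. smooth_map N M g \<and> (\<forall>p\<in>points M. g (f p) = p) \<and> (\<forall>q\<in>points N. f (g q) = q))"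
proof
  assume "diffeomorphism M N f"
  then show "smooth_map M N f \<and>
    (\<exists>g. smooth_map N M g \<and> (\<forall>p\<in>points M. g (f p) = p) \<and> (\<forall>q\<in>points N. f (g q) = q))"
    unfolding diffeomorphism_def bij_betw_def
    by (intro conjI exI[of _ "inv_into (points M) f"]) (auto simp: f_inv_into_f)
next
  assume "smooth_map M N f \<and>
    (\<exists>g. smooth_map N M g \<and> (\<forall>p\<in>points M. g (f p) = p) \<and> (\<forall>q\<in>points N. f (g q) = q))"
  then obtain g where f: "smooth_map M N f" and g: "smooth_map N M g"
    and gf: "\<And>p. p \<in> points M \<Longrightarrow> g (f p) = p" and fg: "\<And>q. q \<in> points N \<Longrightarrow> f (g q) = q" by blast
  have inj: "inj_on f (points M)" using gf by (rule inj_on_inverseI)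
  have "bij_betw f (points M) (points N)"
    using inj fg smooth_map_points[OF f] smooth_map_points[OF g] by (auto simp: bij_betw_def image_iff) metis
  moreover have "smooth_map N M (inv_into (points M) f)"
  proof (rule smooth_map_cong[OF N M g])
    fix q assume q: "q \<in> points N"
    show "g q = inv_into (points M) f q"
      using inv_into_f_f[OF inj smooth_map_points[OF g q]] fg[OF q] by simp
  qed
  ultimately show "diffeomorphism M N f" using f by (simp add: diffeomorphism_def)
qed

section \<open>Opposite monoidal categories\<close>

lemma hom_setD: "f \<in> hom_set C a b \<Longrightarrow> f \<in> Arr C \<and> Dom C f = a \<and> Cod C f = b"
  by (simp add: hom_set_def)

lemma inverse_arrows_iff:
  "f \<in> hom_set C a b \<Longrightarrow> inverse_arrows C f g \<longleftrightarrow>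
    g \<in> hom_set C b a \<and> g \<cdot>\<^bsub>C\<^esub> f = Ide C a \<and> f \<cdot>\<^bsub>C\<^esub> g = Ide C b"
  by (auto simp: inverse_arrows_def hom_set_def)

context category
begin

lemma inverse_arrows_sym: "inverse_arrows C f g \<Longrightarrow> inverse_arrows C g f"
  by (auto simp: inverse_arrows_def hom_set_def)

lemma inverse_arrows_unique:
  assumes "inverse_arrows C f g" "inverse_arrows C f h"
  shows "g = h"
proof -
  let ?a = "Dom C f" and ?b = "Cod C f"
  have f: "f \<in> hom_set C ?a ?b" and g: "g \<in> hom_set C ?b ?a" and h: "h \<in> hom_set C ?b ?a"
    and gf: "g \<cdot> f = Ide C ?a" and fh: "f \<cdot> h = Ide C ?b"
    using assms by (auto simp: inverse_arrows_def hom_set_def)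
  have "g = g \<cdot> (f \<cdot> h)" using comp_ide[OF g] fh by simp
  also have "\<dots> = (g \<cdot> f) \<cdot> h" by (rule comp_assoc[OF h f g, symmetric])
  also have "\<dots> = h" using ide_comp[OF h] gf by simp
  finally show ?thesis .
qed

lemma inverse_arrow_eq: "inverse_arrows C f g \<Longrightarrow> inverse_arrow C f = g"
  unfolding inverse_arrow_def by (rule the_equality, assumption) (rule inverse_arrows_unique)

lemma inverse_arrow: "iso_arrow C f \<Longrightarrow> inverse_arrows C f (inverse_arrow C f)"
  unfolding iso_arrow_def by (erule exE) (simp add: inverse_arrow_eq)

lemma inverse_arrow_in_hom:
  assumes "iso_arrow C f" "f \<in> hom_set C a b"
  shows "inverse_arrow C f \<in> hom_set C b a"
  using inverse_arrow[OF assms(1)] inverse_arrows_iff[OF assms(2)] by simp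

lemma inverse_arrows_comp:
  assumes f: "f \<in> hom_set C a b" "inverse_arrows C f f'" and g: "g \<in> hom_set C b c" "inverse_arrows C g g'"
  shows "inverse_arrows C (g \<cdot> f) (f' \<cdot> g')"
proof -
  have f': "f' \<in> hom_set C b a" "f' \<cdot> f = Ide C a" "f \<cdot> f' = Ide C b"
    using f(2) inverse_arrows_iff[OF f(1)] by auto
  have g': "g' \<in> hom_set C c b" "g' \<cdot> g = Ide C b" "g \<cdot> g' = Ide C c"
    using g(2) inverse_arrows_iff[OF g(1)] by auto
  have "(f' \<cdot> g') \<cdot> (g \<cdot> f) = f' \<cdot> (g' \<cdot> (g \<cdot> f))"
    by (rule comp_assoc[OF comp_in_hom[OF f(1) g(1)] g'(1) f'(1)])
  also have "g' \<cdot> (g \<cdot> f) = f"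
    using comp_assoc[OF f(1) g(1) g'(1)] g'(2) ide_comp[OF f(1)] by simp
  finally have 1: "(f' \<cdot> g') \<cdot> (g \<cdot> f) = Ide C a" using f'(2) by simp
  have "(g \<cdot> f) \<cdot> (f' \<cdot> g') = g \<cdot> (f \<cdot> (f' \<cdot> g'))"
    by (rule comp_assoc[OF comp_in_hom[OF g'(1) f'(1)] f(1) g(1)])
  also have "f \<cdot> (f' \<cdot> g') = g'"
    using comp_assoc[OF g'(1) f'(1) f(1)] f'(3) ide_comp[OF g'(1)] by simp
  finally have 2: "(g \<cdot> f) \<cdot> (f' \<cdot> g') = Ide C c" using g'(3) by simp
  show ?thesis
    unfolding inverse_arrows_iff[OF comp_in_hom[OF f(1) g(1)]]
    using 1 2 comp_in_hom[OF g'(1) f'(1)] by blast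
qed

text \<open>Turns a naturality square of \<alpha> and \<beta> into the square of their inverses,
  which is naturality in the opposite category.\<close>

lemma inverse_arrows_swap:
  assumes x: "x \<in> hom_set C p q" and y: "y \<in> hom_set C r s"
    and \<alpha>: "\<alpha> \<in> hom_set C q s" "iso_arrow C \<alpha>" and \<beta>: "\<beta> \<in> hom_set C p r" "iso_arrow C \<beta>"
    and eq: "\<alpha> \<cdot> x = y \<cdot> \<beta>"
  shows "x \<cdot> inverse_arrow C \<beta> = inverse_arrow C \<alpha> \<cdot> y"
proof -
  let ?\<alpha> = "inverse_arrow C \<alpha>" and ?\<beta> = "inverse_arrow C \<beta>"
  have a: "?\<alpha> \<in> hom_set C s q" "?\<alpha> \<cdot> \<alpha> = Ide C q"
    using inverse_arrow[OF \<alpha>(2)] inverse_arrows_iff[OF \<alpha>(1)] by auto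
  have b: "?\<beta> \<in> hom_set C r p" "\<beta> \<cdot> ?\<beta> = Ide C r"
    using inverse_arrow[OF \<beta>(2)] inverse_arrows_iff[OF \<beta>(1)] by auto
  have "x = ?\<alpha> \<cdot> (\<alpha> \<cdot> x)"
    using comp_assoc[OF x \<alpha>(1) a(1)] a(2) ide_comp[OF x] by simp
  then have "x \<cdot> ?\<beta> = (?\<alpha> \<cdot> (y \<cdot> \<beta>)) \<cdot> ?\<beta>" using eq by simp
  also have "\<dots> = ?\<alpha> \<cdot> ((y \<cdot> \<beta>) \<cdot> ?\<beta>)"
    by (rule comp_assoc[OF b(1) comp_in_hom[OF \<beta>(1) y] a(1)])
  also have "(y \<cdot> \<beta>) \<cdot> ?\<beta> = y"
    using comp_assoc[OF b(1) \<beta>(1) y] b(2) comp_ide[OF y] by simp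
  finally show ?thesis .
qed

end

lemma (in monoidal_category) inverse_arrows_tensor:
  assumes f: "f \<in> hom_set C a a'" "inverse_arrows C f f'" and g: "g \<in> hom_set C b b'" "inverse_arrows C g g'"
  shows "inverse_arrows C (f \<boxdot> g) (f' \<boxdot> g')"
proof -
  have f': "f' \<in> hom_set C a' a" "f' \<cdot> f = Ide C a" "f \<cdot> f' = Ide C a'"
    using f(2) inverse_arrows_iff[OF f(1)] by auto
  have g': "g' \<in> hom_set C b' b" "g' \<cdot> g = Ide C b" "g \<cdot> g' = Ide C b'"
    using g(2) inverse_arrows_iff[OF g(1)] by auto
  have ob: "a \<in> Obj C" "a' \<in> Obj C" "b \<in> Obj C" "b' \<in> Obj C"
    using dom_cod[of f] dom_cod[of g] hom_setD[OF f(1)] hom_setD[OF g(1)] by auto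
  show ?thesis
    unfolding inverse_arrows_iff[OF tensor_in_hom[OF f(1) g(1)]]
    using tensor_in_hom[OF f'(1) g'(1)] tensor_comp[OF f(1) f'(1) g(1) g'(1)]
      tensor_comp[OF f'(1) f(1) g'(1) g(1)] f' g' tensor_ide ob by auto
qed

lemma (in category) inverse_arrows_ide: "a \<in> Obj C \<Longrightarrow> inverse_arrows C (Ide C a) (Ide C a)"
  using inverse_arrows_iff[OF ide_in_hom] ide_in_hom comp_ide by metis

lemma opposite_simps [simp]:
  "Obj (opposite C) = Obj C" "Arr (opposite C) = Arr C" "Dom (opposite C) = Cod C"
  "Cod (opposite C) = Dom C" "Ide (opposite C) = Ide C"
  "g \<cdot>\<^bsub>opposite C\<^esub> f = f \<cdot>\<^bsub>C\<^esub> g"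
  "tensor (opposite C) = tensor C" "tensor_arr (opposite C) = tensor_arr C"
  "unit (opposite C) = unit C"
  "associator (opposite C) a b c = inverse_arrow C (associator C a b c)"
  "left_unitor (opposite C) a = inverse_arrow C (left_unitor C a)"
  "right_unitor (opposite C) a = inverse_arrow C (right_unitor C a)"
  by (simp_all add: opposite_def)

lemma hom_set_opposite [simp]: "hom_set (opposite C) a b = hom_set C b a"
  by (auto simp: hom_set_def)

lemma iso_arrow_opposite [simp]: "iso_arrow (opposite C) f = iso_arrow C f"
  by (auto simp: iso_arrow_def inverse_arrows_def)

text \<open>The structure arrows of the opposite are inverses, so each coherence law is the
  corresponding law of \<open>C\<close> with both sides inverted, and it follows from the uniqueness
  of inverses.\<close>

lemma monoidal_category_opposite:
  fixes C :: "('o, 'm) monoidal"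
  assumes "monoidal_category C"
  shows "monoidal_category (opposite C)"
proof -
  interpret monoidal_category C by fact
  have inv_iso: "iso_arrow C (inverse_arrow C f)" if "iso_arrow C f" for f
    using inverse_arrows_sym[OF inverse_arrow[OF that]] by (auto simp: iso_arrow_def)
  note [simp] = inverse_arrow_in_hom[OF associator_iso associator_in_hom]
    inverse_arrow_in_hom[OF left_unitor_iso left_unitor_in_hom]
    inverse_arrow_in_hom[OF right_unitor_iso right_unitor_in_hom]
  have ob: "a \<in> Obj C" "b \<in> Obj C" if "f \<in> hom_set C a b" for f a b
    using dom_cod[of f] hom_setD[OF that] by auto
  show ?thesis
  proof (intro monoidal_category.intro category.intro monoidal_category_axioms.intro;
      (simp only: opposite_simps hom_set_opposite iso_arrow_opposite)?)
    fix f a a' g b b' h c c'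
    assume f: "f \<in> hom_set C a' a" and g: "g \<in> hom_set C b' b" and h: "h \<in> hom_set C c' c"
    show "((f \<boxdot>\<^bsub>C\<^esub> g) \<boxdot>\<^bsub>C\<^esub> h) \<cdot>\<^bsub>C\<^esub> inverse_arrow C (associator C a' b' c') =
        inverse_arrow C (associator C a b c) \<cdot>\<^bsub>C\<^esub> (f \<boxdot>\<^bsub>C\<^esub> (g \<boxdot>\<^bsub>C\<^esub> h))"
      using ob[OF f] ob[OF g] ob[OF h]
      by (intro inverse_arrows_swap[OF tensor_in_hom[OF tensor_in_hom[OF f g] h]
            tensor_in_hom[OF f tensor_in_hom[OF g h]] associator_in_hom associator_iso
            associator_in_hom associator_iso associator_natural[OF f g h]])
  next
    fix f a a' assume f: "f \<in> hom_set C a' a"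
    show "(Ide C (unit C) \<boxdot>\<^bsub>C\<^esub> f) \<cdot>\<^bsub>C\<^esub> inverse_arrow C (left_unitor C a') =
        inverse_arrow C (left_unitor C a) \<cdot>\<^bsub>C\<^esub> f"
      using ob[OF f]
      by (intro inverse_arrows_swap[OF tensor_in_hom[OF ide_in_hom[OF unit_obj] f] f
            left_unitor_in_hom left_unitor_iso left_unitor_in_hom left_unitor_iso left_unitor_natural[OF f]])
    show "(f \<boxdot>\<^bsub>C\<^esub> Ide C (unit C)) \<cdot>\<^bsub>C\<^esub> inverse_arrow C (right_unitor C a') =
        inverse_arrow C (right_unitor C a) \<cdot>\<^bsub>C\<^esub> f"
      using ob[OF f]
      by (intro inverse_arrows_swap[OF tensor_in_hom[OF f ide_in_hom[OF unit_obj]] f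
            right_unitor_in_hom right_unitor_iso right_unitor_in_hom right_unitor_iso right_unitor_natural[OF f]])
  next
    fix a b c d assume o: "a \<in> Obj C" "b \<in> Obj C" "c \<in> Obj C" "d \<in> Obj C"
    let ?A = "associator C" and ?I = "inverse_arrow C"
    note t = tensor_obj
    have inv: "inverse_arrows C (?A x y z) (?I (?A x y z))" if "x \<in> Obj C" "y \<in> Obj C" "z \<in> Obj C" for x y z
      by (rule inverse_arrow[OF associator_iso[OF that]])
    \<comment> \<open>\<open>1\<close> and \<open>3\<close> exhibit inverses of the two sides of the
      pentagon; \<open>2\<close> and \<open>h2\<close> prepare the longer side.\<close>
    have 1: "inverse_arrows C (?A a b (c \<boxtimes>\<^bsub>C\<^esub> d) \<cdot>\<^bsub>C\<^esub> ?A (a \<boxtimes>\<^bsub>C\<^esub> b) c d)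
        (?I (?A (a \<boxtimes>\<^bsub>C\<^esub> b) c d) \<cdot>\<^bsub>C\<^esub> ?I (?A a b (c \<boxtimes>\<^bsub>C\<^esub> d)))"
      using o by (intro inverse_arrows_comp[OF associator_in_hom inv associator_in_hom inv] t)
    have 2: "inverse_arrows C (?A a (b \<boxtimes>\<^bsub>C\<^esub> c) d \<cdot>\<^bsub>C\<^esub> (?A a b c \<boxdot>\<^bsub>C\<^esub> Ide C d))
        ((?I (?A a b c) \<boxdot>\<^bsub>C\<^esub> Ide C d) \<cdot>\<^bsub>C\<^esub> ?I (?A a (b \<boxtimes>\<^bsub>C\<^esub> c) d))"
      using o by (intro inverse_arrows_comp[OF tensor_in_hom[OF associator_in_hom ide_in_hom]
            inverse_arrows_tensor[OF associator_in_hom inv ide_in_hom inverse_arrows_ide]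
            associator_in_hom inv] t)
    have h2: "?A a (b \<boxtimes>\<^bsub>C\<^esub> c) d \<cdot>\<^bsub>C\<^esub> (?A a b c \<boxdot>\<^bsub>C\<^esub> Ide C d) \<in>
        hom_set C (((a \<boxtimes>\<^bsub>C\<^esub> b) \<boxtimes>\<^bsub>C\<^esub> c) \<boxtimes>\<^bsub>C\<^esub> d) (a \<boxtimes>\<^bsub>C\<^esub> ((b \<boxtimes>\<^bsub>C\<^esub> c) \<boxtimes>\<^bsub>C\<^esub> d))"
      using o by (intro comp_in_hom[OF tensor_in_hom[OF associator_in_hom ide_in_hom] associator_in_hom] t)
    have 3: "inverse_arrows C ((Ide C a \<boxdot>\<^bsub>C\<^esub> ?A b c d) \<cdot>\<^bsub>C\<^esub> ?A a (b \<boxtimes>\<^bsub>C\<^esub> c) d \<cdot>\<^bsub>C\<^esub> (?A a b c \<boxdot>\<^bsub>C\<^esub> Ide C d))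
        (((?I (?A a b c) \<boxdot>\<^bsub>C\<^esub> Ide C d) \<cdot>\<^bsub>C\<^esub> ?I (?A a (b \<boxtimes>\<^bsub>C\<^esub> c) d)) \<cdot>\<^bsub>C\<^esub> (Ide C a \<boxdot>\<^bsub>C\<^esub> ?I (?A b c d)))"
      using o by (intro inverse_arrows_comp[OF h2 2 tensor_in_hom[OF ide_in_hom associator_in_hom]
            inverse_arrows_tensor[OF ide_in_hom inverse_arrows_ide associator_in_hom inv]])
    show "?I (?A (a \<boxtimes>\<^bsub>C\<^esub> b) c d) \<cdot>\<^bsub>C\<^esub> ?I (?A a b (c \<boxtimes>\<^bsub>C\<^esub> d)) =
        ((?I (?A a b c) \<boxdot>\<^bsub>C\<^esub> Ide C d) \<cdot>\<^bsub>C\<^esub> ?I (?A a (b \<boxtimes>\<^bsub>C\<^esub> c) d)) \<cdot>\<^bsub>C\<^esub> (Ide C a \<boxdot>\<^bsub>C\<^esub> ?I (?A b c d))"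
      using inverse_arrows_unique[OF 1] 3 pentagon[OF o] by simp
  next
    fix a b assume o: "a \<in> Obj C" "b \<in> Obj C"
    let ?A = "associator C" and ?I = "inverse_arrow C"
    \<comment> \<open>Likewise \<open>1\<close> and \<open>2\<close> invert the two sides of the
      triangle.\<close>
    have 1: "inverse_arrows C (right_unitor C a \<boxdot>\<^bsub>C\<^esub> Ide C b) (?I (right_unitor C a) \<boxdot>\<^bsub>C\<^esub> Ide C b)"
      using o by (intro inverse_arrows_tensor[OF right_unitor_in_hom inverse_arrow[OF right_unitor_iso]
            ide_in_hom inverse_arrows_ide])
    have 2: "inverse_arrows C ((Ide C a \<boxdot>\<^bsub>C\<^esub> left_unitor C b) \<cdot>\<^bsub>C\<^esub> ?A a (unit C) b)
        (?I (?A a (unit C) b) \<cdot>\<^bsub>C\<^esub> (Ide C a \<boxdot>\<^bsub>C\<^esub> ?I (left_unitor C b)))"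
      using o unit_obj
      by (intro inverse_arrows_comp[OF associator_in_hom inverse_arrow[OF associator_iso]
            tensor_in_hom[OF ide_in_hom left_unitor_in_hom]
            inverse_arrows_tensor[OF ide_in_hom inverse_arrows_ide left_unitor_in_hom inverse_arrow[OF left_unitor_iso]]])
    show "?I (?A a (unit C) b) \<cdot>\<^bsub>C\<^esub> (Ide C a \<boxdot>\<^bsub>C\<^esub> ?I (left_unitor C b)) =
        ?I (right_unitor C a) \<boxdot>\<^bsub>C\<^esub> Ide C b"
      using inverse_arrows_unique[OF 1] 2 triangle[OF o] by simp
  qed (auto simp: comp_ide ide_comp tensor_obj unit_obj tensor_ide inv_iso associator_iso
      left_unitor_iso right_unitor_iso dom_cod
      intro: ide_in_hom comp_in_hom comp_assoc[symmetric] tensor_in_hom tensor_comp)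
qed

section \<open>The monoidal category of interconnections\<close>

lemma SSub_int_simps [simp]:
  "Obj SSub_int = {a. is_ssub a}" "Arr SSub_int = {f. interconnection f}"
  "Dom SSub_int = source" "Cod SSub_int = target" "Ide SSub_int a = mk_ssub_arrow a a id id"
  "g \<cdot>\<^bsub>SSub_int\<^esub> f = mk_ssub_arrow (source f) (target g) (tot_map g \<circ> tot_map f) (st_map g \<circ> st_map f)"
  "a \<boxtimes>\<^bsub>SSub_int\<^esub> b = ssub_prod a b"
  "f \<boxdot>\<^bsub>SSub_int\<^esub> g = mk_ssub_arrow
     (ssub_prod (source f) (source g)) (ssub_prod (target f) (target g))
     (tup_map (tot_map f) (tot_map g)) (tup_map (st_map f) (st_map g))"
  "unit SSub_int = ssub_unit"
  "associator SSub_int a b c = mk_ssub_arrow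
     (ssub_prod (ssub_prod a b) c) (ssub_prod a (ssub_prod b c)) tup_assoc tup_assoc"
  "left_unitor SSub_int a = mk_ssub_arrow (ssub_prod ssub_unit a) a tsnd tsnd"
  "right_unitor SSub_int a = mk_ssub_arrow (ssub_prod a ssub_unit) a tfst tfst"
  by (simp_all add: SSub_int_def SSub_def)

lemma mk_ssub_arrow_simps [simp]:
  "source (mk_ssub_arrow a b f g) = a" "target (mk_ssub_arrow a b f g) = b"
  "action (mk_ssub_arrow a b f g) = (restrict f (points (total a)), restrict g (points (state a)))"
  by (simp_all add: mk_ssub_arrow_def)

text \<open>Both functions are restricted to points, so equality of arrows is pointwise; the laws of
  the monoidal category thereby become computations with \<open>Tup\<close>.\<close>

lemma mk_ssub_arrow_cong:
  assumes "\<And>q. q \<in> points (total a) \<Longrightarrow> f q = f' q" "\<And>p. p \<in> points (state a) \<Longrightarrow> g p = g' p"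
  shows "mk_ssub_arrow a b f g = mk_ssub_arrow a b f' g'"
  unfolding mk_ssub_arrow_def using assms by (auto cong: restrict_cong)

lemma is_ssubD:
  assumes "is_ssub a"
  shows "atlas_manifold (total a)" "atlas_manifold (state a)"
    "smooth_map (total a) (state a) (subm a)" "surjective_submersion (total a) (state a) (subm a)"
    "subm a \<in> extensional (points (total a))"
  using assms by (auto simp: is_ssub_def surjective_submersion_def smooth_imp_atlas_manifold)

lemma subm_points: "is_ssub a \<Longrightarrow> q \<in> points (total a) \<Longrightarrow> subm a q \<in> points (state a)"
  by (rule smooth_map_points[OF is_ssubD(3)])

lemma ssub_prod_simps [simp]:
  "total (ssub_prod a b) = prod_manifold (total a) (total b)"
  "state (ssub_prod a b) = prod_manifold (state a) (state b)"
  "x \<in> points (total a) \<Longrightarrow> y \<in> points (total b) \<Longrightarrow>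
    subm (ssub_prod a b) (Tup x y) = Tup (subm a x) (subm b y)"
  by (simp_all add: ssub_prod_def)

lemma ssub_unit_simps [simp]:
  "total ssub_unit = point_manifold" "state ssub_unit = point_manifold" "subm ssub_unit Pt = Pt"
  by (simp_all add: ssub_unit_def)

lemma is_ssub_prod:
  assumes a: "is_ssub a" and b: "is_ssub b" shows "is_ssub (ssub_prod a b)"
proof -
  have "smooth_manifold (total (ssub_prod a b))" "smooth_manifold (state (ssub_prod a b))"
    using a b by (simp_all add: is_ssub_def smooth_manifold_prod)
  moreover have "surjective_submersion (total (ssub_prod a b)) (state (ssub_prod a b)) (subm (ssub_prod a b))"
    unfolding ssub_prod_def ssub.simps
    by (rule surjective_submersion_prod[OF is_ssubD(1)[OF a] is_ssubD(1)[OF b] is_ssubD(2)[OF a]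
          is_ssubD(2)[OF b] is_ssubD(4)[OF a] is_ssubD(4)[OF b]])
  moreover have "subm (ssub_prod a b) \<in> extensional (points (total (ssub_prod a b)))"
    by (simp add: ssub_prod_def)
  ultimately show ?thesis by (simp add: is_ssub_def)
qed

lemma is_ssub_unit: "is_ssub ssub_unit"
  using point_manifold surjective_submersion_point
  by (simp add: is_ssub_def ssub_unit_def)

lemma interconnection_iff:
  "interconnection f \<longleftrightarrow> is_ssub_arrow f \<and>
    (\<exists>g. smooth_map (state (target f)) (state (source f)) g \<and>
      (\<forall>p\<in>points (state (source f)). g (st_map f p) = p) \<and>
      (\<forall>p\<in>points (state (target f)). st_map f (g p) = p))"
proof (cases "is_ssub_arrow f")
  case True
  then have "atlas_manifold (state (source f))" "atlas_manifold (state (target f))"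
    "smooth_map (state (source f)) (state (target f)) (st_map f)"
    using is_ssubD by (auto simp: is_ssub_arrow_def Let_def)
  then show ?thesis using True by (simp add: interconnection_def diffeomorphism_iff)
qed (simp add: interconnection_def)

lemma ssub_arrowD:
  assumes "is_ssub_arrow f"
  shows "is_ssub (source f)" "is_ssub (target f)"
    "tot_map f \<in> extensional (points (total (source f)))"
    "st_map f \<in> extensional (points (state (source f)))"
    "smooth_map (total (source f)) (total (target f)) (tot_map f)"
    "smooth_map (state (source f)) (state (target f)) (st_map f)"
    "\<And>q. q \<in> points (total (source f)) \<Longrightarrow> subm (target f) (tot_map f q) = st_map f (subm (source f) q)"
  using assms by (auto simp: is_ssub_arrow_def Let_def)

text \<open>Builds an arrow from unrestricted functions and a smooth inverse on the state spaces, so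
  that the restrictions made by \<open>mk_ssub_arrow\<close> have to be handled only here.\<close>

lemma interconnection_mk:
  assumes a: "is_ssub a" and b: "is_ssub b"
    and f: "smooth_map (total a) (total b) f" and g: "smooth_map (state a) (state b) g"
    and comm: "\<And>q. q \<in> points (total a) \<Longrightarrow> subm b (f q) = g (subm a q)"
    and g': "smooth_map (state b) (state a) g'"
      "\<And>p. p \<in> points (state a) \<Longrightarrow> g' (g p) = p" "\<And>p. p \<in> points (state b) \<Longrightarrow> g (g' p) = p"
  shows "interconnection (mk_ssub_arrow a b f g)"
proof -
  note A = is_ssubD[OF a] and B = is_ssubD[OF b]
  have "smooth_map (total a) (total b) (restrict f (points (total a)))"
    by (rule smooth_map_cong[OF A(1) B(1) f]) simp
  moreover have "smooth_map (state a) (state b) (restrict g (points (state a)))"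
    by (rule smooth_map_cong[OF A(2) B(2) g]) simp
  ultimately have "is_ssub_arrow (mk_ssub_arrow a b f g)"
    using a b comm subm_points[OF a] by (simp add: is_ssub_arrow_def Let_def)
  then show ?thesis
    unfolding interconnection_iff using g' smooth_map_points[OF g'(1)] by auto
qed

lemma interconnection_E:
  assumes "interconnection f"
  obtains g where "smooth_map (state (target f)) (state (source f)) g"
      "\<And>p. p \<in> points (state (source f)) \<Longrightarrow> g (st_map f p) = p"
      "\<And>p. p \<in> points (state (target f)) \<Longrightarrow> st_map f (g p) = p"
  using assms unfolding interconnection_iff by blast

lemma interconnection_ssub_arrow: "interconnection f \<Longrightarrow> is_ssub_arrow f"
  by (simp add: interconnection_def)

lemma interconnection_eta:
  assumes "interconnection f"
  shows "mk_ssub_arrow (source f) (target f) (tot_map f) (st_map f) = f"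
  using ssub_arrowD(3,4)[OF interconnection_ssub_arrow[OF assms]]
  by (simp add: mk_ssub_arrow_def extensional_restrict)

lemma hom_SSub_int: "f \<in> hom_set SSub_int a b \<longleftrightarrow> interconnection f \<and> source f = a \<and> target f = b"
  by (simp add: hom_set_def)

lemma interconnection_points:
  assumes "interconnection f"
  shows "q \<in> points (total (source f)) \<Longrightarrow> tot_map f q \<in> points (total (target f))"
    and "p \<in> points (state (source f)) \<Longrightarrow> st_map f p \<in> points (state (target f))"
  using ssub_arrowD(5,6)[OF interconnection_ssub_arrow[OF assms]] by (auto dest: smooth_map_points)

lemma interconnection_comp:
  assumes f: "interconnection f" and g: "interconnection g" and fg: "source g = target f"
  shows "interconnection (mk_ssub_arrow (source f) (target g) (tot_map g \<circ> tot_map f) (st_map g \<circ> st_map f))"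
proof -
  note F = ssub_arrowD[OF interconnection_ssub_arrow[OF f]]
  note G = ssub_arrowD[OF interconnection_ssub_arrow[OF g], unfolded fg]
  note a = is_ssubD[OF F(1)] and b = is_ssubD[OF F(2)] and c = is_ssubD[OF G(2)]
  obtain f' where f': "smooth_map (state (target f)) (state (source f)) f'"
      "\<And>p. p \<in> points (state (source f)) \<Longrightarrow> f' (st_map f p) = p"
      "\<And>p. p \<in> points (state (target f)) \<Longrightarrow> st_map f (f' p) = p"
    using interconnection_E[OF f] by blast
  obtain g' where g': "smooth_map (state (target g)) (state (target f)) g'"
      "\<And>p. p \<in> points (state (target f)) \<Longrightarrow> g' (st_map g p) = p"
      "\<And>p. p \<in> points (state (target g)) \<Longrightarrow> st_map g (g' p) = p"
    using interconnection_E[OF g] unfolding fg by blast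
  show ?thesis
  proof (rule interconnection_mk[OF F(1) G(2) smooth_map_compose[OF a(1) b(1) c(1) F(5) G(5)]
        smooth_map_compose[OF a(2) b(2) c(2) F(6) G(6)] _ smooth_map_compose[OF c(2) b(2) a(2) g'(1) f'(1)]])
    show "subm (target g) ((tot_map g \<circ> tot_map f) q) = (st_map g \<circ> st_map f) (subm (source f) q)"
      if "q \<in> points (total (source f))" for q
      using F(7)[OF that] G(7)[OF smooth_map_points[OF F(5) that]] by simp
    show "(f' \<circ> g') ((st_map g \<circ> st_map f) p) = p" if "p \<in> points (state (source f))" for p
      using f'(2)[OF that] g'(2)[OF smooth_map_points[OF F(6) that]] by simp
    show "(st_map g \<circ> st_map f) ((f' \<circ> g') p) = p" if "p \<in> points (state (target g))" for p
      using g'(3)[OF that] f'(3)[OF smooth_map_points[OF g'(1) that]] by simp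
  qed
qed

lemma interconnection_id: "is_ssub a \<Longrightarrow> interconnection (mk_ssub_arrow a a id id)"
  using smooth_map_id[OF is_ssubD(1), of a] smooth_map_id[OF is_ssubD(2), of a]
  by (intro interconnection_mk[where g' = id]) (auto simp: id_def)

lemma interconnection_tensor:
  assumes f: "interconnection f" and g: "interconnection g"
  shows "interconnection (mk_ssub_arrow (ssub_prod (source f) (source g)) (ssub_prod (target f) (target g))
     (tup_map (tot_map f) (tot_map g)) (tup_map (st_map f) (st_map g)))"
proof -
  note F = ssub_arrowD[OF interconnection_ssub_arrow[OF f]]
  note G = ssub_arrowD[OF interconnection_ssub_arrow[OF g]]
  note fa = is_ssubD[OF F(1)] and fb = is_ssubD[OF F(2)] and ga = is_ssubD[OF G(1)] and gb = is_ssubD[OF G(2)]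
  obtain f' where f': "smooth_map (state (target f)) (state (source f)) f'"
      "\<And>p. p \<in> points (state (source f)) \<Longrightarrow> f' (st_map f p) = p"
      "\<And>p. p \<in> points (state (target f)) \<Longrightarrow> st_map f (f' p) = p"
    using interconnection_E[OF f] by blast
  obtain g' where g': "smooth_map (state (target g)) (state (source g)) g'"
      "\<And>p. p \<in> points (state (source g)) \<Longrightarrow> g' (st_map g p) = p"
      "\<And>p. p \<in> points (state (target g)) \<Longrightarrow> st_map g (g' p) = p"
    using interconnection_E[OF g] by blast
  show ?thesis
  proof (rule interconnection_mk[OF is_ssub_prod[OF F(1) G(1)] is_ssub_prod[OF F(2) G(2)],
        where g' = "tup_map f' g'"]; (simp only: ssub_prod_simps)?)
    show "smooth_map (prod_manifold (total (source f)) (total (source g)))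
        (prod_manifold (total (target f)) (total (target g))) (tup_map (tot_map f) (tot_map g))"
      by (rule smooth_tup_map[OF fa(1) ga(1) fb(1) gb(1) F(5) G(5)])
    show "smooth_map (prod_manifold (state (source f)) (state (source g)))
        (prod_manifold (state (target f)) (state (target g))) (tup_map (st_map f) (st_map g))"
      by (rule smooth_tup_map[OF fa(2) ga(2) fb(2) gb(2) F(6) G(6)])
    show "smooth_map (prod_manifold (state (target f)) (state (target g)))
        (prod_manifold (state (source f)) (state (source g))) (tup_map f' g')"
      by (rule smooth_tup_map[OF fb(2) gb(2) fa(2) ga(2) f'(1) g'(1)])
  qed (auto elim!: tup_timesE simp: F(7) G(7) f' g' smooth_map_points[OF F(5)] smooth_map_points[OF G(5)])
qed

section \<open>Associator and unitors with explicit inverses\<close>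

lemma inverse_arrows_mk:
  assumes a: "is_ssub a" and b: "is_ssub b"
    and f: "smooth_map (total a) (total b) f" and g: "smooth_map (state a) (state b) g"
    and comm: "\<And>q. q \<in> points (total a) \<Longrightarrow> subm b (f q) = g (subm a q)"
    and g': "smooth_map (state b) (state a) g'"
      "\<And>p. p \<in> points (state a) \<Longrightarrow> g' (g p) = p" "\<And>p. p \<in> points (state b) \<Longrightarrow> g (g' p) = p"
    and f': "smooth_map (total b) (total a) f'"
      "\<And>p. p \<in> points (total a) \<Longrightarrow> f' (f p) = p" "\<And>p. p \<in> points (total b) \<Longrightarrow> f (f' p) = p"
  shows "interconnection (mk_ssub_arrow a b f g)" "interconnection (mk_ssub_arrow b a f' g')"
    "inverse_arrows SSub_int (mk_ssub_arrow a b f g) (mk_ssub_arrow b a f' g')"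
proof -
  show 1: "interconnection (mk_ssub_arrow a b f g)"
    using assms by (intro interconnection_mk)
  \<comment> \<open>The inverse pair commutes with the submersions automatically: apply
    \<open>g'\<close> to the equation \<open>comm\<close> at the point \<open>f' q\<close>.\<close>
  have comm': "subm a (f' q) = g' (subm b q)" if q: "q \<in> points (total b)" for q
    using comm[OF smooth_map_points[OF f'(1) q]] f'(3)[OF q]
      g'(2)[OF subm_points[OF a smooth_map_points[OF f'(1) q]]] by simp
  show 2: "interconnection (mk_ssub_arrow b a f' g')"
    using assms comm' by (intro interconnection_mk[OF b a f'(1) g'(1) _ g])
  show "inverse_arrows SSub_int (mk_ssub_arrow a b f g) (mk_ssub_arrow b a f' g')"
    using 1 2 smooth_map_points[OF f] smooth_map_points[OF g] smooth_map_points[OF f'(1)]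
      smooth_map_points[OF g'(1)] f' g'
    by (auto simp: inverse_arrows_def hom_SSub_int intro!: mk_ssub_arrow_cong)
qed

text \<open>The inverse of \<open>tup_assoc\<close>, hence the map underlying the associator of the
  opposite category.\<close>

definition tup_unassoc :: "'a tup \<Rightarrow> 'a tup" where
  "tup_unassoc z = Tup (Tup (tfst z) (tfst (tsnd z))) (tsnd (tsnd z))"

lemma tup_unassoc_Tup [simp]: "tup_unassoc (Tup x (Tup y z)) = Tup (Tup x y) z"
  by (simp add: tup_unassoc_def)

lemma smooth_tup_assoc:
  assumes M: "atlas_manifold M" and N: "atlas_manifold N" and P: "atlas_manifold P"
  shows "smooth_map (prod_manifold (prod_manifold M N) P) (prod_manifold M (prod_manifold N P)) tup_assoc"
    and "smooth_map (prod_manifold M (prod_manifold N P)) (prod_manifold (prod_manifold M N) P) tup_unassoc"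
proof -
  note MN = atlas_prod[OF M N] and NP = atlas_prod[OF N P]
  note L = atlas_prod[OF MN P] and R = atlas_prod[OF M NP]
  note l1 = smooth_tfst[OF MN P] and l2 = smooth_tsnd[OF MN P]
  note r1 = smooth_tfst[OF M NP] and r2 = smooth_tsnd[OF M NP]
  have "smooth_map (prod_manifold (prod_manifold M N) P) (prod_manifold M (prod_manifold N P))
      (\<lambda>z. Tup ((tfst \<circ> tfst) z) (Tup ((tsnd \<circ> tfst) z) (tsnd z)))"
    by (intro smooth_Tup[OF M NP L smooth_map_compose[OF L MN M l1 smooth_tfst[OF M N]]]
        smooth_Tup[OF N P L smooth_map_compose[OF L MN N l1 smooth_tsnd[OF M N]] l2])
  then show "smooth_map (prod_manifold (prod_manifold M N) P) (prod_manifold M (prod_manifold N P)) tup_assoc"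
    unfolding tup_assoc_def[abs_def] by (simp only: comp_apply)
  have "smooth_map (prod_manifold M (prod_manifold N P)) (prod_manifold (prod_manifold M N) P)
      (\<lambda>z. Tup (Tup (tfst z) ((tfst \<circ> tsnd) z)) ((tsnd \<circ> tsnd) z))"
    by (intro smooth_Tup[OF MN P R _ smooth_map_compose[OF R NP P r2 smooth_tsnd[OF N P]]]
        smooth_Tup[OF M N R r1 smooth_map_compose[OF R NP N r2 smooth_tfst[OF N P]]])
  then show "smooth_map (prod_manifold M (prod_manifold N P)) (prod_manifold (prod_manifold M N) P) tup_unassoc"
    unfolding tup_unassoc_def[abs_def] by (simp only: comp_apply)
qed

text \<open>The last claim gives a value to \<open>inverse_arrow\<close> of the associator, along
  which systems are pulled back in the associativity law.\<close>

lemma ssub_associator: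
  assumes "is_ssub a" "is_ssub b" "is_ssub c"
  defines "s \<equiv> ssub_prod (ssub_prod a b) c" and "t \<equiv> ssub_prod a (ssub_prod b c)"
  shows "interconnection (mk_ssub_arrow s t tup_assoc tup_assoc)"
    "interconnection (mk_ssub_arrow t s tup_unassoc tup_unassoc)"
    "inverse_arrows SSub_int (mk_ssub_arrow s t tup_assoc tup_assoc) (mk_ssub_arrow t s tup_unassoc tup_unassoc)"
proof -
  note A = is_ssubD[OF assms(1)] and B = is_ssubD[OF assms(2)] and C = is_ssubD[OF assms(3)]
  have s: "is_ssub s" and t: "is_ssub t" using assms by (auto intro: is_ssub_prod)
  note T = smooth_tup_assoc[OF A(1) B(1) C(1)] and S = smooth_tup_assoc[OF A(2) B(2) C(2)]
  have *: "smooth_map (total s) (total t) tup_assoc" "smooth_map (state s) (state t) tup_assoc"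
    "\<And>q. q \<in> points (total s) \<Longrightarrow> subm t (tup_assoc q) = tup_assoc (subm s q)"
    "smooth_map (state t) (state s) tup_unassoc"
    "\<And>p. p \<in> points (state s) \<Longrightarrow> tup_unassoc (tup_assoc p) = p"
    "\<And>p. p \<in> points (state t) \<Longrightarrow> tup_assoc (tup_unassoc p) = p"
    "smooth_map (total t) (total s) tup_unassoc"
    "\<And>p. p \<in> points (total s) \<Longrightarrow> tup_unassoc (tup_assoc p) = p"
    "\<And>p. p \<in> points (total t) \<Longrightarrow> tup_assoc (tup_unassoc p) = p"
    using S T by (auto simp: s_def t_def elim!: tup_timesE)
  from inverse_arrows_mk[OF s t *]
  show "interconnection (mk_ssub_arrow s t tup_assoc tup_assoc)"
    "interconnection (mk_ssub_arrow t s tup_unassoc tup_unassoc)"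
    "inverse_arrows SSub_int (mk_ssub_arrow s t tup_assoc tup_assoc) (mk_ssub_arrow t s tup_unassoc tup_unassoc)"
    by blast+
qed

lemma ssub_left_unitor:
  assumes a: "is_ssub a"
  defines "s \<equiv> ssub_prod ssub_unit a"
  shows "interconnection (mk_ssub_arrow s a tsnd tsnd)" "interconnection (mk_ssub_arrow a s (Tup Pt) (Tup Pt))"
    "inverse_arrows SSub_int (mk_ssub_arrow s a tsnd tsnd) (mk_ssub_arrow a s (Tup Pt) (Tup Pt))"
proof -
  note A = is_ssubD[OF a] and P = smooth_imp_atlas_manifold[OF point_manifold]
  have s: "is_ssub s" using a by (auto simp: s_def intro: is_ssub_prod is_ssub_unit)
  have *: "smooth_map (total s) (total a) tsnd" "smooth_map (state s) (state a) tsnd"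
    "\<And>q. q \<in> points (total s) \<Longrightarrow> subm a (tsnd q) = tsnd (subm s q)"
    "smooth_map (state a) (state s) (Tup Pt)"
    "\<And>p. p \<in> points (state s) \<Longrightarrow> Tup Pt (tsnd p) = p"
    "\<And>p. p \<in> points (state a) \<Longrightarrow> tsnd (Tup Pt p) = p"
    "smooth_map (total a) (total s) (Tup Pt)"
    "\<And>p. p \<in> points (total s) \<Longrightarrow> Tup Pt (tsnd p) = p"
    "\<And>p. p \<in> points (total a) \<Longrightarrow> tsnd (Tup Pt p) = p"
    using smooth_tsnd[OF P A(1)] smooth_tsnd[OF P A(2)]
      smooth_Tup[OF P A(1) A(1) smooth_map_point[OF A(1)] smooth_map_id[OF A(1)]]
      smooth_Tup[OF P A(2) A(2) smooth_map_point[OF A(2)] smooth_map_id[OF A(2)]]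
    by (auto simp: s_def elim!: tup_timesE)
  from inverse_arrows_mk[OF s a *]
  show "interconnection (mk_ssub_arrow s a tsnd tsnd)" "interconnection (mk_ssub_arrow a s (Tup Pt) (Tup Pt))"
    "inverse_arrows SSub_int (mk_ssub_arrow s a tsnd tsnd) (mk_ssub_arrow a s (Tup Pt) (Tup Pt))"
    by blast+
qed

lemma ssub_right_unitor:
  assumes a: "is_ssub a"
  defines "s \<equiv> ssub_prod a ssub_unit"
  shows "interconnection (mk_ssub_arrow s a tfst tfst)"
    "interconnection (mk_ssub_arrow a s (\<lambda>x. Tup x Pt) (\<lambda>x. Tup x Pt))"
    "inverse_arrows SSub_int (mk_ssub_arrow s a tfst tfst) (mk_ssub_arrow a s (\<lambda>x. Tup x Pt) (\<lambda>x. Tup x Pt))"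
proof -
  note A = is_ssubD[OF a] and P = smooth_imp_atlas_manifold[OF point_manifold]
  have s: "is_ssub s" using a by (auto simp: s_def intro: is_ssub_prod is_ssub_unit)
  have *: "smooth_map (total s) (total a) tfst" "smooth_map (state s) (state a) tfst"
    "\<And>q. q \<in> points (total s) \<Longrightarrow> subm a (tfst q) = tfst (subm s q)"
    "smooth_map (state a) (state s) (\<lambda>x. Tup x Pt)"
    "\<And>p. p \<in> points (state s) \<Longrightarrow> Tup (tfst p) Pt = p"
    "\<And>p. p \<in> points (state a) \<Longrightarrow> tfst (Tup p Pt) = p"
    "smooth_map (total a) (total s) (\<lambda>x. Tup x Pt)"
    "\<And>p. p \<in> points (total s) \<Longrightarrow> Tup (tfst p) Pt = p"
    "\<And>p. p \<in> points (total a) \<Longrightarrow> tfst (Tup p Pt) = p"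
    using smooth_tfst[OF A(1) P] smooth_tfst[OF A(2) P]
      smooth_Tup[OF A(1) P A(1) smooth_map_id[OF A(1)] smooth_map_point[OF A(1)]]
      smooth_Tup[OF A(2) P A(2) smooth_map_id[OF A(2)] smooth_map_point[OF A(2)]]
    by (auto simp: s_def elim!: tup_timesE)
  from inverse_arrows_mk[OF s a *]
  show "interconnection (mk_ssub_arrow s a tfst tfst)"
    "interconnection (mk_ssub_arrow a s (\<lambda>x. Tup x Pt) (\<lambda>x. Tup x Pt))"
    "inverse_arrows SSub_int (mk_ssub_arrow s a tfst tfst) (mk_ssub_arrow a s (\<lambda>x. Tup x Pt) (\<lambda>x. Tup x Pt))"
    by blast+
qed

lemma monoidal_category_SSub_int: "monoidal_category SSub_int"
proof (intro monoidal_category.intro category.intro monoidal_category_axioms.intro)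
  note simps = hom_SSub_int
  show "Dom SSub_int f \<in> Obj SSub_int \<and> Cod SSub_int f \<in> Obj SSub_int" if "f \<in> Arr SSub_int" for f
    using that ssub_arrowD(1,2)[OF interconnection_ssub_arrow, of f] by simp
  show "Ide SSub_int a \<in> hom_set SSub_int a a" if "a \<in> Obj SSub_int" for a
    using that interconnection_id by (simp add: simps)
  show "g \<cdot>\<^bsub>SSub_int\<^esub> f \<in> hom_set SSub_int a c"
    if "f \<in> hom_set SSub_int a b" "g \<in> hom_set SSub_int b c" for f g a b c
    using that interconnection_comp[of f g] by (simp add: simps)
  show "f \<cdot>\<^bsub>SSub_int\<^esub> Ide SSub_int a = f" "Ide SSub_int b \<cdot>\<^bsub>SSub_int\<^esub> f = f"
    if f: "f \<in> hom_set SSub_int a b" for f a b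
  proof -
    have f': "interconnection f" "source f = a" "target f = b" using f by (auto simp: simps)
    note eta = interconnection_eta[OF f'(1), unfolded f'(2,3)]
    have "f \<cdot>\<^bsub>SSub_int\<^esub> Ide SSub_int a = mk_ssub_arrow a b (tot_map f) (st_map f)"
      using f' by (auto intro!: mk_ssub_arrow_cong)
    then show "f \<cdot>\<^bsub>SSub_int\<^esub> Ide SSub_int a = f" unfolding eta .
    have "Ide SSub_int b \<cdot>\<^bsub>SSub_int\<^esub> f = mk_ssub_arrow a b (tot_map f) (st_map f)"
      using f' interconnection_points[OF f'(1)] by (auto intro!: mk_ssub_arrow_cong)
    then show "Ide SSub_int b \<cdot>\<^bsub>SSub_int\<^esub> f = f" unfolding eta .
  qed
  show "(h \<cdot>\<^bsub>SSub_int\<^esub> g) \<cdot>\<^bsub>SSub_int\<^esub> f = h \<cdot>\<^bsub>SSub_int\<^esub> (g \<cdot>\<^bsub>SSub_int\<^esub> f)"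
    if "f \<in> hom_set SSub_int a b" "g \<in> hom_set SSub_int b c" "h \<in> hom_set SSub_int c d" for f g h a b c d
    using that interconnection_points[of f] by (auto simp: simps intro!: mk_ssub_arrow_cong)
  show "a \<boxtimes>\<^bsub>SSub_int\<^esub> b \<in> Obj SSub_int" if "a \<in> Obj SSub_int" "b \<in> Obj SSub_int" for a b
    using that by (simp add: is_ssub_prod)
  show "f \<boxdot>\<^bsub>SSub_int\<^esub> g \<in> hom_set SSub_int (a \<boxtimes>\<^bsub>SSub_int\<^esub> b) (a' \<boxtimes>\<^bsub>SSub_int\<^esub> b')"
    if "f \<in> hom_set SSub_int a a'" "g \<in> hom_set SSub_int b b'" for f g a b a' b'
    using that interconnection_tensor[of f g] by (simp add: simps)
  show "Ide SSub_int a \<boxdot>\<^bsub>SSub_int\<^esub> Ide SSub_int b = Ide SSub_int (a \<boxtimes>\<^bsub>SSub_int\<^esub> b)"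
    if "a \<in> Obj SSub_int" "b \<in> Obj SSub_int" for a b
    using that by (auto intro!: mk_ssub_arrow_cong elim!: tup_timesE)
  show "(f' \<cdot>\<^bsub>SSub_int\<^esub> f) \<boxdot>\<^bsub>SSub_int\<^esub> (g' \<cdot>\<^bsub>SSub_int\<^esub> g) =
      (f' \<boxdot>\<^bsub>SSub_int\<^esub> g') \<cdot>\<^bsub>SSub_int\<^esub> (f \<boxdot>\<^bsub>SSub_int\<^esub> g)"
    if "f \<in> hom_set SSub_int a a'" "f' \<in> hom_set SSub_int a' a''"
      "g \<in> hom_set SSub_int b b'" "g' \<in> hom_set SSub_int b' b''" for f f' g g' a a' a'' b b' b''
    using that interconnection_points[of f] interconnection_points[of g]
    by (auto simp: simps intro!: mk_ssub_arrow_cong elim!: tup_timesE)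
  show "unit SSub_int \<in> Obj SSub_int" by (simp add: is_ssub_unit)
  show "associator SSub_int a b c \<in> hom_set SSub_int ((a \<boxtimes>\<^bsub>SSub_int\<^esub> b) \<boxtimes>\<^bsub>SSub_int\<^esub> c) (a \<boxtimes>\<^bsub>SSub_int\<^esub> (b \<boxtimes>\<^bsub>SSub_int\<^esub> c))"
    "iso_arrow SSub_int (associator SSub_int a b c)"
    if "a \<in> Obj SSub_int" "b \<in> Obj SSub_int" "c \<in> Obj SSub_int" for a b c
    using ssub_associator[of a b c] that by (auto simp: simps iso_arrow_def)
  show "associator SSub_int a' b' c' \<cdot>\<^bsub>SSub_int\<^esub> ((f \<boxdot>\<^bsub>SSub_int\<^esub> g) \<boxdot>\<^bsub>SSub_int\<^esub> h) =
      (f \<boxdot>\<^bsub>SSub_int\<^esub> (g \<boxdot>\<^bsub>SSub_int\<^esub> h)) \<cdot>\<^bsub>SSub_int\<^esub> associator SSub_int a b c"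
    if "f \<in> hom_set SSub_int a a'" "g \<in> hom_set SSub_int b b'" "h \<in> hom_set SSub_int c c'"
    for f g h a b c a' b' c'
    using that interconnection_points[of f] interconnection_points[of g] interconnection_points[of h]
    by (auto simp: simps intro!: mk_ssub_arrow_cong elim!: tup_timesE)
  show "left_unitor SSub_int a \<in> hom_set SSub_int (unit SSub_int \<boxtimes>\<^bsub>SSub_int\<^esub> a) a"
    "iso_arrow SSub_int (left_unitor SSub_int a)" if "a \<in> Obj SSub_int" for a
    using ssub_left_unitor[of a] that by (auto simp: simps iso_arrow_def)
  show "left_unitor SSub_int a' \<cdot>\<^bsub>SSub_int\<^esub> (Ide SSub_int (unit SSub_int) \<boxdot>\<^bsub>SSub_int\<^esub> f) =
      f \<cdot>\<^bsub>SSub_int\<^esub> left_unitor SSub_int a" if "f \<in> hom_set SSub_int a a'" for f a a'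
    using that interconnection_points[of f]
    by (auto simp: simps intro!: mk_ssub_arrow_cong elim!: tup_timesE)
  show "right_unitor SSub_int a \<in> hom_set SSub_int (a \<boxtimes>\<^bsub>SSub_int\<^esub> unit SSub_int) a"
    "iso_arrow SSub_int (right_unitor SSub_int a)" if "a \<in> Obj SSub_int" for a
    using ssub_right_unitor[of a] that by (auto simp: simps iso_arrow_def)
  show "right_unitor SSub_int a' \<cdot>\<^bsub>SSub_int\<^esub> (f \<boxdot>\<^bsub>SSub_int\<^esub> Ide SSub_int (unit SSub_int)) =
      f \<cdot>\<^bsub>SSub_int\<^esub> right_unitor SSub_int a" if "f \<in> hom_set SSub_int a a'" for f a a'
    using that interconnection_points[of f]
    by (auto simp: simps intro!: mk_ssub_arrow_cong elim!: tup_timesE)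
  show "associator SSub_int a b (c \<boxtimes>\<^bsub>SSub_int\<^esub> d) \<cdot>\<^bsub>SSub_int\<^esub> associator SSub_int (a \<boxtimes>\<^bsub>SSub_int\<^esub> b) c d =
      (Ide SSub_int a \<boxdot>\<^bsub>SSub_int\<^esub> associator SSub_int b c d) \<cdot>\<^bsub>SSub_int\<^esub>
      associator SSub_int a (b \<boxtimes>\<^bsub>SSub_int\<^esub> c) d \<cdot>\<^bsub>SSub_int\<^esub>
      (associator SSub_int a b c \<boxdot>\<^bsub>SSub_int\<^esub> Ide SSub_int d)"
    if "a \<in> Obj SSub_int" "b \<in> Obj SSub_int" "c \<in> Obj SSub_int" "d \<in> Obj SSub_int" for a b c d
    by (auto intro!: mk_ssub_arrow_cong elim!: tup_timesE)
  show "(Ide SSub_int a \<boxdot>\<^bsub>SSub_int\<^esub> left_unitor SSub_int b) \<cdot>\<^bsub>SSub_int\<^esub> associator SSub_int a (unit SSub_int) b =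
      right_unitor SSub_int a \<boxdot>\<^bsub>SSub_int\<^esub> Ide SSub_int b"
    if "a \<in> Obj SSub_int" "b \<in> Obj SSub_int" for a b
    by (auto intro!: mk_ssub_arrow_cong elim!: tup_timesE)
qed

section \<open>The monoidal category of real vector spaces\<close>

lemma real_field_simps [simp]:
  "carrier real_field = UNIV" "x \<otimes>\<^bsub>real_field\<^esub> y = x * y" "x \<oplus>\<^bsub>real_field\<^esub> y = x + y"
  "\<one>\<^bsub>real_field\<^esub> = 1" "\<zero>\<^bsub>real_field\<^esub> = 0"
  by (simp_all add: real_field_def)

lemma cring_real_field: "cring real_field"
proof (intro cringI abelian_groupI comm_monoidI)
  show "\<exists>y\<in>carrier real_field. y \<oplus>\<^bsub>real_field\<^esub> x = \<zero>\<^bsub>real_field\<^esub>" for x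
    by (auto intro: exI[of _ "- x"])
qed (auto simp: algebra_simps)

lemma vect_closed:
  assumes "module real_field V"
  shows "\<zero>\<^bsub>V\<^esub> \<in> carrier V"
    and "x \<in> carrier V \<Longrightarrow> y \<in> carrier V \<Longrightarrow> x \<oplus>\<^bsub>V\<^esub> y \<in> carrier V"
    and "x \<in> carrier V \<Longrightarrow> r \<odot>\<^bsub>V\<^esub> x \<in> carrier V"
proof -
  interpret module real_field V by fact
  show "\<zero>\<^bsub>V\<^esub> \<in> carrier V"
    "x \<in> carrier V \<Longrightarrow> y \<in> carrier V \<Longrightarrow> x \<oplus>\<^bsub>V\<^esub> y \<in> carrier V"
    "x \<in> carrier V \<Longrightarrow> r \<odot>\<^bsub>V\<^esub> x \<in> carrier V" by auto
qed

text \<open>Facts of the locale \<open>module\<close> as plain rules, with the operations of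
  \<open>real_field\<close> evaluated. They are the same laws that \<open>vectI\<close> asks for, so
  they can be passed on to direct sums componentwise.\<close>

lemma vect_laws:
  assumes "module real_field V"
  shows "x \<in> carrier V \<Longrightarrow> y \<in> carrier V \<Longrightarrow> z \<in> carrier V \<Longrightarrow>
      (x \<oplus>\<^bsub>V\<^esub> y) \<oplus>\<^bsub>V\<^esub> z = x \<oplus>\<^bsub>V\<^esub> (y \<oplus>\<^bsub>V\<^esub> z)"
    and "x \<in> carrier V \<Longrightarrow> y \<in> carrier V \<Longrightarrow> x \<oplus>\<^bsub>V\<^esub> y = y \<oplus>\<^bsub>V\<^esub> x"
    and "x \<in> carrier V \<Longrightarrow> \<zero>\<^bsub>V\<^esub> \<oplus>\<^bsub>V\<^esub> x = x"
    and "x \<in> carrier V \<Longrightarrow> 0 \<odot>\<^bsub>V\<^esub> x = \<zero>\<^bsub>V\<^esub>"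
    and "x \<in> carrier V \<Longrightarrow> 1 \<odot>\<^bsub>V\<^esub> x = x"
    and "x \<in> carrier V \<Longrightarrow> (r + s) \<odot>\<^bsub>V\<^esub> x = r \<odot>\<^bsub>V\<^esub> x \<oplus>\<^bsub>V\<^esub> s \<odot>\<^bsub>V\<^esub> x"
    and "x \<in> carrier V \<Longrightarrow> y \<in> carrier V \<Longrightarrow> r \<odot>\<^bsub>V\<^esub> (x \<oplus>\<^bsub>V\<^esub> y) = r \<odot>\<^bsub>V\<^esub> x \<oplus>\<^bsub>V\<^esub> r \<odot>\<^bsub>V\<^esub> y"
    and "x \<in> carrier V \<Longrightarrow> (r * s) \<odot>\<^bsub>V\<^esub> x = r \<odot>\<^bsub>V\<^esub> (s \<odot>\<^bsub>V\<^esub> x)"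
proof -
  interpret module real_field V by fact
  show "x \<in> carrier V \<Longrightarrow> y \<in> carrier V \<Longrightarrow> z \<in> carrier V \<Longrightarrow>
      (x \<oplus>\<^bsub>V\<^esub> y) \<oplus>\<^bsub>V\<^esub> z = x \<oplus>\<^bsub>V\<^esub> (y \<oplus>\<^bsub>V\<^esub> z)" by (rule M.a_assoc)
  show "x \<in> carrier V \<Longrightarrow> y \<in> carrier V \<Longrightarrow> x \<oplus>\<^bsub>V\<^esub> y = y \<oplus>\<^bsub>V\<^esub> x" by (rule M.a_comm)
  show "x \<in> carrier V \<Longrightarrow> \<zero>\<^bsub>V\<^esub> \<oplus>\<^bsub>V\<^esub> x = x" by (rule M.l_zero)
  show "x \<in> carrier V \<Longrightarrow> 0 \<odot>\<^bsub>V\<^esub> x = \<zero>\<^bsub>V\<^esub>" using smult_l_null by simp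
  show "x \<in> carrier V \<Longrightarrow> 1 \<odot>\<^bsub>V\<^esub> x = x" using smult_one by simp
  show "x \<in> carrier V \<Longrightarrow> (r + s) \<odot>\<^bsub>V\<^esub> x = r \<odot>\<^bsub>V\<^esub> x \<oplus>\<^bsub>V\<^esub> s \<odot>\<^bsub>V\<^esub> x"
    using smult_l_distr[of r s x] by simp
  show "x \<in> carrier V \<Longrightarrow> y \<in> carrier V \<Longrightarrow> r \<odot>\<^bsub>V\<^esub> (x \<oplus>\<^bsub>V\<^esub> y) = r \<odot>\<^bsub>V\<^esub> x \<oplus>\<^bsub>V\<^esub> r \<odot>\<^bsub>V\<^esub> y"
    using smult_r_distr[of r x y] by simp
  show "x \<in> carrier V \<Longrightarrow> (r * s) \<odot>\<^bsub>V\<^esub> x = r \<odot>\<^bsub>V\<^esub> (s \<odot>\<^bsub>V\<^esub> x)"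
    using smult_assoc1[of r s x] by simp
qed

text \<open>Negatives need not be given: they are the multiples by \<open>-1\<close>.\<close>

lemma vectI:
  fixes V :: "(real, 'v, 'x) module_scheme"
  assumes zero: "\<zero>\<^bsub>V\<^esub> \<in> carrier V"
    and add: "\<And>x y. x \<in> carrier V \<Longrightarrow> y \<in> carrier V \<Longrightarrow> x \<oplus>\<^bsub>V\<^esub> y \<in> carrier V"
    and smult: "\<And>r x. x \<in> carrier V \<Longrightarrow> r \<odot>\<^bsub>V\<^esub> x \<in> carrier V"
    and "\<And>x y z. x \<in> carrier V \<Longrightarrow> y \<in> carrier V \<Longrightarrow> z \<in> carrier V \<Longrightarrow>
      (x \<oplus>\<^bsub>V\<^esub> y) \<oplus>\<^bsub>V\<^esub> z = x \<oplus>\<^bsub>V\<^esub> (y \<oplus>\<^bsub>V\<^esub> z)"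
    and "\<And>x y. x \<in> carrier V \<Longrightarrow> y \<in> carrier V \<Longrightarrow> x \<oplus>\<^bsub>V\<^esub> y = y \<oplus>\<^bsub>V\<^esub> x"
    and "\<And>x. x \<in> carrier V \<Longrightarrow> \<zero>\<^bsub>V\<^esub> \<oplus>\<^bsub>V\<^esub> x = x"
    and null: "\<And>x. x \<in> carrier V \<Longrightarrow> 0 \<odot>\<^bsub>V\<^esub> x = \<zero>\<^bsub>V\<^esub>"
    and one: "\<And>x. x \<in> carrier V \<Longrightarrow> 1 \<odot>\<^bsub>V\<^esub> x = x"
    and distr: "\<And>r s x. x \<in> carrier V \<Longrightarrow> (r + s) \<odot>\<^bsub>V\<^esub> x = r \<odot>\<^bsub>V\<^esub> x \<oplus>\<^bsub>V\<^esub> s \<odot>\<^bsub>V\<^esub> x"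
    and "\<And>r x y. x \<in> carrier V \<Longrightarrow> y \<in> carrier V \<Longrightarrow>
      r \<odot>\<^bsub>V\<^esub> (x \<oplus>\<^bsub>V\<^esub> y) = r \<odot>\<^bsub>V\<^esub> x \<oplus>\<^bsub>V\<^esub> r \<odot>\<^bsub>V\<^esub> y"
    and "\<And>r s x. x \<in> carrier V \<Longrightarrow> (r * s) \<odot>\<^bsub>V\<^esub> x = r \<odot>\<^bsub>V\<^esub> (s \<odot>\<^bsub>V\<^esub> x)"
  shows "module real_field V"
proof (intro moduleI cring_real_field abelian_groupI)
  fix x assume x: "x \<in> carrier V"
  have "(-1) \<odot>\<^bsub>V\<^esub> x \<oplus>\<^bsub>V\<^esub> 1 \<odot>\<^bsub>V\<^esub> x = \<zero>\<^bsub>V\<^esub>"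
    using distr[OF x, of "-1" 1] null[OF x] by simp
  then show "\<exists>y\<in>carrier V. y \<oplus>\<^bsub>V\<^esub> x = \<zero>\<^bsub>V\<^esub>"
    using one[OF x] smult[OF x, of "-1"] by auto
qed ((simp only: real_field_simps)?, (rule assms; assumption))+

section \<open>Direct sums, the zero space and linear arrows\<close>

lemma direct_sum_simps [simp]:
  "carrier (direct_sum V W) = tup_times (carrier V) (carrier W)"
  "\<zero>\<^bsub>direct_sum V W\<^esub> = Tup \<zero>\<^bsub>V\<^esub> \<zero>\<^bsub>W\<^esub>"
  "Tup x y \<oplus>\<^bsub>direct_sum V W\<^esub> Tup x' y' = Tup (x \<oplus>\<^bsub>V\<^esub> x') (y \<oplus>\<^bsub>W\<^esub> y')"
  "r \<odot>\<^bsub>direct_sum V W\<^esub> Tup x y = Tup (r \<odot>\<^bsub>V\<^esub> x) (r \<odot>\<^bsub>W\<^esub> y)"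
  by (simp_all add: direct_sum_def)

lemma zero_vect_simps [simp]:
  "carrier zero_vect = {Pt}" "\<zero>\<^bsub>zero_vect\<^esub> = Pt" "x \<oplus>\<^bsub>zero_vect\<^esub> y = Pt" "r \<odot>\<^bsub>zero_vect\<^esub> x = Pt"
  by (simp_all add: zero_vect_def)

lemma module_direct_sum:
  assumes V: "module real_field V" and W: "module real_field W"
  shows "module real_field (direct_sum V W)"
  by (rule vectI)
     (auto elim!: tup_timesE simp: vect_closed[OF V] vect_closed[OF W] vect_laws(3-8)[OF V] vect_laws(3-8)[OF W]
      intro: vect_laws(1,2)[OF V] vect_laws(1,2)[OF W])

lemma module_zero_vect: "module real_field zero_vect"
  by (rule vectI) auto

lemma mk_vect_arrow_simps [simp]:
  "source (mk_vect_arrow V W f) = V" "target (mk_vect_arrow V W f) = W"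
  "action (mk_vect_arrow V W f) = restrict f (carrier V)"
  by (simp_all add: mk_vect_arrow_def)

lemma mk_vect_arrow_cong:
  "(\<And>x. x \<in> carrier V \<Longrightarrow> f x = g x) \<Longrightarrow> mk_vect_arrow V W f = mk_vect_arrow V W g"
  by (auto simp: mk_vect_arrow_def cong: restrict_cong)

lemma Vect_simps [simp]:
  "Obj Vect = {V. module real_field V}" "Arr Vect = {f. is_vect_arrow f}"
  "Dom Vect = source" "Cod Vect = target" "Ide Vect V = mk_vect_arrow V V id"
  "g \<cdot>\<^bsub>Vect\<^esub> f = mk_vect_arrow (source f) (target g) (action g \<circ> action f)"
  "V \<boxtimes>\<^bsub>Vect\<^esub> W = direct_sum V W"
  "f \<boxdot>\<^bsub>Vect\<^esub> g = mk_vect_arrow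
     (direct_sum (source f) (source g)) (direct_sum (target f) (target g))
     (tup_map (action f) (action g))"
  "unit Vect = zero_vect"
  "associator Vect U V W = mk_vect_arrow
     (direct_sum (direct_sum U V) W) (direct_sum U (direct_sum V W)) tup_assoc"
  "left_unitor Vect V = mk_vect_arrow (direct_sum zero_vect V) V tsnd"
  "right_unitor Vect V = mk_vect_arrow (direct_sum V zero_vect) V tfst"
  by (simp_all add: Vect_def)

lemma hom_Vect: "f \<in> hom_set Vect V W \<longleftrightarrow> is_vect_arrow f \<and> source f = V \<and> target f = W"
  by (simp add: hom_set_def)

lemma linear_mapI:
  assumes "\<And>x. x \<in> carrier V \<Longrightarrow> f x \<in> carrier W"
    and "\<And>x y. x \<in> carrier V \<Longrightarrow> y \<in> carrier V \<Longrightarrow> f (x \<oplus>\<^bsub>V\<^esub> y) = f x \<oplus>\<^bsub>W\<^esub> f y"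
    and "\<And>r x. x \<in> carrier V \<Longrightarrow> f (r \<odot>\<^bsub>V\<^esub> x) = r \<odot>\<^bsub>W\<^esub> f x"
  shows "linear_map V W f"
  using assms by (auto simp: linear_map_def)

lemma linear_mapD:
  assumes "linear_map V W f" "x \<in> carrier V"
  shows "f x \<in> carrier W" "y \<in> carrier V \<Longrightarrow> f (x \<oplus>\<^bsub>V\<^esub> y) = f x \<oplus>\<^bsub>W\<^esub> f y"
    "f (r \<odot>\<^bsub>V\<^esub> x) = r \<odot>\<^bsub>W\<^esub> f x"
  using assms by (auto simp: linear_map_def)

lemma is_vect_arrow_mk:
  assumes V: "module real_field V" and W: "module real_field W" and f: "linear_map V W f"
  shows "is_vect_arrow (mk_vect_arrow V W f)"
  unfolding is_vect_arrow_def
  by (auto simp: V W vect_closed[OF V] linear_mapD[OF f] intro!: linear_mapI)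

lemma vect_arrowD:
  assumes "is_vect_arrow f"
  shows "module real_field (source f)" "module real_field (target f)"
    "action f \<in> extensional (carrier (source f))" "linear_map (source f) (target f) (action f)"
  using assms by (auto simp: is_vect_arrow_def)

lemma vect_arrow_eta: "is_vect_arrow f \<Longrightarrow> mk_vect_arrow (source f) (target f) (action f) = f"
  using vect_arrowD(3)[of f] by (simp add: mk_vect_arrow_def extensional_restrict)

lemma vect_arrow_carrier:
  "is_vect_arrow f \<Longrightarrow> x \<in> carrier (source f) \<Longrightarrow> action f x \<in> carrier (target f)"
  by (rule linear_mapD(1)[OF vect_arrowD(4)])

section \<open>Associator, unitors and the monoidal laws for vector spaces\<close>

lemma inverse_arrows_Vect:
  assumes V: "module real_field V" and W: "module real_field W"
    and f: "linear_map V W f" and g: "linear_map W V g"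
    and gf: "\<And>x. x \<in> carrier V \<Longrightarrow> g (f x) = x" and fg: "\<And>x. x \<in> carrier W \<Longrightarrow> f (g x) = x"
  shows "inverse_arrows Vect (mk_vect_arrow V W f) (mk_vect_arrow W V g)"
  using is_vect_arrow_mk[OF V W f] is_vect_arrow_mk[OF W V g] linear_mapD(1)[OF f] linear_mapD(1)[OF g] gf fg
  by (auto simp: inverse_arrows_def hom_Vect intro!: mk_vect_arrow_cong)

lemma vect_associator:
  assumes U: "module real_field U" and V: "module real_field V" and W: "module real_field W"
  shows "associator Vect U V W \<in> hom_set Vect (direct_sum (direct_sum U V) W) (direct_sum U (direct_sum V W))"
    and "iso_arrow Vect (associator Vect U V W)"
proof -
  note m = module_direct_sum
  have f: "linear_map (direct_sum (direct_sum U V) W) (direct_sum U (direct_sum V W)) tup_assoc"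
    and g: "linear_map (direct_sum U (direct_sum V W)) (direct_sum (direct_sum U V) W) tup_unassoc"
    by (rule linear_mapI; auto elim!: tup_timesE)+
  show "associator Vect U V W \<in> hom_set Vect (direct_sum (direct_sum U V) W) (direct_sum U (direct_sum V W))"
    using is_vect_arrow_mk[OF m[OF m[OF U V] W] m[OF U m[OF V W]] f] by (simp add: hom_Vect)
  have "inverse_arrows Vect (associator Vect U V W)
      (mk_vect_arrow (direct_sum U (direct_sum V W)) (direct_sum (direct_sum U V) W) tup_unassoc)"
    unfolding Vect_simps
    by (rule inverse_arrows_Vect[OF m[OF m[OF U V] W] m[OF U m[OF V W]] f g]) (auto elim!: tup_timesE)
  then show "iso_arrow Vect (associator Vect U V W)" unfolding iso_arrow_def by blast
qed

lemma vect_left_unitor: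
  assumes V: "module real_field V"
  shows "left_unitor Vect V \<in> hom_set Vect (direct_sum zero_vect V) V"
    and "iso_arrow Vect (left_unitor Vect V)"
proof -
  note m = module_direct_sum[OF module_zero_vect V]
  have f: "linear_map (direct_sum zero_vect V) V tsnd"
    and g: "linear_map V (direct_sum zero_vect V) (Tup Pt)"
    by (rule linear_mapI; auto elim!: tup_timesE)+
  show "left_unitor Vect V \<in> hom_set Vect (direct_sum zero_vect V) V"
    using is_vect_arrow_mk[OF m V f] by (simp add: hom_Vect)
  have "inverse_arrows Vect (left_unitor Vect V) (mk_vect_arrow V (direct_sum zero_vect V) (Tup Pt))"
    unfolding Vect_simps by (rule inverse_arrows_Vect[OF m V f g]) (auto elim!: tup_timesE)
  then show "iso_arrow Vect (left_unitor Vect V)" unfolding iso_arrow_def by blast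
qed

lemma vect_right_unitor:
  assumes V: "module real_field V"
  shows "right_unitor Vect V \<in> hom_set Vect (direct_sum V zero_vect) V"
    and "iso_arrow Vect (right_unitor Vect V)"
proof -
  note m = module_direct_sum[OF V module_zero_vect]
  have f: "linear_map (direct_sum V zero_vect) V tfst"
    and g: "linear_map V (direct_sum V zero_vect) (\<lambda>x. Tup x Pt)"
    by (rule linear_mapI; auto elim!: tup_timesE)+
  show "right_unitor Vect V \<in> hom_set Vect (direct_sum V zero_vect) V"
    using is_vect_arrow_mk[OF m V f] by (simp add: hom_Vect)
  have "inverse_arrows Vect (right_unitor Vect V) (mk_vect_arrow V (direct_sum V zero_vect) (\<lambda>x. Tup x Pt))"
    unfolding Vect_simps by (rule inverse_arrows_Vect[OF m V f g]) (auto elim!: tup_timesE)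
  then show "iso_arrow Vect (right_unitor Vect V)" unfolding iso_arrow_def by blast
qed

lemma monoidal_category_Vect: "monoidal_category Vect"
proof (intro monoidal_category.intro category.intro monoidal_category_axioms.intro)
  note simps = hom_Vect
  show "Dom Vect f \<in> Obj Vect \<and> Cod Vect f \<in> Obj Vect" if "f \<in> Arr Vect" for f
    using that vect_arrowD(1,2)[of f] by simp
  show "Ide Vect V \<in> hom_set Vect V V" if "V \<in> Obj Vect" for V
    using that is_vect_arrow_mk[of V V id] by (simp add: simps linear_map_def)
  show "g \<cdot>\<^bsub>Vect\<^esub> f \<in> hom_set Vect U W"
    if f: "f \<in> hom_set Vect U V" and g: "g \<in> hom_set Vect V W" for f g U V W
  proof -
    have f': "is_vect_arrow f" "source f = U" "target f = V" and g': "is_vect_arrow g" "source g = V" "target g = W"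
      using f g by (auto simp: simps)
    note F = linear_mapD[OF vect_arrowD(4)[OF f'(1)], unfolded f'(2,3)]
    note G = linear_mapD[OF vect_arrowD(4)[OF g'(1)], unfolded g'(2,3)]
    have "linear_map U W (action g \<circ> action f)"
      by (rule linear_mapI) (simp_all add: F G)
    then show ?thesis
      using is_vect_arrow_mk[of U W] vect_arrowD(1)[OF f'(1)] vect_arrowD(2)[OF g'(1)] f' g' by (simp add: simps)
  qed
  show "f \<cdot>\<^bsub>Vect\<^esub> Ide Vect V = f" "Ide Vect W \<cdot>\<^bsub>Vect\<^esub> f = f" if f: "f \<in> hom_set Vect V W" for f V W
  proof -
    have f': "is_vect_arrow f" "source f = V" "target f = W" using f by (auto simp: simps)
    note eta = vect_arrow_eta[OF f'(1), unfolded f'(2,3)]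
    have "f \<cdot>\<^bsub>Vect\<^esub> Ide Vect V = mk_vect_arrow V W (action f)"
      using f' by (auto intro!: mk_vect_arrow_cong)
    then show "f \<cdot>\<^bsub>Vect\<^esub> Ide Vect V = f" unfolding eta .
    have "Ide Vect W \<cdot>\<^bsub>Vect\<^esub> f = mk_vect_arrow V W (action f)"
      using f' vect_arrow_carrier[OF f'(1)] by (auto intro!: mk_vect_arrow_cong)
    then show "Ide Vect W \<cdot>\<^bsub>Vect\<^esub> f = f" unfolding eta .
  qed
  show "(h \<cdot>\<^bsub>Vect\<^esub> g) \<cdot>\<^bsub>Vect\<^esub> f = h \<cdot>\<^bsub>Vect\<^esub> (g \<cdot>\<^bsub>Vect\<^esub> f)"
    if "f \<in> hom_set Vect a b" "g \<in> hom_set Vect b c" "h \<in> hom_set Vect c d" for f g h a b c d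
    using that vect_arrow_carrier[of f] by (auto simp: simps intro!: mk_vect_arrow_cong)
  show "V \<boxtimes>\<^bsub>Vect\<^esub> W \<in> Obj Vect" if "V \<in> Obj Vect" "W \<in> Obj Vect" for V W
    using that by (simp add: module_direct_sum)
  show "f \<boxdot>\<^bsub>Vect\<^esub> g \<in> hom_set Vect (V \<boxtimes>\<^bsub>Vect\<^esub> W) (V' \<boxtimes>\<^bsub>Vect\<^esub> W')"
    if f: "f \<in> hom_set Vect V V'" and g: "g \<in> hom_set Vect W W'" for f g V W V' W'
  proof -
    have f': "is_vect_arrow f" "source f = V" "target f = V'" and g': "is_vect_arrow g" "source g = W" "target g = W'"
      using f g by (auto simp: simps)
    note F = linear_mapD[OF vect_arrowD(4)[OF f'(1)], unfolded f'(2,3)]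
    note G = linear_mapD[OF vect_arrowD(4)[OF g'(1)], unfolded g'(2,3)]
    have "linear_map (direct_sum V W) (direct_sum V' W') (tup_map (action f) (action g))"
      by (rule linear_mapI) (auto elim!: tup_timesE simp: F G)
    moreover have "module real_field (direct_sum V W)" "module real_field (direct_sum V' W')"
      using vect_arrowD(1,2)[OF f'(1)] vect_arrowD(1,2)[OF g'(1)] f' g' by (simp_all add: module_direct_sum)
    ultimately show ?thesis
      using is_vect_arrow_mk[of "direct_sum V W" "direct_sum V' W'"] f' g' by (simp add: simps)
  qed
  show "Ide Vect V \<boxdot>\<^bsub>Vect\<^esub> Ide Vect W = Ide Vect (V \<boxtimes>\<^bsub>Vect\<^esub> W)"
    if "V \<in> Obj Vect" "W \<in> Obj Vect" for V W
    by (auto intro!: mk_vect_arrow_cong elim!: tup_timesE)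
  show "(f' \<cdot>\<^bsub>Vect\<^esub> f) \<boxdot>\<^bsub>Vect\<^esub> (g' \<cdot>\<^bsub>Vect\<^esub> g) = (f' \<boxdot>\<^bsub>Vect\<^esub> g') \<cdot>\<^bsub>Vect\<^esub> (f \<boxdot>\<^bsub>Vect\<^esub> g)"
    if "f \<in> hom_set Vect a a'" "f' \<in> hom_set Vect a' a''"
      "g \<in> hom_set Vect b b'" "g' \<in> hom_set Vect b' b''" for f f' g g' a a' a'' b b' b''
    using that vect_arrow_carrier[of f] vect_arrow_carrier[of g]
    by (auto simp: simps intro!: mk_vect_arrow_cong elim!: tup_timesE)
  show "unit Vect \<in> Obj Vect" by (simp add: module_zero_vect)
  show "associator Vect a b c \<in> hom_set Vect ((a \<boxtimes>\<^bsub>Vect\<^esub> b) \<boxtimes>\<^bsub>Vect\<^esub> c) (a \<boxtimes>\<^bsub>Vect\<^esub> (b \<boxtimes>\<^bsub>Vect\<^esub> c))"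
    "iso_arrow Vect (associator Vect a b c)"
    if "a \<in> Obj Vect" "b \<in> Obj Vect" "c \<in> Obj Vect" for a b c
    using vect_associator[of a b c] that by auto
  show "associator Vect a' b' c' \<cdot>\<^bsub>Vect\<^esub> ((f \<boxdot>\<^bsub>Vect\<^esub> g) \<boxdot>\<^bsub>Vect\<^esub> h) =
      (f \<boxdot>\<^bsub>Vect\<^esub> (g \<boxdot>\<^bsub>Vect\<^esub> h)) \<cdot>\<^bsub>Vect\<^esub> associator Vect a b c"
    if "f \<in> hom_set Vect a a'" "g \<in> hom_set Vect b b'" "h \<in> hom_set Vect c c'"
    for f g h a b c a' b' c'
    using that vect_arrow_carrier[of f] vect_arrow_carrier[of g] vect_arrow_carrier[of h]
    by (auto simp: simps intro!: mk_vect_arrow_cong elim!: tup_timesE)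
  show "left_unitor Vect a \<in> hom_set Vect (unit Vect \<boxtimes>\<^bsub>Vect\<^esub> a) a"
    "iso_arrow Vect (left_unitor Vect a)" if "a \<in> Obj Vect" for a
    using vect_left_unitor[of a] that by auto
  show "left_unitor Vect a' \<cdot>\<^bsub>Vect\<^esub> (Ide Vect (unit Vect) \<boxdot>\<^bsub>Vect\<^esub> f) =
      f \<cdot>\<^bsub>Vect\<^esub> left_unitor Vect a" if "f \<in> hom_set Vect a a'" for f a a'
    using that vect_arrow_carrier[of f]
    by (auto simp: simps intro!: mk_vect_arrow_cong elim!: tup_timesE)
  show "right_unitor Vect a \<in> hom_set Vect (a \<boxtimes>\<^bsub>Vect\<^esub> unit Vect) a"
    "iso_arrow Vect (right_unitor Vect a)" if "a \<in> Obj Vect" for a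
    using vect_right_unitor[of a] that by auto
  show "right_unitor Vect a' \<cdot>\<^bsub>Vect\<^esub> (f \<boxdot>\<^bsub>Vect\<^esub> Ide Vect (unit Vect)) =
      f \<cdot>\<^bsub>Vect\<^esub> right_unitor Vect a" if "f \<in> hom_set Vect a a'" for f a a'
    using that vect_arrow_carrier[of f]
    by (auto simp: simps intro!: mk_vect_arrow_cong elim!: tup_timesE)
  show "associator Vect a b (c \<boxtimes>\<^bsub>Vect\<^esub> d) \<cdot>\<^bsub>Vect\<^esub> associator Vect (a \<boxtimes>\<^bsub>Vect\<^esub> b) c d =
      (Ide Vect a \<boxdot>\<^bsub>Vect\<^esub> associator Vect b c d) \<cdot>\<^bsub>Vect\<^esub>
      associator Vect a (b \<boxtimes>\<^bsub>Vect\<^esub> c) d \<cdot>\<^bsub>Vect\<^esub>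
      (associator Vect a b c \<boxdot>\<^bsub>Vect\<^esub> Ide Vect d)"
    if "a \<in> Obj Vect" "b \<in> Obj Vect" "c \<in> Obj Vect" "d \<in> Obj Vect" for a b c d
    by (auto intro!: mk_vect_arrow_cong elim!: tup_timesE)
  show "(Ide Vect a \<boxdot>\<^bsub>Vect\<^esub> left_unitor Vect b) \<cdot>\<^bsub>Vect\<^esub> associator Vect a (unit Vect) b =
      right_unitor Vect a \<boxdot>\<^bsub>Vect\<^esub> Ide Vect b"
    if "a \<in> Obj Vect" "b \<in> Obj Vect" for a b
    by (auto intro!: mk_vect_arrow_cong elim!: tup_timesE)
qed

section \<open>Open systems\<close>

lemma open_systems_iff:
  "F \<in> open_systems a \<longleftrightarrow> F \<in> extensional (points (total a)) \<and>
     smooth_map (total a) (tangent_bundle (state a)) F \<and>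
     (\<forall>q\<in>points (total a). fst (F q) = subm a q \<and> snd (F q) \<in> tangent_space (state a) (subm a q))"
  by (auto simp: open_systems_def mem_Times_iff)

text \<open>The base component of an open system is \<open>subm a\<close>, which is smooth already.
  What remains are fibre coordinates, which are real functions, so closure under the vector space
  operations is closure of \<open>smooth_fn\<close> under sums and products.\<close>

lemma open_systemsI:
  assumes a: "is_ssub a" and "F \<in> extensional (points (total a))"
    and F: "\<And>q. q \<in> points (total a) \<Longrightarrow> fst (F q) = subm a q \<and> snd (F q) \<in> tangent_space (state a) (subm a q)"
    and s: "\<And>c j. c \<in> charts (state a) \<Longrightarrow>
      smooth_fn (total a) {q \<in> points (total a). subm a q \<in> chart_dom c} (\<lambda>q. snd (F q) c j)"
  shows "F \<in> open_systems a"
  unfolding open_systems_iff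
proof (intro conjI ballI assms(2) F)
  note A = is_ssubD[OF a]
  show "smooth_map (total a) (tangent_bundle (state a)) F"
  proof (rule smooth_tangentI[OF A(2) A(1) A(3) F])
    fix q assume q: "q \<in> points (total a)"
    obtain c where c: "c \<in> charts (state a)" "subm a q \<in> chart_dom c"
      using chart_aroundE[OF A(2) subm_points[OF a q]] .
    then show "\<exists>c\<in>charts_at (state a) (subm a q). \<exists>W. q \<in> W \<and> (\<forall>j. smooth_fn (total a) W (\<lambda>q. snd (F q) c j))"
      using s q by (intro bexI[of _ c] exI[of _ "{q \<in> points (total a). subm a q \<in> chart_dom c}"])
        (auto simp: charts_at_iff)
  qed
qed (simp_all add: F)

context
  fixes a :: "'p ssub"
  assumes a: "is_ssub a"
begin

lemma open_systemD:
  assumes F: "F \<in> open_systems a"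
  shows "F \<in> extensional (points (total a))"
    and "smooth_map (total a) (tangent_bundle (state a)) F"
    and "q \<in> points (total a) \<Longrightarrow> fst (F q) = subm a q"
    and "q \<in> points (total a) \<Longrightarrow> snd (F q) \<in> tangent_space (state a) (subm a q)"
    and "q \<in> points (total a) \<Longrightarrow> F q \<in> tangent_points (state a)"
    and "c \<in> charts (state a) \<Longrightarrow>
      smooth_fn (total a) {q \<in> points (total a). subm a q \<in> chart_dom c} (\<lambda>q. snd (F q) c j)"
proof -
  note A = is_ssubD[OF a]
  show "F \<in> extensional (points (total a))"
    and s: "smooth_map (total a) (tangent_bundle (state a)) F"
    and f: "\<And>q. q \<in> points (total a) \<Longrightarrow> fst (F q) = subm a q"
    and "q \<in> points (total a) \<Longrightarrow> snd (F q) \<in> tangent_space (state a) (subm a q)"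
    using F by (simp_all add: open_systems_iff)
  show "q \<in> points (total a) \<Longrightarrow> F q \<in> tangent_points (state a)"
    by (rule smooth_tangentD(3)[OF A(2) A(1) s])
  have "{q \<in> points (total a). fst (F q) \<in> chart_dom c} = {q \<in> points (total a). subm a q \<in> chart_dom c}"
    using f by auto
  then show "c \<in> charts (state a) \<Longrightarrow>
      smooth_fn (total a) {q \<in> points (total a). subm a q \<in> chart_dom c} (\<lambda>q. snd (F q) c j)"
    using smooth_tangentD(1)[OF A(2) A(1) s, of c j] by simp
qed

lemma state_chart_vimage_open:
  "c \<in> charts (state a) \<Longrightarrow> openin (space_top (total a)) {q \<in> points (total a). subm a q \<in> chart_dom c}"
  using is_ssubD[OF a] by (intro smooth_map_vimage_open[where N = "state a"] chart_dom_open) auto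

lemma osys_zero_in: "osys_zero a \<in> open_systems a"
proof (rule open_systemsI[OF a])
  fix c j assume c: "c \<in> charts (state a)"
  note W = state_chart_vimage_open[OF c]
  show "smooth_fn (total a) {q \<in> points (total a). subm a q \<in> chart_dom c} (\<lambda>q. snd (osys_zero a q) c j)"
    by (rule smooth_fn_cong[OF is_ssubD(1)[OF a] smooth_fn_const[OF is_ssubD(1)[OF a] W, of 0]])
       (simp add: osys_zero_def)
qed (simp_all add: osys_zero_def tangent_zero)

lemma osys_add_in:
  assumes F: "F \<in> open_systems a" and G: "G \<in> open_systems a"
  shows "osys_add a F G \<in> open_systems a"
proof (rule open_systemsI[OF a])
  fix c j assume c: "c \<in> charts (state a)"
  note W = state_chart_vimage_open[OF c]
  show "smooth_fn (total a) {q \<in> points (total a). subm a q \<in> chart_dom c} (\<lambda>q. snd (osys_add a F G q) c j)"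
    by (rule smooth_fn_cong[OF is_ssubD(1)[OF a]
          smooth_fn_add[OF is_ssubD(1)[OF a] W open_systemD(6)[OF F c] open_systemD(6)[OF G c]]])
       (simp add: osys_add_def)
qed (simp_all add: osys_add_def tangent_add open_systemD[OF F] open_systemD[OF G])

lemma osys_scale_in:
  assumes F: "F \<in> open_systems a"
  shows "osys_scale a r F \<in> open_systems a"
proof (rule open_systemsI[OF a])
  fix c j assume c: "c \<in> charts (state a)"
  note W = state_chart_vimage_open[OF c]
  note A = is_ssubD(1)[OF a]
  show "smooth_fn (total a) {q \<in> points (total a). subm a q \<in> chart_dom c} (\<lambda>q. snd (osys_scale a r F q) c j)"
    by (rule smooth_fn_cong[OF A smooth_fn_mult[OF A W smooth_fn_const[OF A W, of r] open_systemD(6)[OF F c, of j]]])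
       (simp add: osys_scale_def)
qed (simp_all add: osys_scale_def tangent_scale open_systemD[OF F])

lemma open_system_eqI:
  assumes "F \<in> open_systems a" "G \<in> open_systems a" "\<And>q. q \<in> points (total a) \<Longrightarrow> F q = G q"
  shows "F = G"
  using extensionalityI[OF open_systemD(1)[OF assms(1)] open_systemD(1)[OF assms(2)] assms(3)] .

end

lemma Crl_simps [simp]:
  "carrier (Crl a) = Atom ` open_systems a" "\<zero>\<^bsub>Crl a\<^esub> = Atom (osys_zero a)"
  "Atom F \<oplus>\<^bsub>Crl a\<^esub> Atom G = Atom (osys_add a F G)" "r \<odot>\<^bsub>Crl a\<^esub> Atom F = Atom (osys_scale a r F)"
  by (simp_all add: Crl_def)

lemma module_Crl:
  assumes a: "is_ssub a"
  shows "module real_field (Crl a)"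
proof (rule vectI)
  note cl = osys_zero_in[OF a] osys_add_in[OF a] osys_scale_in[OF a]
  note eq = open_system_eqI[OF a]
  note d = open_systemD(3)[OF a]
  show "\<zero>\<^bsub>Crl a\<^esub> \<oplus>\<^bsub>Crl a\<^esub> x = x" "1 \<odot>\<^bsub>Crl a\<^esub> x = x"
    if x: "x \<in> carrier (Crl a)" for x
  proof -
    obtain F where F: "F \<in> open_systems a" "x = Atom F" using x by auto
    \<comment> \<open>The left side has base point \<open>subm a q\<close> by construction and is
      undefined outside the points; to equal \<open>F\<close> it needs
      \<open>fst (F q) = subm a q\<close> and the extensionality of \<open>F\<close>.\<close>
    have "osys_add a (osys_zero a) F = F"
      by (rule eq[OF cl(2)[OF cl(1) F(1)] F(1)])
         (simp add: osys_add_def osys_zero_def d[OF F(1)] prod_eq_iff)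
    then show "\<zero>\<^bsub>Crl a\<^esub> \<oplus>\<^bsub>Crl a\<^esub> x = x" by (simp add: F(2))
    have "osys_scale a 1 F = F"
      by (rule eq[OF cl(3)[OF F(1)] F(1)]) (simp add: osys_scale_def d[OF F(1)] prod_eq_iff)
    then show "1 \<odot>\<^bsub>Crl a\<^esub> x = x" by (simp add: F(2))
  qed
  show "\<zero>\<^bsub>Crl a\<^esub> \<in> carrier (Crl a)" using cl by simp
  show "x \<oplus>\<^bsub>Crl a\<^esub> y \<in> carrier (Crl a)" if "x \<in> carrier (Crl a)" "y \<in> carrier (Crl a)" for x y
    using that cl by auto
  show "r \<odot>\<^bsub>Crl a\<^esub> x \<in> carrier (Crl a)" if "x \<in> carrier (Crl a)" for r x
    using that cl by auto
qed (auto simp: osys_add_def osys_scale_def osys_zero_def algebra_simps cong: restrict_cong intro!: restrict_ext)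

context
  fixes \<psi> :: "'p ssub_arrow"
  assumes \<psi>: "interconnection \<psi>"
begin

abbreviation (input) "T_st \<equiv> tangent_map (state (source \<psi>)) (state (target \<psi>)) (st_map \<psi>)"

text \<open>The tangent map of a left inverse \<open>g\<close> of \<open>st_map\<close> is a left
  inverse of \<open>T_st\<close>, so \<open>inv_into\<close> can only return \<open>H\<close>. A
  pullback is thus computed by exhibiting a candidate and applying \<open>T_st\<close> to
  it.\<close>

lemma osys_pullback_eqI:
  assumes q: "q \<in> points (total (source \<psi>))" and H: "H \<in> tangent_points (state (source \<psi>))"
    and eq: "T_st H = F (tot_map \<psi> q)"
  shows "osys_pullback \<psi> F q = H"
proof -
  note D = ssub_arrowD[OF interconnection_ssub_arrow[OF \<psi>]]
  obtain g where g: "smooth_map (state (target \<psi>)) (state (source \<psi>)) g"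
      "\<forall>p\<in>points (state (source \<psi>)). g (st_map \<psi> p) = p"
    using \<psi> unfolding interconnection_iff by blast
  have "inj_on T_st (tangent_points (state (source \<psi>)))"
    by (rule inj_on_inverseI[where g = "tangent_map (state (target \<psi>)) (state (source \<psi>)) g"])
       (rule tangent_map_inverse[OF is_ssubD(2)[OF D(1)] is_ssubD(2)[OF D(2)] D(6) g])
  then have "inv_into (tangent_points (state (source \<psi>))) T_st (T_st H) = H"
    using H by (rule inv_into_f_f)
  then show ?thesis using q by (simp add: osys_pullback_def eq)
qed

text \<open>Trades \<open>inv_into\<close> for the tangent map of a smooth inverse \<open>g\<close>,
  from which smoothness and linearity of the pullback can be read.\<close>

lemma osys_pullback_inverse:
  assumes g: "smooth_map (state (target \<psi>)) (state (source \<psi>)) g"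
      "\<forall>p\<in>points (state (target \<psi>)). st_map \<psi> (g p) = p"
    and F: "F \<in> open_systems (target \<psi>)" and q: "q \<in> points (total (source \<psi>))"
  shows "osys_pullback \<psi> F q =
    tangent_map (state (target \<psi>)) (state (source \<psi>)) g (F (tot_map \<psi> q))"
proof -
  note D = ssub_arrowD[OF interconnection_ssub_arrow[OF \<psi>]]
  note a = is_ssubD(2)[OF D(1)] and b = is_ssubD(2)[OF D(2)]
  note Fq = open_systemD(5)[OF D(2) F interconnection_points(1)[OF \<psi> q]]
  show ?thesis
    by (rule osys_pullback_eqI[OF q tangent_map_points[OF b a g(1) Fq]])
       (rule tangent_map_inverse[OF b a g(1) D(6) g(2) Fq])
qed

lemma osys_pullback_in:
  assumes F: "F \<in> open_systems (target \<psi>)"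
  shows "osys_pullback \<psi> F \<in> open_systems (source \<psi>)"
    and "q \<in> points (total (source \<psi>)) \<Longrightarrow> T_st (osys_pullback \<psi> F q) = F (tot_map \<psi> q)"
proof -
  note D = ssub_arrowD[OF interconnection_ssub_arrow[OF \<psi>]]
  note a = is_ssubD[OF D(1)] and b = is_ssubD[OF D(2)]
  note \<psi>p = interconnection_points(1)[OF \<psi>]
  obtain g where g: "smooth_map (state (target \<psi>)) (state (source \<psi>)) g"
      "\<forall>p\<in>points (state (target \<psi>)). st_map \<psi> (g p) = p"
      "\<forall>p\<in>points (state (source \<psi>)). g (st_map \<psi> p) = p"
    using \<psi> unfolding interconnection_iff by blast
  let ?Tg = "tangent_map (state (target \<psi>)) (state (source \<psi>)) g"
  note eq = osys_pullback_inverse[OF g(1,2) F]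
  note FD = open_systemD[OF D(2) F]
  show "T_st (osys_pullback \<psi> F q) = F (tot_map \<psi> q)" if q: "q \<in> points (total (source \<psi>))" for q
    unfolding eq[OF q] by (rule tangent_map_inverse[OF b(2) a(2) g(1) D(6) g(2) FD(5)[OF \<psi>p[OF q]]])
  show "osys_pullback \<psi> F \<in> open_systems (source \<psi>)"
    unfolding open_systems_iff
  proof (intro conjI ballI)
    show "osys_pullback \<psi> F \<in> extensional (points (total (source \<psi>)))"
      by (simp add: osys_pullback_def)
    have "smooth_map (total (source \<psi>)) (tangent_bundle (state (source \<psi>))) (\<lambda>q. ?Tg ((F \<circ> tot_map \<psi>) q))"
      by (rule smooth_tangent_map_compose[OF a(1) b(2) a(2)
            smooth_map_compose[OF a(1) b(1) atlas_tangent_bundle[OF b(2)] D(5) FD(2)] g(1)])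
    then show "smooth_map (total (source \<psi>)) (tangent_bundle (state (source \<psi>))) (osys_pullback \<psi> F)"
      by (rule smooth_map_cong[OF a(1) atlas_tangent_bundle[OF a(2)]]) (simp add: eq)
    fix q assume q: "q \<in> points (total (source \<psi>))"
    note q' = \<psi>p[OF q]
    \<comment> \<open>The base point is right because \<psi> commutes with the submersions and
      \<open>g\<close> undoes \<open>st_map\<close>.\<close>
    have base: "fst (osys_pullback \<psi> F q) = subm (source \<psi>) q"
      using FD(3)[OF q'] D(7)[OF q] bspec[OF g(3) subm_points[OF D(1) q]] by (simp add: eq[OF q])
    then show "fst (osys_pullback \<psi> F q) = subm (source \<psi>) q" .
    have "osys_pullback \<psi> F q \<in> tangent_points (state (source \<psi>))"
      unfolding eq[OF q] by (rule tangent_map_points[OF b(2) a(2) g(1) FD(5)[OF q']])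
    then show "snd (osys_pullback \<psi> F q) \<in> tangent_space (state (source \<psi>)) (subm (source \<psi>) q)"
      using base by (auto simp: tangent_points_def)
  qed
qed

text \<open>The tangent map of \<open>g\<close> is linear on each fibre. The facts
  \<open>base\<close> and \<open>F'\<close> only match base points, which \<open>osys_add\<close>
  and \<open>osys_scale\<close> rebuild from \<open>subm\<close>.\<close>

lemma osys_pullback_linear:
  "linear_map (Crl (target \<psi>)) (Crl (source \<psi>)) (\<lambda>x. Atom (osys_pullback \<psi> (the_atom x)))"
proof -
  note D = ssub_arrowD[OF interconnection_ssub_arrow[OF \<psi>]]
  note a = is_ssubD[OF D(1)] and b = is_ssubD[OF D(2)]
  note \<psi>p = interconnection_points(1)[OF \<psi>]
  obtain g where g: "smooth_map (state (target \<psi>)) (state (source \<psi>)) g"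
      "\<forall>p\<in>points (state (target \<psi>)). st_map \<psi> (g p) = p"
      "\<forall>p\<in>points (state (source \<psi>)). g (st_map \<psi> p) = p"
    using \<psi> unfolding interconnection_iff by blast
  note eq = osys_pullback_inverse[OF g(1,2)]
  note O = osys_add_in[OF D(2)] osys_scale_in[OF D(2)]
  have base: "g (subm (target \<psi>) (tot_map \<psi> q)) = subm (source \<psi>) q" if q: "q \<in> points (total (source \<psi>))" for q
    using D(7)[OF q] bspec[OF g(3) subm_points[OF D(1) q]] by simp
  have F': "F (tot_map \<psi> q) = (subm (target \<psi>) (tot_map \<psi> q), snd (F (tot_map \<psi> q)))"
    if "F \<in> open_systems (target \<psi>)" "q \<in> points (total (source \<psi>))" for F q
    using open_systemD(3)[OF D(2) that(1) \<psi>p[OF that(2)]] by (simp add: prod_eq_iff)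
  have add: "osys_pullback \<psi> (osys_add (target \<psi>) F G) =
      osys_add (source \<psi>) (osys_pullback \<psi> F) (osys_pullback \<psi> G)"
    if F: "F \<in> open_systems (target \<psi>)" and G: "G \<in> open_systems (target \<psi>)" for F G
  proof (rule open_system_eqI[OF D(1) osys_pullback_in(1)[OF O(1)[OF F G]]
        osys_add_in[OF D(1) osys_pullback_in(1)[OF F] osys_pullback_in(1)[OF G]]])
    fix q assume q: "q \<in> points (total (source \<psi>))"
    note q' = \<psi>p[OF q]
    show "osys_pullback \<psi> (osys_add (target \<psi>) F G) q =
        osys_add (source \<psi>) (osys_pullback \<psi> F) (osys_pullback \<psi> G) q"
      using tangent_map_add[OF b(2) a(2) g(1) subm_points[OF D(2) q'] open_systemD(4)[OF D(2) F q']
          open_systemD(4)[OF D(2) G q']] q q' base[OF q]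
      unfolding eq[OF O(1)[OF F G] q]
      by (simp add: osys_add_def eq[OF F q] eq[OF G q] flip: F'[OF F q] F'[OF G q])
  qed
  have scale: "osys_pullback \<psi> (osys_scale (target \<psi>) r F) = osys_scale (source \<psi>) r (osys_pullback \<psi> F)"
    if F: "F \<in> open_systems (target \<psi>)" for F r
  proof (rule open_system_eqI[OF D(1) osys_pullback_in(1)[OF O(2)[OF F]]
        osys_scale_in[OF D(1) osys_pullback_in(1)[OF F]]])
    fix q assume q: "q \<in> points (total (source \<psi>))"
    note q' = \<psi>p[OF q]
    show "osys_pullback \<psi> (osys_scale (target \<psi>) r F) q = osys_scale (source \<psi>) r (osys_pullback \<psi> F) q"
      using tangent_map_scale[OF b(2) a(2) g(1) subm_points[OF D(2) q'] open_systemD(4)[OF D(2) F q'], of r]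
        q q' base[OF q]
      unfolding eq[OF O(2)[OF F] q]
      by (simp add: osys_scale_def eq[OF F q] flip: F'[OF F q])
  qed
  show ?thesis
    by (rule linear_mapI) (auto simp: osys_pullback_in add scale)
qed

lemma Crl_arr_in_hom: "Crl_arr \<psi> \<in> hom_set Vect (Crl (target \<psi>)) (Crl (source \<psi>))"
  using is_vect_arrow_mk[OF module_Crl module_Crl osys_pullback_linear]
    ssub_arrowD(1,2)[OF interconnection_ssub_arrow[OF \<psi>]]
  by (simp add: hom_Vect Crl_arr_def)

end

lemma Crl_arr_simps [simp]:
  "source (Crl_arr \<psi>) = Crl (target \<psi>)" "target (Crl_arr \<psi>) = Crl (source \<psi>)"
  "F \<in> open_systems (target \<psi>) \<Longrightarrow> action (Crl_arr \<psi>) (Atom F) = Atom (osys_pullback \<psi> F)"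
  by (simp_all add: Crl_arr_def)

lemma osys_pullback_id:
  assumes a: "is_ssub a" and F: "F \<in> open_systems a"
  shows "osys_pullback (mk_ssub_arrow a a id id) F = F"
proof -
  note I = interconnection_id[OF a] and A = is_ssubD(2)[OF a]
  note D = ssub_arrowD[OF interconnection_ssub_arrow[OF I], simplified]
  have F': "F \<in> open_systems (target (mk_ssub_arrow a a id id))" using F by simp
  show ?thesis
  proof (rule open_system_eqI[OF a osys_pullback_in(1)[OF I F', simplified] F])
    fix q assume q: "q \<in> points (total a)"
    note Fq = open_systemD(5)[OF a F q]
    show "osys_pullback (mk_ssub_arrow a a id id) F q = F q"
      by (rule osys_pullback_eqI[OF I])
         (use q Fq tangent_map_cong[OF A A D(6) Fq, of "\<lambda>p. p"] tangent_map_id[OF A Fq] in simp_all)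
  qed
qed

text \<open>The iterated pullback is the candidate for \<open>osys_pullback_eqI\<close>: by
  functoriality the tangent map of the composite is applied in two stages, and each stage undoes one
  pullback.\<close>

lemma osys_pullback_comp:
  assumes f: "interconnection f" and g: "interconnection g" and fg: "source g = target f"
    and F: "F \<in> open_systems (target g)"
  shows "osys_pullback (g \<cdot>\<^bsub>SSub_int\<^esub> f) F = osys_pullback f (osys_pullback g F)"
proof -
  let ?h = "g \<cdot>\<^bsub>SSub_int\<^esub> f"
  note Df = ssub_arrowD[OF interconnection_ssub_arrow[OF f]]
  note Dg = ssub_arrowD[OF interconnection_ssub_arrow[OF g], unfolded fg]
  have h: "interconnection ?h" using interconnection_comp[OF f g fg] by simp
  note Dh = ssub_arrowD[OF interconnection_ssub_arrow[OF h]]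
  have st: "source ?h = source f" "target ?h = target g" by simp_all
  have G: "osys_pullback g F \<in> open_systems (target f)"
    using osys_pullback_in(1)[OF g F] fg by simp
  note H = osys_pullback_in[OF f G]
  have F': "F \<in> open_systems (target ?h)" using F by simp
  note a = is_ssubD(2)[OF Df(1)] and b = is_ssubD(2)[OF Df(2)] and c = is_ssubD(2)[OF Dg(2)]
  show ?thesis
  proof (rule open_system_eqI[OF Df(1) osys_pullback_in(1)[OF h F', unfolded st] H(1)])
    fix q assume q: "q \<in> points (total (source f))"
    let ?H = "osys_pullback f (osys_pullback g F) q"
    note Hq = open_systemD(5)[OF Df(1) H(1) q]
    note fq = interconnection_points(1)[OF f q]
    have "tangent_map (state (source f)) (state (target g)) (st_map ?h) ?H =
        tangent_map (state (source f)) (state (target g)) (st_map g \<circ> st_map f) ?H"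
      by (rule tangent_map_cong[OF a c Dh(6)[unfolded st] Hq]) simp
    also have "\<dots> = tangent_map (state (target f)) (state (target g)) (st_map g)
        (tangent_map (state (source f)) (state (target f)) (st_map f) ?H)"
      by (rule tangent_map_compose[OF a b c Df(6) Dg(6) Hq])
    also have "\<dots> = F (tot_map g (tot_map f q))"
      using H(2)[OF q] osys_pullback_in(2)[OF g F, unfolded fg, OF fq] by simp
    finally show "osys_pullback ?h F q = ?H"
      by (intro osys_pullback_eqI[OF h]) (use q Hq in simp_all)
  qed
qed

lemma category_functor_Crl: "category_functor (opposite SSub_int) Vect Crl Crl_arr"
proof (intro category_functor.intro category_functor_axioms.intro)
  show "category (opposite SSub_int)"
    by (rule monoidal_category.axioms(1)[OF monoidal_category_opposite[OF monoidal_category_SSub_int]])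
  show "category Vect"
    by (rule monoidal_category.axioms(1)[OF monoidal_category_Vect])
  show "Crl a \<in> Obj Vect" if "a \<in> Obj (opposite SSub_int)" for a
    using that by (simp add: module_Crl)
  show "Crl_arr f \<in> hom_set Vect (Crl a) (Crl b)" if "f \<in> hom_set (opposite SSub_int) a b" for f a b
    using that Crl_arr_in_hom[of f] by (auto simp: hom_SSub_int)
  show "Crl_arr (Ide (opposite SSub_int) a) = Ide Vect (Crl a)" if "a \<in> Obj (opposite SSub_int)" for a
    using that unfolding Crl_arr_def
    by (auto intro!: mk_vect_arrow_cong simp: osys_pullback_id)
  show "Crl_arr (g \<cdot>\<^bsub>opposite SSub_int\<^esub> f) = Crl_arr g \<cdot>\<^bsub>Vect\<^esub> Crl_arr f"
    if "f \<in> hom_set (opposite SSub_int) a b" "g \<in> hom_set (opposite SSub_int) b c" for f g a b c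
  proof -
    have fg: "interconnection f" "interconnection g" "source f = target g"
      using that by (auto simp: hom_SSub_int)
    show ?thesis
      unfolding opposite_simps Vect_simps Crl_arr_def[of "f \<cdot>\<^bsub>SSub_int\<^esub> g"]
      using osys_pullback_comp[OF fg(2,1,3)] osys_pullback_in(1)[OF fg(1)] fg(3)
      by (auto intro!: mk_vect_arrow_cong)
  qed
qed

section \<open>The lax monoidal structure\<close>

text \<open>Both projections are linear on fibres, so the sum of two pairs has the required
  projections.\<close>

lemma tangent_pair_add:
  assumes M: "atlas_manifold M" and N: "atlas_manifold N"
    and p: "p \<in> points M" and q: "q \<in> points N"
    and v: "v \<in> tangent_space M p" "v' \<in> tangent_space M p"
    and w: "w \<in> tangent_space N q" "w' \<in> tangent_space N q"
  shows "tangent_pair M N (p, \<lambda>c i. v c i + v' c i) (q, \<lambda>c i. w c i + w' c i) =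
    (Tup p q, \<lambda>c i. snd (tangent_pair M N (p, v) (q, w)) c i + snd (tangent_pair M N (p, v') (q, w')) c i)"
proof -
  note P = atlas_prod[OF M N] and s1 = smooth_tfst[OF M N] and s2 = smooth_tsnd[OF M N]
  have z: "Tup p q \<in> points (prod_manifold M N)" using p q by simp
  have *: "tangent_map (prod_manifold M N) M tfst (Tup p q, snd (tangent_pair M N (p, v) (q, w))) = (p, v)"
    "tangent_map (prod_manifold M N) N tsnd (Tup p q, snd (tangent_pair M N (p, v) (q, w))) = (q, w)"
    "snd (tangent_pair M N (p, v) (q, w)) \<in> tangent_space (prod_manifold M N) (Tup p q)"
    if "v \<in> tangent_space M p" "w \<in> tangent_space N q" for v w
  proof -
    have x: "(p, v) \<in> tangent_points M" and y: "(q, w) \<in> tangent_points N"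
      using that p q by (simp_all add: tangent_points_def)
    have "tangent_pair M N (p, v) (q, w) = (Tup p q, snd (tangent_pair M N (p, v) (q, w)))"
      using fst_tangent_pair[OF M N x y] by (simp add: prod_eq_iff)
    with tangent_pair[OF M N x y] show "tangent_map (prod_manifold M N) M tfst (Tup p q, snd (tangent_pair M N (p, v) (q, w))) = (p, v)"
      "tangent_map (prod_manifold M N) N tsnd (Tup p q, snd (tangent_pair M N (p, v) (q, w))) = (q, w)"
      "snd (tangent_pair M N (p, v) (q, w)) \<in> tangent_space (prod_manifold M N) (Tup p q)"
      by (simp_all add: tangent_points_def) (metis SigmaE2)
  qed
  show ?thesis
  proof (rule tangent_pair_eqI[OF M N])
    show "(Tup p q, \<lambda>c i. snd (tangent_pair M N (p, v) (q, w)) c i + snd (tangent_pair M N (p, v') (q, w')) c i)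
        \<in> tangent_points (prod_manifold M N)"
      using z tangent_add[OF *(3)[OF v(1) w(1)] *(3)[OF v(2) w(2)]] by (simp add: tangent_points_def)
    show "tangent_map (prod_manifold M N) M tfst
        (Tup p q, \<lambda>c i. snd (tangent_pair M N (p, v) (q, w)) c i + snd (tangent_pair M N (p, v') (q, w')) c i) =
        (p, \<lambda>c i. v c i + v' c i)"
      using tangent_map_add[OF P M s1 z *(3)[OF v(1) w(1)] *(3)[OF v(2) w(2)]]
        *(1)[OF v(1) w(1)] *(1)[OF v(2) w(2)] by simp
    show "tangent_map (prod_manifold M N) N tsnd
        (Tup p q, \<lambda>c i. snd (tangent_pair M N (p, v) (q, w)) c i + snd (tangent_pair M N (p, v') (q, w')) c i) =
        (q, \<lambda>c i. w c i + w' c i)"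
      using tangent_map_add[OF P N s2 z *(3)[OF v(1) w(1)] *(3)[OF v(2) w(2)]]
        *(2)[OF v(1) w(1)] *(2)[OF v(2) w(2)] by simp
  qed (use p q tangent_add[OF v] tangent_add[OF w] in \<open>simp_all add: tangent_points_def\<close>)
qed

lemma tangent_pair_scale:
  assumes M: "atlas_manifold M" and N: "atlas_manifold N"
    and p: "p \<in> points M" and q: "q \<in> points N"
    and v: "v \<in> tangent_space M p" and w: "w \<in> tangent_space N q"
  shows "tangent_pair M N (p, \<lambda>c i. r * v c i) (q, \<lambda>c i. r * w c i) =
    (Tup p q, \<lambda>c i. r * snd (tangent_pair M N (p, v) (q, w)) c i)"
proof -
  note P = atlas_prod[OF M N] and s1 = smooth_tfst[OF M N] and s2 = smooth_tsnd[OF M N]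
  have z: "Tup p q \<in> points (prod_manifold M N)" using p q by simp
  have x: "(p, v) \<in> tangent_points M" and y: "(q, w) \<in> tangent_points N"
    using v w p q by (simp_all add: tangent_points_def)
  let ?u = "snd (tangent_pair M N (p, v) (q, w))"
  have eq: "tangent_pair M N (p, v) (q, w) = (Tup p q, ?u)"
    using fst_tangent_pair[OF M N x y] by (simp add: prod_eq_iff)
  have *: "(Tup p q, ?u) \<in> tangent_points (prod_manifold M N)"
    "tangent_map (prod_manifold M N) M tfst (Tup p q, ?u) = (p, v)"
    "tangent_map (prod_manifold M N) N tsnd (Tup p q, ?u) = (q, w)"
    using tangent_pair[OF M N x y] unfolding eq[symmetric] by simp_all
  have u: "?u \<in> tangent_space (prod_manifold M N) (Tup p q)"
    using *(1) by (simp add: tangent_points_def)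
  show ?thesis
    by (rule tangent_pair_eqI[OF M N])
       (use p q v w z u *(2,3) tangent_map_scale[OF P M s1 z u, of r] tangent_map_scale[OF P N s2 z u, of r]
         in \<open>simp_all add: tangent_points_def tangent_scale\<close>)
qed

section \<open>Products of open systems and the structure maps\<close>

definition osys_prod :: "'p ssub \<Rightarrow> 'p ssub \<Rightarrow> 'p osys \<Rightarrow> 'p osys \<Rightarrow> 'p osys" where
  "osys_prod a b F G = (\<lambda>z\<in>points (total (ssub_prod a b)).
     tangent_pair (state a) (state b) (F (tfst z)) (G (tsnd z)))"

lemma osys_prod_Tup:
  "x \<in> points (total a) \<Longrightarrow> y \<in> points (total b) \<Longrightarrow>
    osys_prod a b F G (Tup x y) = tangent_pair (state a) (state b) (F x) (G y)"
  by (simp add: osys_prod_def)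

context
  fixes a b :: "'p ssub"
  assumes a: "is_ssub a" and b: "is_ssub b"
begin

lemma osys_prod_in:
  assumes F: "F \<in> open_systems a" and G: "G \<in> open_systems b"
  shows "osys_prod a b F G \<in> open_systems (ssub_prod a b)"
  unfolding open_systems_iff
proof (intro conjI ballI)
  note A = is_ssubD[OF a] and B = is_ssubD[OF b]
  note TT = atlas_prod[OF A(1) B(1)] and SS = atlas_prod[OF A(2) B(2)]
  note FD = open_systemD[OF a F] and GD = open_systemD[OF b G]
  show "osys_prod a b F G \<in> extensional (points (total (ssub_prod a b)))"
    by (simp add: osys_prod_def)
  have "smooth_map (prod_manifold (total a) (total b)) (tangent_bundle (prod_manifold (state a) (state b)))
      (\<lambda>z. tangent_pair (state a) (state b) ((F \<circ> tfst) z) ((G \<circ> tsnd) z))"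
    by (rule smooth_tangent_pair[OF A(2) B(2) TT
          smooth_map_compose[OF TT A(1) atlas_tangent_bundle[OF A(2)] smooth_tfst[OF A(1) B(1)] FD(2)]
          smooth_map_compose[OF TT B(1) atlas_tangent_bundle[OF B(2)] smooth_tsnd[OF A(1) B(1)] GD(2)]])
  then have "smooth_map (prod_manifold (total a) (total b)) (tangent_bundle (prod_manifold (state a) (state b)))
      (osys_prod a b F G)"
    by (rule smooth_map_cong[OF TT atlas_tangent_bundle[OF SS]]) (simp add: osys_prod_def)
  then show "smooth_map (total (ssub_prod a b)) (tangent_bundle (state (ssub_prod a b))) (osys_prod a b F G)"
    by simp
  fix z assume "z \<in> points (total (ssub_prod a b))"
  then obtain x y where xy: "z = Tup x y" "x \<in> points (total a)" "y \<in> points (total b)"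
    by (auto elim: tup_timesE)
  note Fx = FD(5)[OF xy(2)] and Gy = GD(5)[OF xy(3)]
  have 1: "fst (osys_prod a b F G z) = subm (ssub_prod a b) z"
    using fst_tangent_pair[OF A(2) B(2) Fx Gy] FD(3)[OF xy(2)] GD(3)[OF xy(3)] xy
    by (simp add: osys_prod_Tup)
  then show "fst (osys_prod a b F G z) = subm (ssub_prod a b) z" .
  have "osys_prod a b F G z \<in> tangent_points (prod_manifold (state a) (state b))"
    using tangent_pair(1)[OF A(2) B(2) Fx Gy] xy by (simp add: osys_prod_Tup)
  then show "snd (osys_prod a b F G z) \<in> tangent_space (state (ssub_prod a b)) (subm (ssub_prod a b) z)"
    unfolding 1[symmetric] by (auto simp: tangent_points_def)
qed

lemma osys_prod_add:
  assumes F: "F \<in> open_systems a" "F' \<in> open_systems a" and G: "G \<in> open_systems b" "G' \<in> open_systems b"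
  shows "osys_prod a b (osys_add a F F') (osys_add b G G') =
    osys_add (ssub_prod a b) (osys_prod a b F G) (osys_prod a b F' G')"
proof (rule open_system_eqI[OF is_ssub_prod[OF a b] osys_prod_in[OF osys_add_in[OF a F] osys_add_in[OF b G]]
      osys_add_in[OF is_ssub_prod[OF a b] osys_prod_in[OF F(1) G(1)] osys_prod_in[OF F(2) G(2)]]])
  fix z assume "z \<in> points (total (ssub_prod a b))"
  then obtain x y where xy: "z = Tup x y" "x \<in> points (total a)" "y \<in> points (total b)"
    by (auto elim: tup_timesE)
  have eq: "(subm a x, snd (F x)) = F x" "(subm a x, snd (F' x)) = F' x"
    "(subm b y, snd (G y)) = G y" "(subm b y, snd (G' y)) = G' y"
    using open_systemD(3)[OF a F(1) xy(2)] open_systemD(3)[OF a F(2) xy(2)]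
      open_systemD(3)[OF b G(1) xy(3)] open_systemD(3)[OF b G(2) xy(3)] by (simp_all add: prod_eq_iff)
  show "osys_prod a b (osys_add a F F') (osys_add b G G') z =
      osys_add (ssub_prod a b) (osys_prod a b F G) (osys_prod a b F' G') z"
    using tangent_pair_add[OF is_ssubD(2)[OF a] is_ssubD(2)[OF b] subm_points[OF a xy(2)] subm_points[OF b xy(3)]
        open_systemD(4)[OF a F(1) xy(2)] open_systemD(4)[OF a F(2) xy(2)]
        open_systemD(4)[OF b G(1) xy(3)] open_systemD(4)[OF b G(2) xy(3)]] xy
    by (simp add: osys_prod_Tup osys_add_def eq)
qed

lemma osys_prod_scale:
  assumes F: "F \<in> open_systems a" and G: "G \<in> open_systems b"
  shows "osys_prod a b (osys_scale a r F) (osys_scale b r G) = osys_scale (ssub_prod a b) r (osys_prod a b F G)"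
proof (rule open_system_eqI[OF is_ssub_prod[OF a b] osys_prod_in[OF osys_scale_in[OF a F] osys_scale_in[OF b G]]
      osys_scale_in[OF is_ssub_prod[OF a b] osys_prod_in[OF F G]]])
  fix z assume "z \<in> points (total (ssub_prod a b))"
  then obtain x y where xy: "z = Tup x y" "x \<in> points (total a)" "y \<in> points (total b)"
    by (auto elim: tup_timesE)
  have eq: "(subm a x, snd (F x)) = F x" "(subm b y, snd (G y)) = G y"
    using open_systemD(3)[OF a F xy(2)] open_systemD(3)[OF b G xy(3)] by (simp_all add: prod_eq_iff)
  show "osys_prod a b (osys_scale a r F) (osys_scale b r G) z =
      osys_scale (ssub_prod a b) r (osys_prod a b F G) z"
    using tangent_pair_scale[OF is_ssubD(2)[OF a] is_ssubD(2)[OF b] subm_points[OF a xy(2)] subm_points[OF b xy(3)]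
        open_systemD(4)[OF a F xy(2)] open_systemD(4)[OF b G xy(3)], of r] xy
    by (simp add: osys_prod_Tup osys_scale_def eq)
qed

end

definition Crl_mult :: "'p ssub \<Rightarrow> 'p ssub \<Rightarrow> 'p osys vect_arrow" where
  "Crl_mult a b = mk_vect_arrow (direct_sum (Crl a) (Crl b)) (Crl (ssub_prod a b))
     (\<lambda>z. Atom (osys_prod a b (the_atom (tfst z)) (the_atom (tsnd z))))"

text \<open>A linear map out of the zero space must send \<open>Pt\<close> to the zero
  vector.\<close>

definition Crl_unit :: "'p osys vect_arrow" where
  "Crl_unit = mk_vect_arrow zero_vect (Crl ssub_unit) (\<lambda>_. Atom (osys_zero ssub_unit))"

lemma Crl_mult_simps [simp]:
  "source (Crl_mult a b) = direct_sum (Crl a) (Crl b)" "target (Crl_mult a b) = Crl (ssub_prod a b)"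
  "F \<in> open_systems a \<Longrightarrow> G \<in> open_systems b \<Longrightarrow>
    action (Crl_mult a b) (Tup (Atom F) (Atom G)) = Atom (osys_prod a b F G)"
  by (simp_all add: Crl_mult_def)

lemma Crl_unit_simps [simp]:
  "source Crl_unit = zero_vect" "target Crl_unit = Crl ssub_unit"
  "action Crl_unit Pt = Atom (osys_zero ssub_unit)"
  by (simp_all add: Crl_unit_def)

lemma Crl_mult_in_hom:
  assumes a: "is_ssub a" and b: "is_ssub b"
  shows "Crl_mult a b \<in> hom_set Vect (direct_sum (Crl a) (Crl b)) (Crl (ssub_prod a b))"
proof -
  have "linear_map (direct_sum (Crl a) (Crl b)) (Crl (ssub_prod a b))
      (\<lambda>z. Atom (osys_prod a b (the_atom (tfst z)) (the_atom (tsnd z))))"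
    by (rule linear_mapI)
       (auto elim!: tup_timesE simp: osys_prod_in[OF a b] osys_prod_add[OF a b] osys_prod_scale[OF a b])
  then show ?thesis
    using is_vect_arrow_mk[OF module_direct_sum[OF module_Crl[OF a] module_Crl[OF b]]
        module_Crl[OF is_ssub_prod[OF a b]]] by (simp add: hom_Vect Crl_mult_def)
qed

lemma Crl_unit_in_hom: "Crl_unit \<in> hom_set Vect zero_vect (Crl ssub_unit)"
proof -
  have 1: "osys_add ssub_unit (osys_zero ssub_unit) (osys_zero ssub_unit) = osys_zero ssub_unit"
    "osys_scale ssub_unit r (osys_zero ssub_unit) = osys_zero ssub_unit" for r
    by (auto simp: osys_add_def osys_scale_def osys_zero_def intro!: restrict_ext)
  have "linear_map zero_vect (Crl ssub_unit) (\<lambda>_. Atom (osys_zero ssub_unit))"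
    by (rule linear_mapI) (auto simp: osys_zero_in[OF is_ssub_unit] 1)
  then show ?thesis
    using is_vect_arrow_mk[OF module_zero_vect module_Crl[OF is_ssub_unit]] by (simp add: hom_Vect Crl_unit_def)
qed

text \<open>By \<open>tangent_map_tup_map\<close> the tangent map of the product arrow sends the
  pair of pullbacks to the pair of the values of \<open>F\<close> and \<open>G\<close>, so this pair
  is the pullback of the product system.\<close>

lemma osys_prod_natural:
  assumes f: "interconnection f" and g: "interconnection g"
    and F: "F \<in> open_systems (target f)" and G: "G \<in> open_systems (target g)"
  shows "osys_prod (source f) (source g) (osys_pullback f F) (osys_pullback g G) =
    osys_pullback (f \<boxdot>\<^bsub>SSub_int\<^esub> g) (osys_prod (target f) (target g) F G)"
proof -
  let ?h = "f \<boxdot>\<^bsub>SSub_int\<^esub> g"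
  have h: "interconnection ?h" using interconnection_tensor[OF f g] by simp
  have st: "source ?h = ssub_prod (source f) (source g)" "target ?h = ssub_prod (target f) (target g)" by simp_all
  note Df = ssub_arrowD[OF interconnection_ssub_arrow[OF f]]
  note Dg = ssub_arrowD[OF interconnection_ssub_arrow[OF g]]
  note Dh = ssub_arrowD[OF interconnection_ssub_arrow[OF h], unfolded st]
  note S = is_ssubD(2)[OF Df(1)] is_ssubD(2)[OF Dg(1)] and T = is_ssubD(2)[OF Df(2)] is_ssubD(2)[OF Dg(2)]
  note Pf = osys_pullback_in[OF f F] and Pg = osys_pullback_in[OF g G]
  have FG: "osys_prod (target f) (target g) F G \<in> open_systems (target ?h)"
    using osys_prod_in[OF Df(2) Dg(2) F G] by simp
  show ?thesis
  proof (rule open_system_eqI[OF Dh(1) osys_prod_in[OF Df(1) Dg(1) Pf(1) Pg(1)] osys_pullback_in(1)[OF h FG, unfolded st]])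
    fix z assume z: "z \<in> points (total (ssub_prod (source f) (source g)))"
    then obtain x y where xy: "z = Tup x y" "x \<in> points (total (source f))" "y \<in> points (total (source g))"
      by (auto elim: tup_timesE)
    let ?H = "tangent_pair (state (source f)) (state (source g)) (osys_pullback f F x) (osys_pullback g G y)"
    note H = tangent_pair[OF S open_systemD(5)[OF Df(1) Pf(1) xy(2)] open_systemD(5)[OF Dg(1) Pg(1) xy(3)]]
    have Tz: "tot_map ?h z = Tup (tot_map f x) (tot_map g y)" using xy by simp
    have "tangent_map (state (source ?h)) (state (target ?h)) (st_map ?h) ?H =
        tangent_map (prod_manifold (state (source f)) (state (source g)))
          (prod_manifold (state (target f)) (state (target g))) (tup_map (st_map f) (st_map g)) ?H"
      unfolding st ssub_prod_simps
      by (rule tangent_map_cong[OF atlas_prod[OF S] atlas_prod[OF T] Dh(6)[unfolded ssub_prod_simps] H(1)]) simp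
    also have "\<dots> = osys_prod (target f) (target g) F G (tot_map ?h z)"
      unfolding tangent_map_tup_map[OF S T Df(6) Dg(6) H(1)] H(2,3) Pf(2)[OF xy(2)] Pg(2)[OF xy(3)] Tz
      by (rule osys_prod_Tup[symmetric, OF interconnection_points(1)[OF f xy(2)] interconnection_points(1)[OF g xy(3)]])
    finally have "osys_pullback ?h (osys_prod (target f) (target g) F G) z = ?H"
      by (intro osys_pullback_eqI[OF h]) (use z H(1) in simp_all)
    then show "osys_prod (source f) (source g) (osys_pullback f F) (osys_pullback g G) z =
        osys_pullback ?h (osys_prod (target f) (target g) F G) z"
      using xy by (simp add: osys_prod_Tup)
  qed
qed

text \<open>\<open>osys_pullback_eqI\<close> for whole systems and for arrows made by
  \<open>mk_ssub_arrow\<close>: the condition is stated with \<open>g\<close> itself instead of its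
  restriction, so that it can be supplied by lemmas about projections and tuples.\<close>

lemma osys_pullback_mk_eqI:
  assumes \<psi>: "interconnection (mk_ssub_arrow a b f g)" and g: "smooth_map (state a) (state b) g"
    and F: "F \<in> open_systems b" and G: "G \<in> open_systems a"
    and eq: "\<And>q. q \<in> points (total a) \<Longrightarrow> tangent_map (state a) (state b) g (G q) = F (f q)"
  shows "osys_pullback (mk_ssub_arrow a b f g) F = G"
proof -
  let ?\<psi> = "mk_ssub_arrow a b f g"
  note D = ssub_arrowD[OF interconnection_ssub_arrow[OF \<psi>], simplified]
  note A = is_ssubD(2)[OF D(1)] and B = is_ssubD(2)[OF D(2)]
  have F': "F \<in> open_systems (target ?\<psi>)" using F by simp
  show ?thesis
  proof (rule open_system_eqI[OF D(1) osys_pullback_in(1)[OF \<psi> F', simplified] G])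
    fix q assume q: "q \<in> points (total a)"
    note Gq = open_systemD(5)[OF D(1) G q]
    have "tangent_map (state a) (state b) (restrict g (points (state a))) (G q) =
        tangent_map (state a) (state b) g (G q)"
      by (rule tangent_map_cong[OF A B D(6) Gq]) simp
    then show "osys_pullback ?\<psi> F q = G q"
      by (intro osys_pullback_eqI[OF \<psi>]) (use q Gq eq in simp_all)
  qed
qed

text \<open>Both sides have the same images in the tangent bundles of the three factors; each image
  is found by composing \<open>tup_unassoc\<close> with projections. The nested pairs require
  \<open>tangent_pair_eqI\<close> twice.\<close>

lemma tangent_map_unassoc:
  assumes M: "atlas_manifold M" and N: "atlas_manifold N" and P: "atlas_manifold P"
    and x: "x \<in> tangent_points M" and y: "y \<in> tangent_points N" and z: "z \<in> tangent_points P"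
  shows "tangent_map (prod_manifold M (prod_manifold N P)) (prod_manifold (prod_manifold M N) P) tup_unassoc
      (tangent_pair M (prod_manifold N P) x (tangent_pair N P y z)) =
    tangent_pair (prod_manifold M N) P (tangent_pair M N x y) z"
proof -
  note MN = atlas_prod[OF M N] and NP = atlas_prod[OF N P]
  note L = atlas_prod[OF MN P] and R = atlas_prod[OF M NP]
  note yz = tangent_pair[OF N P y z]
  note w = tangent_pair[OF M NP x yz(1)]
  note l1 = smooth_tfst[OF MN P] and l2 = smooth_tsnd[OF MN P]
  note r1 = smooth_tfst[OF M NP] and r2 = smooth_tsnd[OF M NP]
  note u = smooth_tup_assoc(2)[OF M N P]
  let ?R = "prod_manifold M (prod_manifold N P)" and ?L = "prod_manifold (prod_manifold M N) P"
  let ?w = "tangent_pair M (prod_manifold N P) x (tangent_pair N P y z)"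
  let ?u = "tangent_map ?R ?L tup_unassoc ?w"
  note u' = tangent_map_points[OF R L u w(1)]
  note t1 = tangent_map_points[OF L MN l1 u']
  note u1 = smooth_map_compose[OF R L MN u l1]
  have "tangent_map (prod_manifold M N) M tfst (tangent_map ?L (prod_manifold M N) tfst ?u) =
      tangent_map ?R M (tfst \<circ> (tfst \<circ> tup_unassoc)) ?w"
    unfolding tangent_map_compose[OF R MN M u1 smooth_tfst[OF M N] w(1)] tangent_map_compose[OF R L MN u l1 w(1)] ..
  also have "tfst \<circ> (tfst \<circ> tup_unassoc) = tfst" by (simp add: tup_unassoc_def fun_eq_iff)
  finally have 1: "tangent_map (prod_manifold M N) M tfst (tangent_map ?L (prod_manifold M N) tfst ?u) = x"
    using w(2) by simp
  have "tangent_map (prod_manifold M N) N tsnd (tangent_map ?L (prod_manifold M N) tfst ?u) =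
      tangent_map ?R N (tsnd \<circ> (tfst \<circ> tup_unassoc)) ?w"
    unfolding tangent_map_compose[OF R MN N u1 smooth_tsnd[OF M N] w(1)] tangent_map_compose[OF R L MN u l1 w(1)] ..
  also have "tsnd \<circ> (tfst \<circ> tup_unassoc) = tfst \<circ> tsnd" by (simp add: tup_unassoc_def fun_eq_iff)
  also have "tangent_map ?R N (tfst \<circ> tsnd) ?w = y"
    using tangent_map_compose[OF R NP N r2 smooth_tfst[OF N P] w(1)] w(3) yz(2) by simp
  finally have 2: "tangent_map (prod_manifold M N) N tsnd (tangent_map ?L (prod_manifold M N) tfst ?u) = y" .
  have "tangent_map ?L P tsnd ?u = tangent_map ?R P (tsnd \<circ> tup_unassoc) ?w"
    by (rule tangent_map_compose[OF R L P u l2 w(1), symmetric])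
  also have "tsnd \<circ> tup_unassoc = tsnd \<circ> tsnd" by (simp add: tup_unassoc_def fun_eq_iff)
  also have "tangent_map ?R P (tsnd \<circ> tsnd) ?w = z"
    using tangent_map_compose[OF R NP P r2 smooth_tsnd[OF N P] w(1)] w(3) yz(3) by simp
  finally have 3: "tangent_map ?L P tsnd ?u = z" .
  show ?thesis
    by (rule tangent_pair_eqI[OF MN P u' tangent_pair_eqI[OF M N t1 1 2 x y, symmetric] 3
          tangent_pair(1)[OF M N x y] z, symmetric])
qed

text \<open>In dimension 0 the only coordinate vector is 0. In the unit laws this settles the
  component in the tangent bundle of the point.\<close>

lemma tangent_points_point_unique:
  assumes "x \<in> tangent_points (point_manifold :: 'a tup manifold)" "y \<in> tangent_points (point_manifold :: 'a tup manifold)"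
  shows "x = y"
proof -
  note P = smooth_imp_atlas_manifold[OF point_manifold]
  have xy: "fst x = Pt" "fst y = Pt" "snd x \<in> tangent_space point_manifold Pt" "snd y \<in> tangent_space point_manifold Pt"
    using assms by (auto simp: tangent_points_def)
  obtain c :: "'a tup chart" where c: "c \<in> charts_at point_manifold Pt"
    using charts_at_ex[OF P, of Pt] by auto
  have "mdim (point_manifold :: 'a tup manifold) = 0" by (simp add: point_manifold_def manifold_of_atlas_def)
  then have "snd x c = snd y c"
    using tangent_space_in_Eucl[OF xy(3) c] tangent_space_in_Eucl[OF xy(4) c] by (simp add: Eucl_iff fun_eq_iff)
  then have "snd x = snd y" by (rule tangent_eqI[OF xy(3,4) c])
  then show ?thesis using xy by (simp add: prod_eq_iff)
qed

text \<open>Projecting back to \<open>M\<close> gives the tangent map of the identity, and the other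
  component has only one possible value.\<close>

lemma tangent_map_Tup_Pt:
  assumes M: "atlas_manifold M" and v: "v \<in> tangent_points M" and pt: "pt \<in> tangent_points point_manifold"
  shows "tangent_map M (prod_manifold point_manifold M) (Tup Pt) v = tangent_pair point_manifold M pt v"
    and "tangent_map M (prod_manifold M point_manifold) (\<lambda>x. Tup x Pt) v = tangent_pair M point_manifold v pt"
proof -
  note P = smooth_imp_atlas_manifold[OF point_manifold]
  note PM = atlas_prod[OF P M] and MP = atlas_prod[OF M P]
  note i1 = smooth_Tup[OF P M M smooth_map_point[OF M] smooth_map_id[OF M]]
  note i2 = smooth_Tup[OF M P M smooth_map_id[OF M] smooth_map_point[OF M]]
  note t1 = tangent_map_points[OF M PM i1 v] and t2 = tangent_map_points[OF M MP i2 v]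
  have "tangent_map (prod_manifold point_manifold M) M tsnd
      (tangent_map M (prod_manifold point_manifold M) (Tup Pt) v) = tangent_map M M (tsnd \<circ> Tup Pt) v"
    by (rule tangent_map_compose[OF M PM M i1 smooth_tsnd[OF P M] v, symmetric])
  also have "tsnd \<circ> Tup Pt = (\<lambda>x. x)" by (simp add: fun_eq_iff)
  also have "tangent_map M M (\<lambda>x. x) v = v" by (rule tangent_map_id[OF M v])
  finally have 1: "tangent_map (prod_manifold point_manifold M) M tsnd
      (tangent_map M (prod_manifold point_manifold M) (Tup Pt) v) = v" .
  have "tangent_map (prod_manifold M point_manifold) M tfst
      (tangent_map M (prod_manifold M point_manifold) (\<lambda>x. Tup x Pt) v) = tangent_map M M (tfst \<circ> (\<lambda>x. Tup x Pt)) v"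
    by (rule tangent_map_compose[OF M MP M i2 smooth_tfst[OF M P] v, symmetric])
  also have "tfst \<circ> (\<lambda>x. Tup x Pt) = (\<lambda>x. x)" by (simp add: fun_eq_iff)
  also have "tangent_map M M (\<lambda>x. x) v = v" by (rule tangent_map_id[OF M v])
  finally have 2: "tangent_map (prod_manifold M point_manifold) M tfst
      (tangent_map M (prod_manifold M point_manifold) (\<lambda>x. Tup x Pt) v) = v" .
  show "tangent_map M (prod_manifold point_manifold M) (Tup Pt) v = tangent_pair point_manifold M pt v"
    by (rule tangent_pair_eqI[OF P M t1 tangent_points_point_unique[OF tangent_map_points[OF PM P smooth_tfst[OF P M] t1] pt]
          1 pt v, symmetric])
  show "tangent_map M (prod_manifold M point_manifold) (\<lambda>x. Tup x Pt) v = tangent_pair M point_manifold v pt"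
    by (rule tangent_pair_eqI[OF M P t2 2 tangent_points_point_unique[OF tangent_map_points[OF MP P smooth_tsnd[OF M P] t2] pt]
          v pt, symmetric])
qed

text \<open>The inverse of the associator is \<open>tup_unassoc\<close>, starting at
  \<open>ssub_prod a (ssub_prod b c)\<close>; pulling back along it therefore carries systems
  bracketed to the left to systems bracketed to the right, as the associativity law demands.
  Pointwise the claim is \<open>tangent_map_unassoc\<close>.\<close>

lemma osys_pullback_associator:
  assumes a: "is_ssub a" and b: "is_ssub b" and c: "is_ssub c"
    and F: "F \<in> open_systems a" and G: "G \<in> open_systems b" and H: "H \<in> open_systems c"
  shows "osys_pullback (inverse_arrow SSub_int (associator SSub_int a b c))
      (osys_prod (ssub_prod a b) c (osys_prod a b F G) H) =
    osys_prod a (ssub_prod b c) F (osys_prod b c G H)"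
proof -
  interpret monoidal_category SSub_int by (rule monoidal_category_SSub_int)
  note \<alpha> = ssub_associator[OF a b c]
  note A = is_ssubD(2)[OF a] and B = is_ssubD(2)[OF b] and C = is_ssubD(2)[OF c]
  show ?thesis
    unfolding SSub_int_simps inverse_arrow_eq[OF \<alpha>(3)]
  proof (rule osys_pullback_mk_eqI[OF \<alpha>(2)]; (simp only: ssub_prod_simps)?)
    show "smooth_map (prod_manifold (state a) (prod_manifold (state b) (state c)))
        (prod_manifold (prod_manifold (state a) (state b)) (state c)) tup_unassoc"
      by (rule smooth_tup_assoc(2)[OF A B C])
    show "osys_prod (ssub_prod a b) c (osys_prod a b F G) H \<in> open_systems (ssub_prod (ssub_prod a b) c)"
      by (rule osys_prod_in[OF is_ssub_prod[OF a b] c osys_prod_in[OF a b F G] H])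
    show "osys_prod a (ssub_prod b c) F (osys_prod b c G H) \<in> open_systems (ssub_prod a (ssub_prod b c))"
      by (rule osys_prod_in[OF a is_ssub_prod[OF b c] F osys_prod_in[OF b c G H]])
    fix q assume "q \<in> points (prod_manifold (total a) (prod_manifold (total b) (total c)))"
    then obtain x y z where q: "q = Tup x (Tup y z)" "x \<in> points (total a)" "y \<in> points (total b)" "z \<in> points (total c)"
      by (auto elim!: tup_timesE)
    show "tangent_map (prod_manifold (state a) (prod_manifold (state b) (state c)))
        (prod_manifold (prod_manifold (state a) (state b)) (state c)) tup_unassoc
        (osys_prod a (ssub_prod b c) F (osys_prod b c G H) q) =
        osys_prod (ssub_prod a b) c (osys_prod a b F G) H (tup_unassoc q)"
      using tangent_map_unassoc[OF A B C open_systemD(5)[OF a F q(2)] open_systemD(5)[OF b G q(3)]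
          open_systemD(5)[OF c H q(4)]] q by (simp add: osys_prod_Tup)
  qed
qed

text \<open>The inverse unitors insert \<open>Pt\<close>, and their tangent maps insert the only
  tangent vector of the point, which is the value of the zero system.\<close>

lemma osys_pullback_unitors:
  assumes a: "is_ssub a" and F: "F \<in> open_systems a"
  shows "osys_pullback (inverse_arrow SSub_int (left_unitor SSub_int a))
      (osys_prod ssub_unit a (osys_zero ssub_unit) F) = F"
    and "osys_pullback (inverse_arrow SSub_int (right_unitor SSub_int a))
      (osys_prod a ssub_unit F (osys_zero ssub_unit)) = F"
proof -
  interpret monoidal_category SSub_int by (rule monoidal_category_SSub_int)
  note l = ssub_left_unitor[OF a] and r = ssub_right_unitor[OF a]
  note A = is_ssubD(2)[OF a] and P = smooth_imp_atlas_manifold[OF point_manifold]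
  note z = osys_zero_in[OF is_ssub_unit]
  have pt: "osys_zero ssub_unit Pt \<in> tangent_points point_manifold"
    using open_systemD(5)[OF is_ssub_unit z, of Pt] by simp
  show "osys_pullback (inverse_arrow SSub_int (left_unitor SSub_int a))
      (osys_prod ssub_unit a (osys_zero ssub_unit) F) = F"
    unfolding SSub_int_simps inverse_arrow_eq[OF l(3)]
  proof (rule osys_pullback_mk_eqI[OF l(2)]; (simp only: ssub_prod_simps ssub_unit_simps)?)
    show "smooth_map (state a) (prod_manifold point_manifold (state a)) (Tup Pt)"
      by (rule smooth_Tup[OF P A A smooth_map_point[OF A] smooth_map_id[OF A]])
    show "osys_prod ssub_unit a (osys_zero ssub_unit) F \<in> open_systems (ssub_prod ssub_unit a)"
      by (rule osys_prod_in[OF is_ssub_unit a z F])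
    show "tangent_map (state a) (prod_manifold point_manifold (state a)) (Tup Pt) (F q) =
        osys_prod ssub_unit a (osys_zero ssub_unit) F (Tup Pt q)" if "q \<in> points (total a)" for q
      using tangent_map_Tup_Pt(1)[OF A open_systemD(5)[OF a F that] pt] that by (simp add: osys_prod_Tup)
  qed (rule F)
  show "osys_pullback (inverse_arrow SSub_int (right_unitor SSub_int a))
      (osys_prod a ssub_unit F (osys_zero ssub_unit)) = F"
    unfolding SSub_int_simps inverse_arrow_eq[OF r(3)]
  proof (rule osys_pullback_mk_eqI[OF r(2)]; (simp only: ssub_prod_simps ssub_unit_simps)?)
    show "smooth_map (state a) (prod_manifold (state a) point_manifold) (\<lambda>x. Tup x Pt)"
      by (rule smooth_Tup[OF A P A smooth_map_id[OF A] smooth_map_point[OF A]])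
    show "osys_prod a ssub_unit F (osys_zero ssub_unit) \<in> open_systems (ssub_prod a ssub_unit)"
      by (rule osys_prod_in[OF a is_ssub_unit F z])
    show "tangent_map (state a) (prod_manifold (state a) point_manifold) (\<lambda>x. Tup x Pt) (F q) =
        osys_prod a ssub_unit F (osys_zero ssub_unit) (Tup q Pt)" if "q \<in> points (total a)" for q
      using tangent_map_Tup_Pt(2)[OF A open_systemD(5)[OF a F that] pt] that by (simp add: osys_prod_Tup)
  qed (rule F)
qed

text \<open>\<open>Crl_arr\<close> takes its source and target from the arrow, and for the structure
  arrows of the opposite category these are hidden behind \<open>inverse_arrow\<close>.\<close>

lemma inverse_structure_source_target:
  assumes "is_ssub a" "is_ssub b" "is_ssub c"
  shows "source (inverse_arrow SSub_int (associator SSub_int a b c)) = ssub_prod a (ssub_prod b c)"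
    "target (inverse_arrow SSub_int (associator SSub_int a b c)) = ssub_prod (ssub_prod a b) c"
    "source (inverse_arrow SSub_int (left_unitor SSub_int a)) = a"
    "target (inverse_arrow SSub_int (left_unitor SSub_int a)) = ssub_prod ssub_unit a"
    "source (inverse_arrow SSub_int (right_unitor SSub_int a)) = a"
    "target (inverse_arrow SSub_int (right_unitor SSub_int a)) = ssub_prod a ssub_unit"
proof -
  interpret monoidal_category SSub_int by (rule monoidal_category_SSub_int)
  show "source (inverse_arrow SSub_int (associator SSub_int a b c)) = ssub_prod a (ssub_prod b c)"
    "target (inverse_arrow SSub_int (associator SSub_int a b c)) = ssub_prod (ssub_prod a b) c"
    "source (inverse_arrow SSub_int (left_unitor SSub_int a)) = a"
    "target (inverse_arrow SSub_int (left_unitor SSub_int a)) = ssub_prod ssub_unit a"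
    "source (inverse_arrow SSub_int (right_unitor SSub_int a)) = a"
    "target (inverse_arrow SSub_int (right_unitor SSub_int a)) = ssub_prod a ssub_unit"
    unfolding SSub_int_simps inverse_arrow_eq[OF ssub_associator(3)[OF assms]]
      inverse_arrow_eq[OF ssub_left_unitor(3)[OF assms(1)]] inverse_arrow_eq[OF ssub_right_unitor(3)[OF assms(1)]]
    by simp_all
qed

theorem lemma4p1:
  shows "\<exists>\<epsilon> \<mu>. lax_monoidal_functor
           (opposite (SSub_int :: ('p ssub, 'p ssub_arrow) monoidal))
           (Vect :: ('p osys vect, 'p osys vect_arrow) monoidal)
           Crl Crl_arr \<epsilon> \<mu>"
proof (intro exI)
  show "lax_monoidal_functor
           (opposite (SSub_int :: ('p ssub, 'p ssub_arrow) monoidal))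
           (Vect :: ('p osys vect, 'p osys vect_arrow) monoidal)
           Crl Crl_arr Crl_unit Crl_mult"
  proof (intro lax_monoidal_functor.intro lax_monoidal_functor_axioms.intro category_functor_Crl
      monoidal_category_opposite[OF monoidal_category_SSub_int] monoidal_category_Vect;
      (simp only: opposite_simps hom_set_opposite)?)
    show "Crl_unit \<in> hom_set Vect (unit Vect) (Crl (unit SSub_int))"
      using Crl_unit_in_hom by simp
    fix a b :: "'p ssub" assume ob: "a \<in> Obj SSub_int" "b \<in> Obj SSub_int"
    then have a: "is_ssub a" and b: "is_ssub b" by simp_all
    show "Crl_mult a b \<in> hom_set Vect (Crl a \<boxtimes>\<^bsub>Vect\<^esub> Crl b) (Crl (a \<boxtimes>\<^bsub>SSub_int\<^esub> b))"
      using Crl_mult_in_hom[OF a b] by simp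
    fix c :: "'p ssub" assume "c \<in> Obj SSub_int"
    then have c: "is_ssub c" by simp
    show "Crl_arr (inverse_arrow SSub_int (associator SSub_int a b c)) \<cdot>\<^bsub>Vect\<^esub>
        Crl_mult (a \<boxtimes>\<^bsub>SSub_int\<^esub> b) c \<cdot>\<^bsub>Vect\<^esub> (Crl_mult a b \<boxdot>\<^bsub>Vect\<^esub> Ide Vect (Crl c)) =
      Crl_mult a (b \<boxtimes>\<^bsub>SSub_int\<^esub> c) \<cdot>\<^bsub>Vect\<^esub> (Ide Vect (Crl a) \<boxdot>\<^bsub>Vect\<^esub> Crl_mult b c) \<cdot>\<^bsub>Vect\<^esub>
        associator Vect (Crl a) (Crl b) (Crl c)"
      \<comment> \<open>Deleting \<open>SSub_int_simps(10)\<close> keeps the associator folded, so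
        that these facts still match. The unit laws and naturality below treat the unitors and the
        tensor of arrows in the same way.\<close>
      using inverse_structure_source_target(1,2)[OF a b c] osys_pullback_associator[OF a b c]
        osys_prod_in[OF a b] osys_prod_in[OF b c] osys_prod_in[OF is_ssub_prod[OF a b] c]
      by (auto intro!: mk_vect_arrow_cong elim!: tup_timesE simp del: SSub_int_simps(10))
  next
    fix a :: "'p ssub" assume "a \<in> Obj SSub_int"
    then have a: "is_ssub a" by simp
    have z: "osys_zero (ssub_unit :: 'p ssub) \<in> open_systems ssub_unit"
      by (rule osys_zero_in[OF is_ssub_unit])
    show "Crl_arr (inverse_arrow SSub_int (left_unitor SSub_int a)) \<cdot>\<^bsub>Vect\<^esub>
        Crl_mult (unit SSub_int) a \<cdot>\<^bsub>Vect\<^esub> (Crl_unit \<boxdot>\<^bsub>Vect\<^esub> Ide Vect (Crl a)) = left_unitor Vect (Crl a)"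
      using inverse_structure_source_target(3,4)[OF a a a] osys_pullback_unitors(1)[OF a]
        z osys_prod_in[OF is_ssub_unit a]
      by (auto intro!: mk_vect_arrow_cong elim!: tup_timesE simp del: SSub_int_simps(11))
    show "Crl_arr (inverse_arrow SSub_int (right_unitor SSub_int a)) \<cdot>\<^bsub>Vect\<^esub>
        Crl_mult a (unit SSub_int) \<cdot>\<^bsub>Vect\<^esub> (Ide Vect (Crl a) \<boxdot>\<^bsub>Vect\<^esub> Crl_unit) = right_unitor Vect (Crl a)"
      using inverse_structure_source_target(5,6)[OF a a a] osys_pullback_unitors(2)[OF a]
        z osys_prod_in[OF a is_ssub_unit]
      by (auto intro!: mk_vect_arrow_cong elim!: tup_timesE simp del: SSub_int_simps(12))
  next
    \<comment> \<open>An arrow of the opposite category from \<open>a\<close> to \<open>a'\<close>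
      is an interconnection from \<open>a'\<close> to \<open>a\<close>, so \<open>f\<close> and
      \<open>g\<close> run from the primed objects.\<close>
    fix f g :: "'p ssub_arrow" and a a' b b' :: "'p ssub"
    assume "f \<in> hom_set SSub_int a' a" "g \<in> hom_set SSub_int b' b"
    then have f: "interconnection f" "source f = a'" "target f = a"
      and g: "interconnection g" "source g = b'" "target g = b" by (auto simp: hom_SSub_int)
    note n = osys_prod_natural[OF f(1) g(1), unfolded f(2,3) g(2,3)]
    have st: "source (f \<boxdot>\<^bsub>SSub_int\<^esub> g) = ssub_prod a' b'" "target (f \<boxdot>\<^bsub>SSub_int\<^esub> g) = ssub_prod a b"
      using f g by simp_all
    have ab: "is_ssub a" "is_ssub b"
      using ssub_arrowD(2)[OF interconnection_ssub_arrow] f g by auto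
    show "Crl_mult a' b' \<cdot>\<^bsub>Vect\<^esub> (Crl_arr f \<boxdot>\<^bsub>Vect\<^esub> Crl_arr g) =
        Crl_arr (f \<boxdot>\<^bsub>SSub_int\<^esub> g) \<cdot>\<^bsub>Vect\<^esub> Crl_mult a b"
      using osys_pullback_in(1)[OF f(1)] osys_pullback_in(1)[OF g(1)] f g st n osys_prod_in[OF ab]
      by (auto intro!: mk_vect_arrow_cong elim!: tup_timesE simp del: SSub_int_simps(8))
  qed
qed

end
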